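(* Let $\rho$ be a state on $S$, $C$ a finite-dimensional catalytic system with state $c$, and $\Lambda$ a covariant operation from $S\otimes C$ to $S'\otimes C$ such that $\mathrm{Tr}_{S'}[\Lambda(\rho\otimes c)]=c$. Let $\rho'=\mathrm{Tr}_C[\Lambda(\rho\otimes c)]$. Then $\mathcal{C}'(\rho')\subseteq\mathcal{C}'(\rho)$. Equivalently, if $\mathcal{C}'(\rho')\not\subseteq\mathcal{C}'(\rho)$, there is no correlated-catalytic covariant transformation from $\rho$ to $\rho'$.
   Context: All systems are finite-dimensional quantum systems $X$ with Hamiltonians $H_X$; composites carry the sum Hamiltonian. A channel $\Lambda:X\to Y$ is covariant if $\Lambda(e^{-iH_Xt}\sigma e^{iH_Xt})=e^{-iH_Yt}\Lambda(\sigma)e^{iH_Yt}$ for all states $\sigma$ and $t\in\mathbb{R}$. Writing $H_X=\sum_kE_k\Pi_k$ (distinct eigenvalues, spectral projectors), $\mathcal{D}(\sigma)=\{E_k-E_l:\Pi_k\sigma\Pi_l\ne0\}$, and the set of rational coherent modes $\mathcal{C}'(\sigma)$ is the set of all finite linear combinations with rational coefficients of elements of $\mathcal{D}(\sigma)$. *)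

theory Defs
  imports Complex_Main "Jordan_Normal_Form.Matrix"
begin

definition adj :: "complex mat \<Rightarrow> complex mat" where
  "adj A = mat (dim_col A) (dim_row A) (\<lambda>(i,j). cnj (A $$ (j,i)))"

definition mtrace :: "complex mat \<Rightarrow> complex" where
  "mtrace A = (\<Sum>i<dim_row A. A $$ (i,i))"

definition hermitian :: "nat \<Rightarrow> complex mat \<Rightarrow> bool" where
  "hermitian n H \<longleftrightarrow> H \<in> carrier_mat n n \<and> adj H = H"

definition cinner :: "complex vec \<Rightarrow> complex vec \<Rightarrow> complex" where
  "cinner v w = (\<Sum>i<dim_vec v. cnj (v $ i) * w $ i)"

definition psd :: "nat \<Rightarrow> complex mat \<Rightarrow> bool" where
  "psd n A \<longleftrightarrow> hermitian n A \<and>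
     (\<forall>v \<in> carrier_vec n. Im (cinner v (A *\<^sub>v v)) = 0 \<and> Re (cinner v (A *\<^sub>v v)) \<ge> 0)"

definition is_state :: "nat \<Rightarrow> complex mat \<Rightarrow> bool" where
  "is_state n \<rho> \<longleftrightarrow> psd n \<rho> \<and> mtrace \<rho> = 1"

text \<open>Kronecker (tensor) product; index (i,k) of A\<otimes>B is i * dim B + k.\<close>
definition kron :: "complex mat \<Rightarrow> complex mat \<Rightarrow> complex mat" where
  "kron A B = mat (dim_row A * dim_row B) (dim_col A * dim_col B)
     (\<lambda>(i,j). A $$ (i div dim_row B, j div dim_col B) * B $$ (i mod dim_row B, j mod dim_col B))"

definition ptrace2 :: "nat \<Rightarrow> nat \<Rightarrow> complex mat \<Rightarrow> complex mat" where
  "ptrace2 dA dB M = mat dA dA (\<lambda>(i,j). \<Sum>k<dB. M $$ (i * dB + k, j * dB + k))"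

definition ptrace1 :: "nat \<Rightarrow> nat \<Rightarrow> complex mat \<Rightarrow> complex mat" where
  "ptrace1 dA dB M = mat dB dB (\<lambda>(i,j). \<Sum>k<dA. M $$ (k * dB + i, k * dB + j))"

definition comp_ham :: "complex mat \<Rightarrow> complex mat \<Rightarrow> complex mat" where
  "comp_ham HA HB = kron HA (1\<^sub>m (dim_row HB)) + kron (1\<^sub>m (dim_row HA)) HB"

definition lin_map :: "nat \<Rightarrow> nat \<Rightarrow> (complex mat \<Rightarrow> complex mat) \<Rightarrow> bool" where
  "lin_map n m \<Lambda> \<longleftrightarrow>
     (\<forall>X \<in> carrier_mat n n. \<Lambda> X \<in> carrier_mat m m) \<and>
     (\<forall>X \<in> carrier_mat n n. \<forall>Y \<in> carrier_mat n n. \<Lambda> (X + Y) = \<Lambda> X + \<Lambda> Y) \<and>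
     (\<forall>X \<in> carrier_mat n n. \<forall>a. \<Lambda> (a \<cdot>\<^sub>m X) = a \<cdot>\<^sub>m \<Lambda> X)"

text \<open>(id_k \<otimes> \<Lambda>) applied to a (k*n)x(k*n) matrix, acting blockwise.\<close>
definition ext_map :: "nat \<Rightarrow> nat \<Rightarrow> nat \<Rightarrow> (complex mat \<Rightarrow> complex mat) \<Rightarrow> complex mat \<Rightarrow> complex mat" where
  "ext_map k n m \<Lambda> X = mat (k * m) (k * m) (\<lambda>(i,j).
      \<Lambda> (mat n n (\<lambda>(p,q). X $$ ((i div m) * n + p, (j div m) * n + q))) $$ (i mod m, j mod m))"

definition is_channel :: "nat \<Rightarrow> nat \<Rightarrow> (complex mat \<Rightarrow> complex mat) \<Rightarrow> bool" where
  "is_channel n m \<Lambda> \<longleftrightarrow> lin_map n m \<Lambda> \<and>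
     (\<forall>X \<in> carrier_mat n n. mtrace (\<Lambda> X) = mtrace X) \<and>
     (\<forall>k X. psd (k * n) X \<longrightarrow> psd (k * m) (ext_map k n m \<Lambda> X))"

definition mat_exp :: "complex mat \<Rightarrow> complex mat" where
  "mat_exp A = mat (dim_row A) (dim_col A) (\<lambda>(i,j). \<Sum>p. (A ^\<^sub>m p) $$ (i,j) / of_nat (fact p))"

definition evolve :: "complex mat \<Rightarrow> real \<Rightarrow> complex mat \<Rightarrow> complex mat" where
  "evolve H t \<sigma> = mat_exp ((- \<i> * of_real t) \<cdot>\<^sub>m H) * \<sigma> * mat_exp ((\<i> * of_real t) \<cdot>\<^sub>m H)"

definition covariant :: "nat \<Rightarrow> complex mat \<Rightarrow> nat \<Rightarrow> complex mat \<Rightarrow> (complex mat \<Rightarrow> complex mat) \<Rightarrow> bool" where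
  "covariant n HX m HY \<Lambda> \<longleftrightarrow>
     (\<forall>\<sigma> t. is_state n \<sigma> \<longrightarrow> \<Lambda> (evolve HX t \<sigma>) = evolve HY t (\<Lambda> \<sigma>))"

definition spec :: "complex mat \<Rightarrow> real set" where
  "spec H = {E. \<exists>v \<in> carrier_vec (dim_row H). v \<noteq> 0\<^sub>v (dim_row H) \<and> H *\<^sub>v v = of_real E \<cdot>\<^sub>v v}"

definition eigproj :: "complex mat \<Rightarrow> real \<Rightarrow> complex mat" where
  "eigproj H E = (THE P. P \<in> carrier_mat (dim_row H) (dim_row H) \<and> P * P = P \<and> adj P = P \<and>
      (\<forall>v \<in> carrier_vec (dim_row H). P *\<^sub>v v = v \<longleftrightarrow> H *\<^sub>v v = of_real E \<cdot>\<^sub>v v))"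

definition modes :: "complex mat \<Rightarrow> complex mat \<Rightarrow> real set" where
  "modes H \<sigma> = {E - F | E F. E \<in> spec H \<and> F \<in> spec H \<and>
      eigproj H E * \<sigma> * eigproj H F \<noteq> 0\<^sub>m (dim_row H) (dim_row H)}"

definition rat_modes :: "complex mat \<Rightarrow> complex mat \<Rightarrow> real set" where
  "rat_modes H \<sigma> = {x. \<exists>F q. finite F \<and> F \<subseteq> modes H \<sigma> \<and> x = (\<Sum>d\<in>F. of_rat (q d) * d)}"

end

theory Submission
  imports Defs
begin

text \<open>
  Let \<open>V\<close> be the rational span of the modes of \<open>\<rho>\<close>. Modulo \<open>V\<close> the state \<open>\<rho>\<close> is invariant, so feeding
  it into \<open>\<Lambda>\<close> leaves a channel \<open>C \<rightarrow> S' \<otimes> C\<close> with Kraus operators \<open>A\<^sub>j\<close>, \<open>j = (r, s)\<close>, where \<open>s\<close> labels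
  the energy basis of \<open>S'\<close>; it is covariant modulo \<open>V\<close>. The reduced channel on \<open>C\<close> fixes \<open>c\<close>, hence also
  the block part \<open>c\<^sub>0\<close> of \<open>c\<close> with modes in \<open>V\<close>, and after restricting to its support \<open>c\<^sub>0\<close> is faithful.
  Let \<open>T X = \<Sum>j. A\<^sub>j\<^sup>* X A\<^sub>j\<close> be the dual map. As \<open>T\<close> preserves a faithful state, a fixed point \<open>X\<close> of \<open>T\<close>
  commutes with every \<open>A\<^sub>j\<close> and \<open>A\<^sub>j\<^sup>*\<close>.

  The \<open>(s, s')\<close> entry of \<open>\<rho>'\<close> is \<open>tr (c Y)\<close> with \<open>Y = \<Sum>r. A\<^bsub>(r,s')\<^esub>\<^sup>* A\<^bsub>(r,s)\<^esub>\<close>. A limit \<open>Z\<close> of Cesaro means of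
  the \<open>T\<^sup>k Y\<close> is a fixed point of \<open>T\<close> with \<open>tr (c Z) = tr (c Y)\<close>. Being built from \<open>Y\<close>, it commutes with
  whatever commutes with all \<open>A\<^sub>j\<close> and \<open>A\<^sub>j\<^sup>*\<close>, in particular with \<open>Z\<^sup>*\<close>. Thus \<open>Z\<close> is normal, and its modes lie
  in one coset \<open>w + V\<close> with \<open>w = \<epsilon>\<^sub>s\<^sub>' - \<epsilon>\<^sub>s\<close>. If \<open>w \<notin> V\<close>, then \<open>Z\<close> moves energies along cosets that never repeat, so it is
  nilpotent, and a normal nilpotent matrix vanishes.
\<close>

section \<open>Hermitian matrices\<close>

text \<open>The catalyst state \<open>c\<close> may have modes outside \<open>V\<close>, and
  precisely these pair with \<open>Y\<close> in tr (c Y), so \<open>c\<close> cannot be replaced by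
  its block part there. The eigenvectors of \<open>c\<close>, in turn, have in general no definite
  energy, even modulo \<open>V\<close>. Hence two matrices are used: \<open>c\<close> for the
  expectation, and its block part, whose eigenbasis and support respect the cosets of
  \<open>V\<close>, for the weights that make the dual map a contraction. Positivity of
  \<open>c\<close> ensures that restricting to the support of the block part loses nothing of
  \<open>c\<close>. A single Kraus operator need not shift energies by a definite amount. Only sums
  over the environment label of one operator times the conjugate of another do, which is why every
  mode hypothesis is about such a sum. Rational coefficients enter where a chain of nonzero entries
  of \<open>Z\<close> closes up: after m steps it yields m w in \<open>V\<close>, and w in
  \<open>V\<close> only follows if \<open>V\<close> admits division by m.\<close>

lemma bounded_real_convergent_subseq:
  fixes f :: "nat \<Rightarrow> real"
  assumes "\<And>n. \<bar>f n\<bar> \<le> B"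
  shows "\<exists>r l. strict_mono r \<and> (\<lambda>n. f (r n)) \<longlonglongrightarrow> l"
proof -
  obtain r :: "nat \<Rightarrow> nat" where r: "strict_mono r" "monoseq (\<lambda>n. f (r n))"
    using seq_monosub by blast
  have "Bseq (\<lambda>n. f (r n))" using assms by (intro BseqI'[of _ B]) auto
  then have "convergent (\<lambda>n. f (r n))" using r(2) Bseq_monoseq_convergent by blast
  then show ?thesis using r(1) unfolding convergent_def by blast
qed

lemma bounded_complex_convergent_subseq:
  fixes f :: "nat \<Rightarrow> complex"
  assumes "\<And>n. cmod (f n) \<le> B"
  shows "\<exists>r l. strict_mono r \<and> (\<lambda>n. f (r n)) \<longlonglongrightarrow> l"
proof -
  have "\<And>n. \<bar>Re (f n)\<bar> \<le> B" using assms abs_Re_le_cmod order_trans by blast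
  then obtain r a where r: "strict_mono r" "(\<lambda>n. Re (f (r n))) \<longlonglongrightarrow> a"
    using bounded_real_convergent_subseq[of "\<lambda>n. Re (f n)"] by blast
  have "\<And>n. \<bar>Im (f (r n))\<bar> \<le> B" using assms abs_Im_le_cmod order_trans by blast
  then obtain s b where s: "strict_mono s" "(\<lambda>n. Im (f (r (s n)))) \<longlonglongrightarrow> b"
    using bounded_real_convergent_subseq[of "\<lambda>n. Im (f (r n))"] by blast
  have "(\<lambda>n. Re (f (r (s n)))) \<longlonglongrightarrow> a"
    using LIMSEQ_subseq_LIMSEQ[OF r(2) s(1)] by (simp add: o_def)
  then have "(\<lambda>n. f (r (s n))) \<longlonglongrightarrow> Complex a b"
    using s(2) by (simp add: tendsto_complex_iff)
  moreover have "strict_mono (\<lambda>n. r (s n))" using strict_mono_o[OF r(1) s(1)] by (simp add: o_def)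
  ultimately show ?thesis by blast
qed

text \<open>Each further coordinate costs one more passage to a subsequence, which keeps the limits
  already obtained. This finite-dimensional compactness yields both the maximiser of the Rayleigh
  quotient and the limit of the Cesaro means.\<close>

lemma bounded_family_convergent_subseq:
  fixes f :: "nat \<Rightarrow> 'i \<Rightarrow> complex"
  assumes "finite I" "\<And>i n. i \<in> I \<Longrightarrow> cmod (f n i) \<le> B i"
  shows "\<exists>r l. strict_mono r \<and> (\<forall>i\<in>I. (\<lambda>n. f (r n) i) \<longlonglongrightarrow> l i)"
  using assms
proof (induction I rule: finite_induct)
  case empty
  show ?case using strict_mono_id by blast
next
  case (insert j I)
  then obtain r l where r: "strict_mono r" "\<forall>i\<in>I. (\<lambda>n. f (r n) i) \<longlonglongrightarrow> l i" by auto
  obtain s m where s: "strict_mono s" "(\<lambda>n. f (r (s n)) j) \<longlonglongrightarrow> m"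
    using bounded_complex_convergent_subseq[of "\<lambda>n. f (r n) j" "B j"] insert.prems by blast
  have "\<forall>i\<in>I. (\<lambda>n. f (r (s n)) i) \<longlonglongrightarrow> l i"
    using r(2) LIMSEQ_subseq_LIMSEQ[OF _ s(1)] by (fastforce simp: o_def)
  then have "\<forall>i\<in>insert j I. (\<lambda>n. f (r (s n)) i) \<longlonglongrightarrow> (l(j := m)) i"
    using s(2) insert.hyps(2) by auto
  moreover have "strict_mono (\<lambda>n. r (s n))" using strict_mono_o[OF r(1) s(1)] by (simp add: o_def)
  ultimately show ?case by blast
qed

section \<open>Eigenvectors from the Rayleigh quotient\<close>

text \<open>Subspaces are given by linear equations because these pass to limits coordinate by
  coordinate; the zeros from \<open>n\<close> on make a vector of dimension \<open>n\<close> a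
  function on all naturals.\<close>

definition solution_space :: "nat \<Rightarrow> (nat \<Rightarrow> complex) set \<Rightarrow> (nat \<Rightarrow> complex) set" where
  "solution_space n F = {x. (\<forall>i\<ge>n. x i = 0) \<and> (\<forall>c\<in>F. (\<Sum>i<n. c i * x i) = 0)}"

lemma hermitian_form_cnj:
  fixes A :: "nat \<Rightarrow> nat \<Rightarrow> complex"
  assumes "\<And>i j. i < n \<Longrightarrow> j < n \<Longrightarrow> A j i = cnj (A i j)"
  shows "cnj (\<Sum>i<n. \<Sum>j<n. cnj (y i) * A i j * x j) = (\<Sum>i<n. \<Sum>j<n. cnj (x i) * A i j * y j)"
proof -
  have "cnj (\<Sum>i<n. \<Sum>j<n. cnj (y i) * A i j * x j) = (\<Sum>i<n. \<Sum>j<n. y i * cnj (A i j) * cnj (x j))"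
    by simp
  also have "\<dots> = (\<Sum>j<n. \<Sum>i<n. y i * cnj (A i j) * cnj (x j))" by (rule sum.swap)
  also have "\<dots> = (\<Sum>j<n. \<Sum>i<n. cnj (x j) * A j i * y i)"
    using assms by (intro sum.cong refl) (metis lessThan_iff mult.commute mult.left_commute)
  finally show ?thesis .
qed

lemma norm_le_one_of_sum_squares:
  fixes x :: "nat \<Rightarrow> complex"
  assumes "(\<Sum>i<n. (cmod (x i))\<^sup>2) = 1" "i < n"
  shows "cmod (x i) \<le> 1"
proof -
  have "(cmod (x i))\<^sup>2 \<le> (\<Sum>i<n. (cmod (x i))\<^sup>2)"
    using assms(2) by (intro member_le_sum) auto
  then show ?thesis using assms(1) by (simp add: abs_square_le_1)
qed

text \<open>For small \<open>e\<close> a positive \<open>a\<close> would make the linear term win.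
  This serves as the first-order condition at a maximum of the Rayleigh quotient.\<close>

lemma quadratic_nonneg_linear_zero:
  fixes a b :: real
  assumes "\<And>e. e > 0 \<Longrightarrow> 0 \<le> - 2 * e * a + e\<^sup>2 * b" "a \<ge> 0"
  shows "a = 0"
proof (rule ccontr)
  assume "a \<noteq> 0"
  with assms(2) have a: "a > 0" by simp
  \<comment> \<open>This size gives \<open>e * b \<le> a\<close>, so the quadratic term cancels at
    most half of the linear one.\<close>
  define e where "e = a / (\<bar>b\<bar> + 1)"
  have e: "e > 0" using a by (simp add: e_def)
  have "e * (\<bar>b\<bar> + 1) = a" by (simp add: e_def add_nonneg_eq_0_iff)
  then have "e * b \<le> a" using e by (smt (verit) mult_left_mono)
  then have "e * (e * b) \<le> e * a" using e by simp
  moreover have "0 \<le> - 2 * e * a + e * (e * b)" using assms(1)[OF e] by (simp add: power2_eq_square mult_ac)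
  ultimately have "e * a \<le> 0" by linarith
  then show False using e a by (simp add: mult_le_0_iff)
qed

text \<open>A maximiser of the Rayleigh quotient on an invariant subspace is an eigenvector.\<close>
lemma hermitian_eigenvector_in_invariant_subspace:
  fixes A :: "nat \<Rightarrow> nat \<Rightarrow> complex"
  assumes herm: "\<And>i j. i < n \<Longrightarrow> j < n \<Longrightarrow> A j i = cnj (A i j)"
    and inv: "\<And>x. x \<in> solution_space n F \<Longrightarrow> (\<lambda>i. if i < n then \<Sum>j<n. A i j * x j else 0) \<in> solution_space n F"
    and x0: "x0 \<in> solution_space n F" "i0 < n" "x0 i0 \<noteq> 0"
  shows "\<exists>v \<mu>::real. v \<in> solution_space n F \<and> (\<Sum>i<n. (cmod (v i))\<^sup>2) = 1 \<and>
    (\<forall>i<n. (\<Sum>j<n. A i j * v j) = of_real \<mu> * v i)"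
proof -
  let ?W = "solution_space n F"
  define N :: "(nat \<Rightarrow> complex) \<Rightarrow> real" where "N x = (\<Sum>i<n. (cmod (x i))\<^sup>2)" for x
  define ip where "ip y x = (\<Sum>i<n. cnj (y i) * x i)" for y x :: "nat \<Rightarrow> complex"
  define q where "q y x = (\<Sum>i<n. \<Sum>j<n. cnj (y i) * A i j * x j)" for y x
  have lin: "(\<lambda>i. x i + z * y i) \<in> ?W" if "x \<in> ?W" "y \<in> ?W" for x y z
    using that by (auto simp: solution_space_def algebra_simps sum.distrib simp flip: sum_distrib_left)
  have scale: "(\<lambda>i. z * y i) \<in> ?W" if "y \<in> ?W" for y z
    using that by (auto simp: solution_space_def mult.left_commute simp flip: sum_distrib_left)
  have Nge: "N x \<ge> 0" for x unfolding N_def by (intro sum_nonneg) auto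
  have ipN: "ip x x = of_real (N x)" for x
    unfolding ip_def N_def of_real_sum
    by (intro sum.cong refl) (metis complex_norm_square mult.commute)
  have qc: "cnj (q y x) = q x y" for x y unfolding q_def by (rule hermitian_form_cnj[OF herm])
  have ipc: "cnj (ip y x) = ip x y" for x y by (simp add: ip_def mult.commute)
  define S where "S = {Re (q x x) | x. x \<in> ?W \<and> N x = 1}"
  define B where "B = (\<Sum>i<n. \<Sum>j<n. cmod (A i j))"
  have bd: "Re (q x x) \<le> B" if "N x = 1" for x
  proof -
    have "Re (q x x) \<le> cmod (q x x)" by (rule complex_Re_le_cmod)
    also have "\<dots> \<le> (\<Sum>i<n. \<Sum>j<n. cmod (cnj (x i) * A i j * x j))"
      unfolding q_def by (intro order_trans[OF norm_sum] sum_mono norm_sum)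
    also have "\<dots> \<le> B" unfolding B_def
    proof (intro sum_mono)
      fix i j assume "i \<in> {..<n}" "j \<in> {..<n}"
      then have "cmod (x i) \<le> 1" "cmod (x j) \<le> 1"
        using norm_le_one_of_sum_squares that unfolding N_def by blast+
      then have "cmod (x i) * cmod (x j) * cmod (A i j) \<le> 1 * cmod (A i j)"
        by (intro mult_right_mono mult_le_one) auto
      then show "cmod (cnj (x i) * A i j * x j) \<le> cmod (A i j)" by (simp add: norm_mult mult_ac)
    qed
    finally show ?thesis .
  qed
  have bdd: "bdd_above S" unfolding S_def using bd by (auto intro!: bdd_aboveI[of _ B])
  \<comment> \<open>Here \<open>normal\<close> means normalised: scaling \<open>y\<close> to unit
    length turns its Rayleigh quotient into a value of the form on the unit sphere.\<close>
  have normal: "(\<lambda>i. of_real (1 / sqrt (N y)) * y i) \<in> ?W \<and> N (\<lambda>i. of_real (1 / sqrt (N y)) * y i) = 1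
      \<and> Re (q (\<lambda>i. of_real (1 / sqrt (N y)) * y i) (\<lambda>i. of_real (1 / sqrt (N y)) * y i)) = Re (q y y) / N y"
    if "y \<in> ?W" "N y > 0" for y
  proof -
    let ?c = "1 / sqrt (N y)"
    have c: "?c * ?c = 1 / N y" using that(2) by simp
    have "N (\<lambda>i. of_real ?c * y i) = ?c\<^sup>2 * N y"
      unfolding N_def by (simp add: norm_mult power_mult_distrib norm_divide sum_divide_distrib power_divide)
    then have 1: "N (\<lambda>i. of_real ?c * y i) = 1" using that(2) c by (simp add: power2_eq_square)
    have "q (\<lambda>i. of_real ?c * y i) (\<lambda>i. of_real ?c * y i) = of_real (?c * ?c) * q y y"
      unfolding q_def sum_distrib_left by (intro sum.cong refl) (simp only: complex_cnj_mult complex_cnj_complex_of_real of_real_mult mult_ac)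
    then have "Re (q (\<lambda>i. of_real ?c * y i) (\<lambda>i. of_real ?c * y i)) = ?c * ?c * Re (q y y)" by simp
    then have "Re (q (\<lambda>i. of_real ?c * y i) (\<lambda>i. of_real ?c * y i)) = Re (q y y) / N y"
      unfolding c by simp
    then show ?thesis using 1 scale[OF that(1)] by blast
  qed
  have "N x0 > 0" 
  proof -
    have "(cmod (x0 i0))\<^sup>2 \<le> N x0" unfolding N_def using x0(2) by (intro member_le_sum) auto
    then show ?thesis using x0(3) by (smt (verit) zero_less_norm_iff zero_less_power)
  qed
  then have "S \<noteq> {}" using normal[OF x0(1)] unfolding S_def by blast
  define M where "M = Sup S"
  have "\<exists>x. x \<in> ?W \<and> N x = 1 \<and> Re (q x x) > M - 1 / Suc k" for k
  proof -
    have "\<exists>s\<in>S. M - 1 / Suc k < s" unfolding M_def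
      using less_cSup_iff[OF \<open>S \<noteq> {}\<close> bdd, of "Sup S - 1 / Suc k"] by simp
    then show ?thesis unfolding S_def by blast
  qed
  then obtain X where X: "\<And>k. X k \<in> ?W" "\<And>k. N (X k) = 1" "\<And>k. Re (q (X k) (X k)) > M - 1 / Suc k"
    by metis
  have "cmod (X k i) \<le> 1" if "i \<in> {..<n}" for i k
    using norm_le_one_of_sum_squares X(2) that unfolding N_def by blast
  then obtain r l where r: "strict_mono r" "\<forall>i\<in>{..<n}. (\<lambda>k. X (r k) i) \<longlonglongrightarrow> l i"
    using bounded_family_convergent_subseq[of "{..<n}" X "\<lambda>_. 1"] by auto
  define v where "v i = (if i < n then l i else 0)" for i
  have lim: "(\<lambda>k. X (r k) i) \<longlonglongrightarrow> v i" if "i < n" for i using r(2) that by (simp add: v_def)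
  have vW: "v \<in> ?W"
  proof -
    have "(\<Sum>i<n. c i * v i) = 0" if "c \<in> F" for c
    proof -
      have "(\<lambda>k. \<Sum>i<n. c i * X (r k) i) \<longlonglongrightarrow> (\<Sum>i<n. c i * v i)"
        by (intro tendsto_intros lim) auto
      moreover have "(\<lambda>k. \<Sum>i<n. c i * X (r k) i) = (\<lambda>k. 0)"
        using X(1) that by (auto simp: solution_space_def)
      ultimately show ?thesis using LIMSEQ_unique tendsto_const by metis
    qed
    then show ?thesis by (auto simp: solution_space_def v_def)
  qed
  have Nv: "N v = 1"
  proof -
    have "(\<lambda>k. N (X (r k))) \<longlonglongrightarrow> N v" unfolding N_def by (intro tendsto_intros lim) auto
    then show ?thesis using X(2) LIMSEQ_unique tendsto_const by (metis (no_types, lifting) ext)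
  qed
  have qv: "M \<le> Re (q v v)"
  proof -
    have a: "(\<lambda>k. Re (q (X (r k)) (X (r k)))) \<longlonglongrightarrow> Re (q v v)"
      unfolding q_def by (intro tendsto_intros lim) auto
    have b: "(\<lambda>k. M - 1 / Suc (r k)) \<longlonglongrightarrow> M - 0"
      using LIMSEQ_subseq_LIMSEQ[OF LIMSEQ_inverse_real_of_nat r(1)]
      by (intro tendsto_intros) (simp add: o_def inverse_eq_divide)
    show ?thesis using LIMSEQ_le[OF b a] X(3) less_imp_le by auto
  qed
  have qle: "Re (q y y) \<le> M * N y" if "y \<in> ?W" for y
  proof (cases "N y > 0")
    case True
    have "Re (q y y) / N y \<in> S" using normal[OF that True] unfolding S_def mem_Collect_eq by metis
    then have "Re (q y y) / N y \<le> M" unfolding M_def by (rule cSup_upper[OF _ bdd])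
    then show ?thesis using True by (simp add: pos_divide_le_eq)
  next
    case False
    then have "N y = 0" using Nge[of y] by linarith
    then have "y i = 0" if "i < n" for i
      using that unfolding N_def by (subst (asm) sum_nonneg_eq_0_iff) auto
    then have "q y y = 0" unfolding q_def by simp
    then show ?thesis using \<open>N y = 0\<close> by simp
  qed
  \<comment> \<open>The residual \<open>M v - A v\<close>, which is to vanish; it stays in the
    subspace by invariance.\<close>
  define g where "g i = of_real M * v i + (-1) * (if i < n then \<Sum>j<n. A i j * v j else 0)" for i
  have gW: "g \<in> ?W" unfolding g_def by (intro lin scale inv vW)
  have gform: "ip w g = of_real M * ip w v - q w v" for w
  proof -
    have "ip w g = (\<Sum>i<n. of_real M * (cnj (w i) * v i) - (\<Sum>j<n. cnj (w i) * A i j * v j))"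
      unfolding ip_def g_def by (intro sum.cong refl) (simp add: algebra_simps sum_distrib_left sum_negf)
    then show ?thesis by (simp add: ip_def q_def sum_subtractf sum_distrib_left)
  qed
  \<comment> \<open>Compare \<open>v\<close> with the nearby vector \<open>v - e g\<close>: by
    \<open>qle\<close> the form \<open>M N - q\<close> is nonnegative there, and its first-order
    term is \<open>- 2 e N g\<close>.\<close>
  have "0 \<le> - 2 * e * N g + e\<^sup>2 * (M * N g - Re (q g g))" if "e > 0" for e :: real
  proof -
    define y where "y = (\<lambda>i. v i + of_real (- e) * g i)"
    have yW: "y \<in> ?W" unfolding y_def by (intro lin vW gW)
    have ipy: "ip y y = ip v v + of_real (-e) * (ip v g + ip g v) + of_real (e\<^sup>2) * ip g g"
      unfolding ip_def y_def sum_distrib_left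
      by (simp add: algebra_simps sum.distrib sum_distrib_left sum_negf sum_subtractf power2_eq_square)
    have qy: "q y y = q v v + of_real (-e) * (q v g + q g v) + of_real (e\<^sup>2) * q g g"
      unfolding q_def y_def sum_distrib_left
      by (simp add: algebra_simps sum.distrib sum_distrib_left sum_negf sum_subtractf power2_eq_square)
    have "0 \<le> M * N y - Re (q y y)" using qle[OF yW] by simp
    also have "M * N y = M * Re (ip y y)" using ipN by simp
    also have "M * Re (ip y y) - Re (q y y) = (M * Re (ip v v) - Re (q v v))
       - e * (Re (of_real M * ip v g - q v g) + Re (of_real M * ip g v - q g v)) + e\<^sup>2 * (M * Re (ip g g) - Re (q g g))"
      unfolding ipy qy by (simp add: algebra_simps)
    also have "of_real M * ip g v - q g v = of_real (N g)" using gform[of g] ipN by simp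
    also have "Re (of_real M * ip v g - q v g) = Re (cnj (of_real M * ip g v - q g v))"
      by (simp only: complex_cnj_diff complex_cnj_mult ipc qc complex_cnj_complex_of_real)
    also have "of_real M * ip g v - q g v = of_real (N g)" using gform[of g] ipN by simp
    also have "M * Re (ip v v) - Re (q v v) = M - Re (q v v)" using ipN[of v] Nv by simp
    finally have "0 \<le> M - Re (q v v) - 2 * e * N g + e\<^sup>2 * (M * N g - Re (q g g))"
      using ipN[of g] by (simp add: algebra_simps)
    then show ?thesis using qv by linarith
  qed
  then have "N g = 0" using quadratic_nonneg_linear_zero[of "N g"] Nge by blast
  then have "g i = 0" if "i < n" for i
    using that unfolding N_def by (subst (asm) sum_nonneg_eq_0_iff) auto
  then have "\<forall>i<n. (\<Sum>j<n. A i j * v j) = of_real M * v i" by (simp add: g_def)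
  then show ?thesis using vW Nv unfolding N_def by blast
qed

section \<open>Orthonormal systems and block diagonalisation\<close>

definition orthonormal :: "nat \<Rightarrow> nat \<Rightarrow> (nat \<Rightarrow> nat \<Rightarrow> complex) \<Rightarrow> bool" where
  "orthonormal n m v \<longleftrightarrow> (\<forall>k<m. \<forall>l<m. (\<Sum>i<n. cnj (v k i) * v l i) = (if k = l then 1 else 0))"

text \<open>\<open>Q\<close> is the orthogonal projector onto the complement of the span. Its trace
  \<open>n - m\<close> stands in for a dimension count: nonzero, it exhibits a vector with which to
  extend the system; zero, it proves completeness. The last claim is the diagonal of the identity
  adj(Q) Q = Q.\<close>

lemma orthonormal_residual:
  fixes v :: "nat \<Rightarrow> nat \<Rightarrow> complex"
  assumes on: "orthonormal n m v"
    and Q_def: "\<And>i j. Q i j = (if i = j then 1 else 0) - (\<Sum>k<m. v k i * cnj (v k j))"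
  shows "k < m \<Longrightarrow> j < n \<Longrightarrow> (\<Sum>i<n. cnj (v k i) * Q i j) = 0"
    and "(\<Sum>i<n. Q i i) = of_nat n - of_nat m"
    and "j < n \<Longrightarrow> of_real (\<Sum>i<n. (cmod (Q i j))\<^sup>2) = Q j j"
proof -
  show 1: "(\<Sum>i<n. cnj (v k i) * Q i j) = 0" if "k < m" "j < n" for k j
  proof -
    have "(\<Sum>i<n. cnj (v k i) * Q i j) =
        (\<Sum>i<n. cnj (v k i) * (if i = j then 1 else 0)) - (\<Sum>i<n. \<Sum>l<m. cnj (v k i) * v l i * cnj (v l j))"
      by (simp add: Q_def right_diff_distrib sum_subtractf sum_distrib_left mult.assoc)
    also have "(\<Sum>i<n. \<Sum>l<m. cnj (v k i) * v l i * cnj (v l j)) = (\<Sum>l<m. (\<Sum>i<n. cnj (v k i) * v l i) * cnj (v l j))"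
      by (subst sum.swap) (simp add: sum_distrib_right)
    also have "\<dots> = (\<Sum>l<m. (if k = l then 1 else 0) * cnj (v l j))"
      using on that(1) by (intro sum.cong refl) (simp add: orthonormal_def)
    also have "\<dots> = cnj (v k j)" using that(1) by (simp add: if_distrib[of "\<lambda>x. x * _"] cong: if_cong)
    also have "(\<Sum>i<n. cnj (v k i) * (if i = j then 1 else 0)) = cnj (v k j)"
      using that(2) by (simp add: if_distrib[of "\<lambda>x. _ * x"] cong: if_cong)
    finally show ?thesis by simp
  qed
  have "(\<Sum>i<n. Q i i) = of_nat n - (\<Sum>k<m. \<Sum>i<n. cnj (v k i) * v k i)"
    unfolding Q_def sum_subtractf by (subst (2) sum.swap) (simp add: mult.commute)
  also have "(\<Sum>k<m. \<Sum>i<n. cnj (v k i) * v k i) = of_nat m"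
    using on by (simp add: orthonormal_def)
  finally show "(\<Sum>i<n. Q i i) = of_nat n - of_nat m" .
  show "of_real (\<Sum>i<n. (cmod (Q i j))\<^sup>2) = Q j j" if "j < n" for j
  proof -
    have "of_real (\<Sum>i<n. (cmod (Q i j))\<^sup>2) = (\<Sum>i<n. cnj (Q i j) * Q i j)"
      unfolding of_real_sum by (intro sum.cong refl) (metis complex_norm_square mult.commute)
    also have "\<dots> = (\<Sum>i<n. (if i = j then 1 else 0) * Q i j - (\<Sum>k<m. v k j * (cnj (v k i) * Q i j)))"
    proof (intro sum.cong refl)
      fix i
      have "cnj (Q i j) = (if i = j then 1 else 0) - (\<Sum>k<m. v k j * cnj (v k i))"
        by (simp add: Q_def mult.commute)
      then show "cnj (Q i j) * Q i j = (if i = j then 1 else 0) * Q i j - (\<Sum>k<m. v k j * (cnj (v k i) * Q i j))"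
        by (simp only: left_diff_distrib sum_distrib_right mult.assoc)
    qed
    also have "\<dots> = Q j j - (\<Sum>k<m. v k j * (\<Sum>i<n. cnj (v k i) * Q i j))"
      unfolding sum_subtractf using that
      by (subst sum.swap) (simp add: if_distrib[of "\<lambda>x. x * _"] sum_distrib_left cong: if_cong)
    finally show ?thesis using 1 that by simp
  qed
qed

text \<open>The squared entries of the residual projector sum to its trace, which is
  \<open>n - n = 0\<close>.\<close>

lemma orthonormal_complete:
  assumes "orthonormal n n v" "i < n" "j < n"
  shows "(\<Sum>k<n. v k i * cnj (v k j)) = (if i = j then 1 else 0)"
proof -
  define Q where "Q i j = (if i = j then 1 else 0) - (\<Sum>k<n. v k i * cnj (v k j))" for i j
  note res = orthonormal_residual[OF assms(1) Q_def]
  have "complex_of_real (\<Sum>j<n. \<Sum>i<n. (cmod (Q i j))\<^sup>2) = (\<Sum>j<n. Q j j)"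
    unfolding of_real_sum[of _ "{..<n}"] using res(3) by (intro sum.cong refl) auto
  also have "\<dots> = 0" using res(2) by simp
  finally have "(\<Sum>j<n. \<Sum>i<n. (cmod (Q i j))\<^sup>2) = 0" using of_real_eq_0_iff by blast
  then have "(cmod (Q i j))\<^sup>2 = 0"
    using assms(2,3) by (simp add: sum_nonneg_eq_0_iff sum_nonneg)
  then show ?thesis by (simp add: Q_def)
qed

text \<open>Eigenvectors are added one at a time, each sought inside the orthogonal complement of
  the earlier ones and inside a single block; both constraints are linear equations preserved by
  \<open>A\<close>. The blocks will be the energy cosets of the catalyst, so that every eigenvector
  gets an energy modulo \<open>V\<close>.\<close>

theorem spectral_theorem_blocks:
  fixes A :: "nat \<Rightarrow> nat \<Rightarrow> complex" and \<kappa> :: "nat \<Rightarrow> 'b"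
  assumes herm: "\<And>i j. i < n \<Longrightarrow> j < n \<Longrightarrow> A j i = cnj (A i j)"
    and block: "\<And>i j. i < n \<Longrightarrow> j < n \<Longrightarrow> A i j \<noteq> 0 \<Longrightarrow> \<kappa> i = \<kappa> j"
  shows "\<exists>v \<mu>. orthonormal n n v \<and>
    (\<forall>k<n. \<forall>i<n. (\<Sum>j<n. A i j * v k j) = of_real (\<mu> k) * v k i) \<and>
    (\<forall>k<n. \<forall>i<n. \<forall>j<n. v k i \<noteq> 0 \<longrightarrow> v k j \<noteq> 0 \<longrightarrow> \<kappa> i = \<kappa> j)"
proof -
  have "\<exists>v \<mu>. orthonormal n m v \<and>
    (\<forall>k<m. \<forall>i<n. (\<Sum>j<n. A i j * v k j) = of_real (\<mu> k) * v k i) \<and>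
    (\<forall>k<m. \<forall>i<n. \<forall>j<n. v k i \<noteq> 0 \<longrightarrow> v k j \<noteq> 0 \<longrightarrow> \<kappa> i = \<kappa> j)" if "m \<le> n" for m
    using that
  proof (induction m)
    case 0
    show ?case by (simp add: orthonormal_def)
  next
    case (Suc m)
    then obtain v \<mu> where on: "orthonormal n m v"
      and eig: "\<And>k i. k < m \<Longrightarrow> i < n \<Longrightarrow> (\<Sum>j<n. A i j * v k j) = of_real (\<mu> k) * v k i"
      and cls: "\<And>k i j. k < m \<Longrightarrow> i < n \<Longrightarrow> j < n \<Longrightarrow> v k i \<noteq> 0 \<Longrightarrow> v k j \<noteq> 0 \<Longrightarrow> \<kappa> i = \<kappa> j"
      by (metis Suc_leD)
    define Q where "Q i j = (if i = j then 1 else 0) - (\<Sum>k<m. v k i * cnj (v k j))" for i j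
    note res = orthonormal_residual[OF on Q_def]
    have "(\<Sum>i<n. Q i i) \<noteq> 0" using res(2) Suc.prems by simp
    then obtain i0 where i0: "i0 < n" "Q i0 i0 \<noteq> 0" by (meson lessThan_iff sum.neutral)
    \<comment> \<open>The equations: orthogonality to the vectors found so far, and vanishing
      outside the block of \<open>i0\<close>.\<close>
    define F where "F = (\<lambda>k i. cnj (v k i)) ` {..<m} \<union> (\<lambda>a i. if i = a then 1 else 0) ` {a. a < n \<and> \<kappa> a \<noteq> \<kappa> i0}"
    have memF: "x \<in> solution_space n F \<longleftrightarrow> (\<forall>i\<ge>n. x i = 0) \<and> (\<forall>k<m. (\<Sum>i<n. cnj (v k i) * x i) = 0)
        \<and> (\<forall>a<n. \<kappa> a \<noteq> \<kappa> i0 \<longrightarrow> x a = 0)" for x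
    proof -
      have "(\<Sum>i<n. (if i = a then 1 else 0) * x i) = x a" if "a < n" for a
        using that by (simp add: if_distrib[of "\<lambda>y. y * _"] cong: if_cong)
      moreover have "(\<forall>c\<in>F. (\<Sum>i<n. c i * x i) = 0) \<longleftrightarrow> (\<forall>k<m. (\<Sum>i<n. cnj (v k i) * x i) = 0)
          \<and> (\<forall>a. a < n \<and> \<kappa> a \<noteq> \<kappa> i0 \<longrightarrow> (\<Sum>i<n. (if i = a then 1 else 0) * x i) = 0)"
        unfolding F_def ball_Un ball_simps by blast
      ultimately show ?thesis unfolding solution_space_def by simp blast
    qed
    \<comment> \<open>Column \<open>i0\<close> of the residual projector starts the search: it is
      orthogonal to the earlier vectors, nonzero at \<open>i0\<close>, and lives in the block of
      \<open>i0\<close> since no earlier vector meets two blocks.\<close>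
    define x0 where "x0 i = (if i < n then Q i i0 else 0)" for i
    have "x0 a = 0" if "a < n" "\<kappa> a \<noteq> \<kappa> i0" for a
    proof -
      have "v k a = 0 \<or> v k i0 = 0" if "k < m" for k
        using cls[OF that \<open>a < n\<close> i0(1)] \<open>\<kappa> a \<noteq> \<kappa> i0\<close> by blast
      then have "(\<Sum>k<m. v k a * cnj (v k i0)) = 0" by (intro sum.neutral) auto
      then show ?thesis using that by (auto simp: x0_def Q_def)
    qed
    then have x0: "x0 \<in> solution_space n F" unfolding memF using res(1)[OF _ i0(1)] by (simp add: x0_def)
    have inv: "(\<lambda>i. if i < n then \<Sum>j<n. A i j * x j else 0) \<in> solution_space n F"
      if x: "x \<in> solution_space n F" for x
    proof -
      have "(\<Sum>i<n. cnj (v k i) * (\<Sum>j<n. A i j * x j)) = 0" if "k < m" for k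
      proof -
        have "(\<Sum>i<n. cnj (v k i) * (\<Sum>j<n. A i j * x j)) = (\<Sum>j<n. \<Sum>i<n. cnj (v k i) * A i j * x j)"
          by (subst sum.swap) (simp add: sum_distrib_left mult.assoc)
        also have "\<dots> = (\<Sum>j<n. cnj (\<Sum>i<n. A j i * v k i) * x j)"
        proof (intro sum.cong refl)
          fix j assume "j \<in> {..<n}"
          then have h: "cnj (v k i) * A i j * x j = cnj (A j i * v k i) * x j" if "i < n" for i
            using herm[of j i] that by simp
          show "(\<Sum>i<n. cnj (v k i) * A i j * x j) = cnj (\<Sum>i<n. A j i * v k i) * x j"
            unfolding cnj_sum sum_distrib_right by (intro sum.cong refl h) simp
        qed
        also have "\<dots> = of_real (\<mu> k) * (\<Sum>j<n. cnj (v k j) * x j)"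
          unfolding sum_distrib_left using eig[OF that] by (intro sum.cong refl) (simp add: mult.assoc)
        finally show ?thesis using x that unfolding memF by simp
      qed
      moreover have "(\<Sum>j<n. A a j * x j) = 0" if "a < n" "\<kappa> a \<noteq> \<kappa> i0" for a
        using x block[of a] that unfolding memF by (intro sum.neutral) (metis lessThan_iff mult_eq_0_iff)
      ultimately show ?thesis unfolding memF by simp
    qed
    obtain w \<nu> where w: "w \<in> solution_space n F" "(\<Sum>i<n. (cmod (w i))\<^sup>2) = 1"
        "\<forall>i<n. (\<Sum>j<n. A i j * w j) = of_real \<nu> * w i"
      using hermitian_eigenvector_in_invariant_subspace[OF herm inv x0 i0(1)] i0 by (auto simp: x0_def)
    have ww: "(\<Sum>i<n. cnj (w i) * w i) = 1"
    proof -
      have "(\<Sum>i<n. cnj (w i) * w i) = of_real (\<Sum>i<n. (cmod (w i))\<^sup>2)"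
        unfolding of_real_sum by (intro sum.cong refl) (metis complex_norm_square mult.commute)
      then show ?thesis using w(2) by simp
    qed
    have vw: "(\<Sum>i<n. cnj (v k i) * w i) = 0" if "k < m" for k using w(1) that unfolding memF by blast
    have wv: "(\<Sum>i<n. cnj (w i) * v k i) = 0" if "k < m" for k
    proof -
      have "(\<Sum>i<n. cnj (w i) * v k i) = cnj (\<Sum>i<n. cnj (v k i) * w i)" by (simp add: mult.commute)
      then show ?thesis using vw[OF that] by simp
    qed
    have "orthonormal n (Suc m) (v(m := w))"
      using on ww vw wv unfolding orthonormal_def by (auto simp: less_Suc_eq)
    moreover have "\<forall>k<Suc m. \<forall>i<n. (\<Sum>j<n. A i j * (v(m := w)) k j) = of_real ((\<mu>(m := \<nu>)) k) * (v(m := w)) k i"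
      using eig w(3) by (auto simp: less_Suc_eq)
    moreover have "\<kappa> i = \<kappa> j"
      if "k < Suc m" "i < n" "j < n" "(v(m := w)) k i \<noteq> 0" "(v(m := w)) k j \<noteq> 0" for k i j
    proof (cases "k = m")
      case True
      then have "w i \<noteq> 0" "w j \<noteq> 0" using that(4,5) by simp_all
      then show ?thesis using w(1) that(2,3) unfolding memF by metis
    next
      case False
      then show ?thesis using that cls[of k i j] by simp
    qed
    then have "\<forall>k<Suc m. \<forall>i<n. \<forall>j<n. (v(m := w)) k i \<noteq> 0 \<longrightarrow> (v(m := w)) k j \<noteq> 0 \<longrightarrow> \<kappa> i = \<kappa> j"
      by blast
    ultimately show ?case by blast
  qed
  then show ?thesis by blast
qed

corollary spectral_theorem:
  fixes A :: "nat \<Rightarrow> nat \<Rightarrow> complex"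
  assumes herm: "\<And>i j. i < n \<Longrightarrow> j < n \<Longrightarrow> A j i = cnj (A i j)"
  shows "\<exists>v \<mu>. orthonormal n n v \<and> (\<forall>k<n. \<forall>i<n. (\<Sum>j<n. A i j * v k j) = of_real (\<mu> k) * v k i)"
proof -
  have "\<exists>v \<mu>. orthonormal n n v \<and> (\<forall>k<n. \<forall>i<n. (\<Sum>j<n. A i j * v k j) = of_real (\<mu> k) * v k i) \<and>
      (\<forall>k<n. \<forall>i<n. \<forall>j<n. v k i \<noteq> 0 \<longrightarrow> v k j \<noteq> 0 \<longrightarrow> () = ())"
    by (rule spectral_theorem_blocks[of n A "\<lambda>_. ()"]) ((rule herm; assumption) | rule refl)+
  then show ?thesis by blast
qed

lemma spectral_expansion:
  assumes "orthonormal n n v" "\<And>k i. k < n \<Longrightarrow> i < n \<Longrightarrow> (\<Sum>j<n. A i j * v k j) = \<mu> k * v k i" "i < n" "j < n"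
  shows "A i j = (\<Sum>k<n. \<mu> k * v k i * cnj (v k j))"
proof -
  have "(\<Sum>k<n. \<mu> k * v k i * cnj (v k j)) = (\<Sum>k<n. \<Sum>l<n. A i l * (v k l * cnj (v k j)))"
    using assms(2,3) by (intro sum.cong refl) (simp add: sum_distrib_right mult.assoc flip: assms(2))
  also have "\<dots> = (\<Sum>l<n. A i l * (\<Sum>k<n. v k l * cnj (v k j)))"
    by (subst sum.swap) (simp add: sum_distrib_left)
  also have "\<dots> = (\<Sum>l<n. A i l * (if l = j then 1 else 0))"
    using orthonormal_complete[OF assms(1)] assms(4) by (intro sum.cong refl) simp
  also have "\<dots> = A i j" using assms(4) by (simp add: if_distrib[of "\<lambda>y. _ * y"] cong: if_cong)
  finally show ?thesis by simp
qed

section \<open>Fixed points of channels with a faithful invariant state\<close>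

text \<open>Products run over an arbitrary index set \<open>I\<close> so that passing to the support
  of a state only means shrinking \<open>I\<close>, without renumbering.\<close>

definition mm :: "nat set \<Rightarrow> (nat \<Rightarrow> nat \<Rightarrow> complex) \<Rightarrow> (nat \<Rightarrow> nat \<Rightarrow> complex) \<Rightarrow> nat \<Rightarrow> nat \<Rightarrow> complex" where
  "mm I X Y = (\<lambda>p k. \<Sum>q\<in>I. X p q * Y q k)"

definition adjf :: "(nat \<Rightarrow> nat \<Rightarrow> complex) \<Rightarrow> nat \<Rightarrow> nat \<Rightarrow> complex" where
  "adjf X = (\<lambda>p k. cnj (X k p))"

lemma sum_swap22:
  "(\<Sum>a\<in>A. \<Sum>b\<in>B. \<Sum>c\<in>C. \<Sum>d\<in>D. f a b c d) = (\<Sum>c\<in>C. \<Sum>d\<in>D. \<Sum>a\<in>A. \<Sum>b\<in>B. f a b c d)"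
proof -
  have "(\<Sum>a\<in>A. \<Sum>b\<in>B. \<Sum>c\<in>C. \<Sum>d\<in>D. f a b c d) = (\<Sum>a\<in>A. \<Sum>c\<in>C. \<Sum>b\<in>B. \<Sum>d\<in>D. f a b c d)"
    by (intro sum.cong refl, rule sum.swap)
  also have "\<dots> = (\<Sum>c\<in>C. \<Sum>a\<in>A. \<Sum>b\<in>B. \<Sum>d\<in>D. f a b c d)" by (rule sum.swap)
  also have "\<dots> = (\<Sum>c\<in>C. \<Sum>a\<in>A. \<Sum>d\<in>D. \<Sum>b\<in>B. f a b c d)"
    by (intro sum.cong refl, rule sum.swap)
  also have "\<dots> = (\<Sum>c\<in>C. \<Sum>d\<in>D. \<Sum>a\<in>A. \<Sum>b\<in>B. f a b c d)"
    by (intro sum.cong refl, rule sum.swap)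
  finally show ?thesis .
qed

lemma sum_swap21: "(\<Sum>a\<in>A. \<Sum>b\<in>B. \<Sum>c\<in>C. f a b c) = (\<Sum>c\<in>C. \<Sum>a\<in>A. \<Sum>b\<in>B. f a b c)"
proof -
  have "(\<Sum>a\<in>A. \<Sum>b\<in>B. \<Sum>c\<in>C. f a b c) = (\<Sum>a\<in>A. \<Sum>c\<in>C. \<Sum>b\<in>B. f a b c)"
    by (intro sum.cong refl, rule sum.swap)
  also have "\<dots> = (\<Sum>c\<in>C. \<Sum>a\<in>A. \<Sum>b\<in>B. f a b c)" by (rule sum.swap)
  finally show ?thesis .
qed

lemma mm_assoc: "mm I (mm I X Y) Z = mm I X (mm I Y Z)"
proof (intro ext)
  fix p k
  have "mm I (mm I X Y) Z p k = (\<Sum>q\<in>I. \<Sum>r\<in>I. X p r * (Y r q * Z q k))"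
    by (simp add: mm_def sum_distrib_right mult.assoc)
  also have "\<dots> = mm I X (mm I Y Z) p k"
    by (subst sum.swap) (simp add: mm_def sum_distrib_left)
  finally show "mm I (mm I X Y) Z p k = mm I X (mm I Y Z) p k" .
qed

lemma adjf_mm: "adjf (mm I X Y) = mm I (adjf Y) (adjf X)"
  by (intro ext) (simp add: adjf_def mm_def mult.commute)

lemma adjf_adjf [simp]: "adjf (adjf X) = X" by (simp add: adjf_def)

text \<open>A weighted Parseval identity: off-diagonal Gram entries vanish, so all cross terms drop
  out. Invariance of the weights \<open>lam\<close> and trace preservation both have the form of the
  hypothesis \<open>gram\<close>.\<close>

lemma sum_norm_square_gram:
  fixes G :: "'a \<Rightarrow> 'b \<Rightarrow> nat \<Rightarrow> complex" and m :: "'b \<Rightarrow> real"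
  assumes I: "finite I" and gram: "\<And>q q'. q \<in> I \<Longrightarrow> q' \<in> I \<Longrightarrow>
    (\<Sum>j\<in>J. \<Sum>k\<in>K. G j k q * of_real (m k) * cnj (G j k q')) = (if q = q' then of_real (w q) else 0)"
  shows "(\<Sum>j\<in>J. \<Sum>k\<in>K. m k * (cmod (\<Sum>q\<in>I. u q * G j k q))\<^sup>2) = (\<Sum>q\<in>I. w q * (cmod (u q))\<^sup>2)"
proof -
  have "complex_of_real (\<Sum>j\<in>J. \<Sum>k\<in>K. m k * (cmod (\<Sum>q\<in>I. u q * G j k q))\<^sup>2) =
      (\<Sum>j\<in>J. \<Sum>k\<in>K. of_real (m k) * ((\<Sum>q\<in>I. u q * G j k q) * cnj (\<Sum>q\<in>I. u q * G j k q)))"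
    by (simp only: of_real_sum of_real_mult complex_norm_square)
  also have "\<dots> = (\<Sum>j\<in>J. \<Sum>k\<in>K. \<Sum>q\<in>I. \<Sum>q'\<in>I. u q * cnj (u q') * (G j k q * of_real (m k) * cnj (G j k q')))"
    unfolding cnj_sum sum_product unfolding sum_distrib_left by (intro sum.cong refl) (simp add: mult_ac)
  also have "\<dots> = (\<Sum>q\<in>I. \<Sum>q'\<in>I. u q * cnj (u q') * (\<Sum>j\<in>J. \<Sum>k\<in>K. G j k q * of_real (m k) * cnj (G j k q')))"
    by (subst sum_swap22) (simp only: sum_distrib_left)
  also have "\<dots> = (\<Sum>q\<in>I. \<Sum>q'\<in>I. if q = q' then u q * cnj (u q) * of_real (w q) else 0)"
    by (intro sum.cong refl) (simp add: gram)
  also have "\<dots> = (\<Sum>q\<in>I. of_real (w q) * (u q * cnj (u q)))" using I by (simp add: mult_ac)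
  also have "\<dots> = complex_of_real (\<Sum>q\<in>I. w q * (cmod (u q))\<^sup>2)"
    by (simp only: of_real_sum of_real_mult complex_norm_square)
  finally show ?thesis using of_real_eq_iff by blast
qed

section \<open>Contractivity of the dual map and commutation of its fixed points\<close>

text \<open>The channel on the support of an invariant positive matrix, written in an eigenbasis of
  that matrix, with \<open>lam\<close> the eigenvalues. Entries are zero off \<open>I\<close>, so
  matrix identities can be stated as equalities of functions.\<close>

locale faithful_kraus =
  fixes I :: "nat set" and J :: "'j set" and A :: "'j \<Rightarrow> nat \<Rightarrow> nat \<Rightarrow> complex" and lam :: "nat \<Rightarrow> real"
  assumes finI: "finite I" and finJ: "finite J"
    and A_supp: "p \<notin> I \<or> k \<notin> I \<Longrightarrow> A j p k = 0"
    and trace_preserving: "k \<in> I \<Longrightarrow> l \<in> I \<Longrightarrow> (\<Sum>j\<in>J. \<Sum>p\<in>I. A j p k * cnj (A j p l)) = (if k = l then 1 else 0)"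
    and lam_pos: "k \<in> I \<Longrightarrow> lam k > 0"
    and lam_fixed: "p \<in> I \<Longrightarrow> q \<in> I \<Longrightarrow>
      (\<Sum>j\<in>J. \<Sum>k\<in>I. A j p k * of_real (lam k) * cnj (A j q k)) = (if p = q then of_real (lam p) else 0)"
begin

definition T :: "(nat \<Rightarrow> nat \<Rightarrow> complex) \<Rightarrow> nat \<Rightarrow> nat \<Rightarrow> complex" where
  "T X = (\<lambda>k l. \<Sum>j\<in>J. mm I (adjf (A j)) (mm I X (A j)) k l)"

text \<open>The squared norm tr (D adj(X) X), where D is the diagonal matrix of \<open>lam\<close>;
  the weight goes with the column.\<close>

definition nrm :: "(nat \<Rightarrow> nat \<Rightarrow> complex) \<Rightarrow> real" where
  "nrm X = (\<Sum>k\<in>I. \<Sum>p\<in>I. lam k * (cmod (X p k))\<^sup>2)"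

definition on_I :: "(nat \<Rightarrow> nat \<Rightarrow> complex) \<Rightarrow> bool" where
  "on_I X \<longleftrightarrow> (\<forall>p q. p \<notin> I \<or> q \<notin> I \<longrightarrow> X p q = 0)"

lemma on_I_T: "on_I (T X)"
  unfolding on_I_def T_def mm_def adjf_def by (auto simp: A_supp intro!: sum.neutral)

lemma on_I_A: "on_I (A j)" by (simp add: on_I_def A_supp)

lemma on_I_adjf: "on_I X \<Longrightarrow> on_I (adjf X)" by (auto simp: on_I_def adjf_def)

lemma on_I_mm: "on_I X \<Longrightarrow> on_I Y \<Longrightarrow> on_I (mm I X Y)" by (auto simp: on_I_def mm_def)

lemma on_I_eqI: "on_I X \<Longrightarrow> on_I Y \<Longrightarrow> (\<And>p q. p \<in> I \<Longrightarrow> q \<in> I \<Longrightarrow> X p q = Y p q) \<Longrightarrow> X = Y"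
  unfolding on_I_def by (intro ext) metis

lemma T_adjf: "T (adjf X) = adjf (T X)"
proof -
  have "mm I (adjf (A j)) (mm I (adjf X) (A j)) k l = cnj (mm I (adjf (A j)) (mm I X (A j)) l k)" for j k l
  proof -
    have "mm I (adjf (A j)) (mm I (adjf X) (A j)) = adjf (mm I (adjf (A j)) (mm I X (A j)))"
      by (simp add: adjf_mm mm_assoc)
    then show ?thesis by (simp add: adjf_def)
  qed
  then show ?thesis by (intro ext) (simp add: T_def, simp add: adjf_def)
qed

text \<open>Expanding the square leaves three terms: invariance of \<open>lam\<close> makes right
  multiplication by the \<open>A j\<close> norm preserving, trace preservation does the same for
  left multiplication, and the mixed term is the definition of \<open>T\<close>. The matrix
  \<open>W\<close> is left free: \<open>W = T X\<close> yields contractivity, and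
  \<open>W = X\<close> the commutation of fixed points.\<close>

lemma intertwiner_defect:
  "(\<Sum>j\<in>J. \<Sum>k\<in>I. \<Sum>p\<in>I. lam k * (cmod (mm I X (A j) p k - mm I (A j) W p k))\<^sup>2) =
     nrm X - 2 * (\<Sum>k\<in>I. lam k * Re (\<Sum>q\<in>I. cnj (W q k) * T X q k)) + nrm W"
proof -
  have sq: "(cmod (a - b))\<^sup>2 = (cmod a)\<^sup>2 - 2 * Re (cnj b * a) + (cmod b)\<^sup>2" for a b :: complex
    unfolding cmod_power2 by (simp add: power2_eq_square algebra_simps)
  have "(\<Sum>j\<in>J. \<Sum>k\<in>I. \<Sum>p\<in>I. lam k * (cmod (mm I X (A j) p k - mm I (A j) W p k))\<^sup>2) =
      (\<Sum>j\<in>J. \<Sum>k\<in>I. \<Sum>p\<in>I. lam k * (cmod (mm I X (A j) p k))\<^sup>2)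
      - 2 * (\<Sum>j\<in>J. \<Sum>k\<in>I. \<Sum>p\<in>I. lam k * Re (cnj (mm I (A j) W p k) * mm I X (A j) p k))
      + (\<Sum>j\<in>J. \<Sum>k\<in>I. \<Sum>p\<in>I. lam k * (cmod (mm I (A j) W p k))\<^sup>2)"
    unfolding sq by (simp add: algebra_simps sum.distrib sum_subtractf sum_distrib_left)
  also have "(\<Sum>j\<in>J. \<Sum>k\<in>I. \<Sum>p\<in>I. lam k * (cmod (mm I X (A j) p k))\<^sup>2) = nrm X"
  proof -
    have "(\<Sum>j\<in>J. \<Sum>k\<in>I. \<Sum>p\<in>I. lam k * (cmod (mm I X (A j) p k))\<^sup>2) =
        (\<Sum>p\<in>I. \<Sum>j\<in>J. \<Sum>k\<in>I. lam k * (cmod (\<Sum>q\<in>I. X p q * A j q k))\<^sup>2)"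
      by (subst sum_swap21) (simp add: mm_def)
    also have "\<dots> = (\<Sum>p\<in>I. \<Sum>q\<in>I. lam q * (cmod (X p q))\<^sup>2)"
      by (intro sum.cong refl sum_norm_square_gram[where G="\<lambda>j k q. A j q k"] finI lam_fixed)
    also have "\<dots> = nrm X" unfolding nrm_def by (rule sum.swap)
    finally show ?thesis .
  qed
  also have "(\<Sum>j\<in>J. \<Sum>k\<in>I. \<Sum>p\<in>I. lam k * (cmod (mm I (A j) W p k))\<^sup>2) = nrm W"
  proof -
    have "(\<Sum>j\<in>J. \<Sum>k\<in>I. \<Sum>p\<in>I. lam k * (cmod (mm I (A j) W p k))\<^sup>2) =
        (\<Sum>k\<in>I. lam k * (\<Sum>j\<in>J. \<Sum>p\<in>I. 1 * (cmod (\<Sum>q\<in>I. W q k * A j p q))\<^sup>2))"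
      by (subst sum.swap) (simp add: mm_def sum_distrib_left mult.commute[of "A _ _ _"])
    also have "\<dots> = (\<Sum>k\<in>I. lam k * (\<Sum>q\<in>I. 1 * (cmod (W q k))\<^sup>2))"
      by (intro sum.cong refl arg_cong2[where f="(*)"] sum_norm_square_gram[where G="\<lambda>j p q. A j p q"] finI)
        (simp add: trace_preserving)
    finally show ?thesis by (simp add: nrm_def sum_distrib_left)
  qed
  also have "(\<Sum>j\<in>J. \<Sum>k\<in>I. \<Sum>p\<in>I. lam k * Re (cnj (mm I (A j) W p k) * mm I X (A j) p k)) =
      (\<Sum>k\<in>I. lam k * Re (\<Sum>q\<in>I. cnj (W q k) * T X q k))"
  proof -
    have "(\<Sum>j\<in>J. \<Sum>p\<in>I. cnj (mm I (A j) W p k) * mm I X (A j) p k) = (\<Sum>q\<in>I. cnj (W q k) * T X q k)" for k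
    proof -
      have "(\<Sum>j\<in>J. \<Sum>p\<in>I. cnj (mm I (A j) W p k) * mm I X (A j) p k) =
          (\<Sum>j\<in>J. \<Sum>p\<in>I. \<Sum>q\<in>I. cnj (W q k) * (cnj (A j p q) * mm I X (A j) p k))"
        by (simp add: mm_def[of I "A _" W] sum_distrib_left mult_ac)
      also have "\<dots> = (\<Sum>q\<in>I. cnj (W q k) * (\<Sum>j\<in>J. \<Sum>p\<in>I. cnj (A j p q) * mm I X (A j) p k))"
        by (subst sum_swap21) (simp only: sum_distrib_left)
      also have "\<dots> = (\<Sum>q\<in>I. cnj (W q k) * T X q k)"
      proof -
        have "mm I (adjf (A j)) M q k = (\<Sum>p\<in>I. cnj (A j p q) * M p k)" for j M q
          by (simp add: mm_def adjf_def)
        then show ?thesis by (simp add: T_def)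
      qed
      finally show ?thesis .
    qed
    note eq = this
    show ?thesis unfolding eq[symmetric]
      by (subst sum.swap) (simp only: Re_sum sum_distrib_left)
  qed
  finally show ?thesis .
qed

lemma Re_sum_self: "(\<Sum>k\<in>I. lam k * Re (\<Sum>q\<in>I. cnj (W q k) * W q k)) = nrm W"
proof -
  have "Re (cnj z * z) = (cmod z)\<^sup>2" for z unfolding cmod_power2 by (simp add: power2_eq_square)
  then show ?thesis by (simp add: nrm_def sum_distrib_left)
qed

lemma nrm_T_le: "nrm (T X) \<le> nrm X"
proof -
  have "0 \<le> (\<Sum>j\<in>J. \<Sum>k\<in>I. \<Sum>p\<in>I. lam k * (cmod (mm I X (A j) p k - mm I (A j) (T X) p k))\<^sup>2)"
    by (intro sum_nonneg mult_nonneg_nonneg) (auto simp: lam_pos less_imp_le)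
  then show ?thesis unfolding intertwiner_defect Re_sum_self by linarith
qed

text \<open>For \<open>W = X = T X\<close> the defect is zero, and it is a sum of squares with
  weights \<open>lam k > 0\<close>: faithfulness forces every square to vanish.\<close>

lemma fixed_point_commutes:
  assumes X: "on_I X" and fp: "T X = X" and j: "j \<in> J"
  shows "mm I X (A j) = mm I (A j) X"
proof -
  let ?d = "\<lambda>j k p. lam k * (cmod (mm I X (A j) p k - mm I (A j) X p k))\<^sup>2"
  have nn: "?d j k p \<ge> 0" if "k \<in> I" for j k p using lam_pos[OF that] by simp
  have "(\<Sum>j\<in>J. \<Sum>k\<in>I. \<Sum>p\<in>I. ?d j k p) = 0"
    unfolding intertwiner_defect fp Re_sum_self by simp
  then have "(\<Sum>k\<in>I. \<Sum>p\<in>I. ?d j k p) = 0"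
    using j finJ nn by (subst (asm) sum_nonneg_eq_0_iff) (auto intro!: sum_nonneg)
  then have "(\<Sum>p\<in>I. ?d j k p) = 0" if "k \<in> I" for k
    using that finI nn by (subst (asm) sum_nonneg_eq_0_iff) (auto intro!: sum_nonneg)
  then have d0: "?d j k p = 0" if "k \<in> I" "p \<in> I" for k p
    using that finI nn by (metis (no_types, lifting) sum_nonneg_eq_0_iff)
  show ?thesis
  proof (rule on_I_eqI[OF on_I_mm[OF X on_I_A] on_I_mm[OF on_I_A X]])
    fix p k assume "p \<in> I" "k \<in> I"
    then show "mm I X (A j) p k = mm I (A j) X p k" using d0[of k p] lam_pos[of k] by simp
  qed
qed

section \<open>Cesaro means of the dual map\<close>

text \<open>The mean of \<open>N + 1\<close> iterates, so that no denominator is zero.\<close>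

definition cesaro :: "(nat \<Rightarrow> nat \<Rightarrow> complex) \<Rightarrow> nat \<Rightarrow> nat \<Rightarrow> nat \<Rightarrow> complex" where
  "cesaro Y N = (\<lambda>p q. (\<Sum>m<Suc N. (T ^^ m) Y p q) / of_nat (Suc N))"

lemma T_sum: "T (\<lambda>p q. (\<Sum>m\<in>M. f m p q) / z) = (\<lambda>p q. (\<Sum>m\<in>M. T (f m) p q) / z)"
proof (intro ext)
  fix k l
  have "T (\<lambda>p q. (\<Sum>m\<in>M. f m p q) / z) k l =
      (\<Sum>j\<in>J. \<Sum>p\<in>I. \<Sum>q\<in>I. \<Sum>m\<in>M. cnj (A j p k) * (f m p q * A j q l) / z)"
    by (simp add: T_def mm_def adjf_def sum_distrib_left sum_distrib_right sum_divide_distrib)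
  also have "\<dots> = (\<Sum>j\<in>J. \<Sum>m\<in>M. \<Sum>p\<in>I. \<Sum>q\<in>I. cnj (A j p k) * (f m p q * A j q l) / z)"
    by (intro sum.cong refl) (rule sum_swap21)
  also have "\<dots> = (\<Sum>m\<in>M. \<Sum>j\<in>J. \<Sum>p\<in>I. \<Sum>q\<in>I. cnj (A j p k) * (f m p q * A j q l) / z)"
    by (rule sum.swap)
  also have "\<dots> = (\<Sum>m\<in>M. T (f m) k l) / z"
    by (simp add: T_def mm_def adjf_def sum_distrib_left sum_divide_distrib)
  finally show "T (\<lambda>p q. (\<Sum>m\<in>M. f m p q) / z) k l = (\<Sum>m\<in>M. T (f m) k l) / z" .
qed

lemma on_I_power: "on_I Y \<Longrightarrow> on_I ((T ^^ m) Y)"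
  by (cases m) (auto simp: on_I_T)

text \<open>\<open>T\<close> does not increase \<open>nrm\<close>, and a positive weight lets
  \<open>nrm\<close> control every single entry.\<close>

lemma power_bounded:
  assumes "p \<in> I" "q \<in> I"
  shows "cmod ((T ^^ m) Y p q) \<le> sqrt (nrm Y / lam q)"
proof -
  have "nrm ((T ^^ m) Y) \<le> nrm Y" by (induction m) (auto intro: order_trans[OF nrm_T_le])
  moreover have "lam q * (cmod ((T ^^ m) Y p q))\<^sup>2 \<le> nrm ((T ^^ m) Y)"
  proof -
    have "lam q * (cmod ((T ^^ m) Y p q))\<^sup>2 \<le> (\<Sum>p\<in>I. lam q * (cmod ((T ^^ m) Y p q))\<^sup>2)"
      using assms finI lam_pos[of q] by (intro member_le_sum) auto
    also have "\<dots> \<le> nrm ((T ^^ m) Y)" unfolding nrm_def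
      using assms finI lam_pos
      by (intro member_le_sum[of q I "\<lambda>q. \<Sum>p\<in>I. lam q * (cmod ((T ^^ m) Y p q))\<^sup>2"])
        (auto intro!: sum_nonneg mult_nonneg_nonneg simp: less_imp_le)
    finally show ?thesis .
  qed
  ultimately have "(cmod ((T ^^ m) Y p q))\<^sup>2 \<le> nrm Y / lam q"
    using lam_pos[OF assms(2)] by (simp add: pos_le_divide_eq mult.commute)
  then show ?thesis by (simp add: real_le_rsqrt)
qed

text \<open>A limit along a subsequence suffices: applying \<open>T\<close> shifts the window of the
  mean by one, which changes only the two end terms, and these are bounded while the denominator
  grows.\<close>

lemma cesaro_limit:
  assumes Y: "on_I Y"
  shows "\<exists>Z r. strict_mono r \<and> on_I Z \<and> T Z = Z \<and> (\<forall>p q. (\<lambda>N. cesaro Y (r N) p q) \<longlonglongrightarrow> Z p q)"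
proof -
  have bd: "cmod (cesaro Y N p q) \<le> sqrt (nrm Y / lam q)" if "p \<in> I" "q \<in> I" for N p q
  proof -
    have "cmod (\<Sum>m<Suc N. (T ^^ m) Y p q) \<le> (\<Sum>m<Suc N. sqrt (nrm Y / lam q))"
      by (intro order_trans[OF norm_sum] sum_mono power_bounded that)
    also have "\<dots> = of_nat (Suc N) * sqrt (nrm Y / lam q)" by simp
    finally show ?thesis
      unfolding cesaro_def norm_divide norm_of_nat by (simp add: pos_divide_le_eq mult.commute del: of_nat_Suc)
  qed
  obtain r Z0 where r: "strict_mono r"
      "\<forall>i\<in>I\<times>I. (\<lambda>N. cesaro Y (r N) (fst i) (snd i)) \<longlonglongrightarrow> Z0 i"
    using bounded_family_convergent_subseq[of "I \<times> I" "\<lambda>N i. cesaro Y N (fst i) (snd i)"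
        "\<lambda>i. sqrt (nrm Y / lam (snd i))"] bd finI by auto
  define Z where "Z p q = (if p \<in> I \<and> q \<in> I then Z0 (p, q) else 0)" for p q
  have onZ: "on_I Z" by (auto simp: on_I_def Z_def)
  have lim: "(\<lambda>N. cesaro Y (r N) p q) \<longlonglongrightarrow> Z p q" for p q
  proof (cases "p \<in> I \<and> q \<in> I")
    case True
    then show ?thesis using r(2) by (force simp: Z_def)
  next
    case False
    then have "cesaro Y N p q = 0" for N
      using on_I_power[OF Y] unfolding cesaro_def on_I_def by auto
    then show ?thesis using False by (auto simp: Z_def)
  qed
  have "T Z p q = Z p q" if "p \<in> I" "q \<in> I" for p q
  proof -
    have Tc: "T (cesaro Y N) p q - cesaro Y N p q = ((T ^^ Suc N) Y p q - Y p q) / of_nat (Suc N)" for N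
    proof -
      have "T (cesaro Y N) p q = (\<Sum>m<Suc N. (T ^^ Suc m) Y p q) / of_nat (Suc N)"
        unfolding cesaro_def T_sum by simp
      then have "T (cesaro Y N) p q - cesaro Y N p q =
          (\<Sum>m<Suc N. (T ^^ Suc m) Y p q - (T ^^ m) Y p q) / of_nat (Suc N)"
        by (simp only: cesaro_def sum_subtractf diff_divide_distrib)
      also have "(\<Sum>m<Suc N. (T ^^ Suc m) Y p q - (T ^^ m) Y p q) = (T ^^ Suc N) Y p q - (T ^^ 0) Y p q"
        by (rule sum_lessThan_telescope)
      finally show ?thesis by simp
    qed
    have a: "(\<lambda>N. T (cesaro Y (r N)) p q - cesaro Y (r N) p q) \<longlonglongrightarrow> T Z p q - Z p q"
      unfolding T_def mm_def by (intro tendsto_intros lim)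
    have b: "(\<lambda>N. T (cesaro Y N) p q - cesaro Y N p q) \<longlonglongrightarrow> 0"
    proof (rule tendsto_0_le[OF LIMSEQ_inverse_real_of_nat])
      let ?B = "2 * sqrt (nrm Y / lam q)"
      show "\<forall>\<^sub>F N in sequentially. norm (T (cesaro Y N) p q - cesaro Y N p q) \<le> norm (inverse (real (Suc N))) * ?B"
      proof (intro always_eventually allI)
        fix N
        have "norm ((T ^^ Suc N) Y p q - (T ^^ 0) Y p q) \<le> ?B"
          using power_bounded[OF that, of "Suc N" Y] power_bounded[OF that, of 0 Y]
          by (intro order_trans[OF norm_triangle_ineq4]) linarith
        then show "norm (T (cesaro Y N) p q - cesaro Y N p q) \<le> norm (inverse (real (Suc N))) * ?B"
          unfolding Tc norm_divide norm_of_nat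
          by (simp add: divide_inverse mult.commute mult_left_mono del: of_nat_Suc)
      qed
    qed
    have "T Z p q - Z p q = 0"
      using LIMSEQ_unique[OF a] LIMSEQ_subseq_LIMSEQ[OF b r(1)] by (simp add: o_def)
    then show ?thesis by simp
  qed
  then have "T Z = Z" by (intro on_I_eqI on_I_T onZ)
  then show ?thesis using r(1) onZ lim by blast
qed

text \<open>Meant for the functional tr (c X), which is constant along the orbit of
  \<open>Y\<close>; a linear functional then has the same value on every mean and on the
  limit.\<close>

lemma cesaro_limit_linear:
  assumes lim: "\<And>p q. (\<lambda>N. cesaro Y (r N) p q) \<longlonglongrightarrow> Z p q"
    and inv: "\<And>m. (\<Sum>p\<in>I. \<Sum>q\<in>I. d p q * (T ^^ m) Y p q) = b"
  shows "(\<Sum>p\<in>I. \<Sum>q\<in>I. d p q * Z p q) = b"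
proof -
  have "(\<Sum>p\<in>I. \<Sum>q\<in>I. d p q * cesaro Y N p q) = b" for N
  proof -
    have "(\<Sum>p\<in>I. \<Sum>q\<in>I. d p q * cesaro Y N p q) =
        (\<Sum>p\<in>I. \<Sum>q\<in>I. \<Sum>m<Suc N. d p q * (T ^^ m) Y p q) / of_nat (Suc N)"
      by (simp only: cesaro_def sum_distrib_left sum_divide_distrib times_divide_eq_right)
    also have "(\<Sum>p\<in>I. \<Sum>q\<in>I. \<Sum>m<Suc N. d p q * (T ^^ m) Y p q) = of_nat (Suc N) * b"
      by (subst sum_swap21) (simp only: inv sum_constant card_lessThan)
    finally show ?thesis by (simp del: of_nat_Suc)
  qed
  moreover have "(\<lambda>N. \<Sum>p\<in>I. \<Sum>q\<in>I. d p q * cesaro Y (r N) p q) \<longlonglongrightarrow> (\<Sum>p\<in>I. \<Sum>q\<in>I. d p q * Z p q)"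
    by (intro tendsto_intros lim)
  ultimately show ?thesis by (simp add: LIMSEQ_const_iff)
qed

lemma mm_sum_right: "mm I X (\<lambda>p q. \<Sum>j\<in>M. f j p q) = (\<lambda>p q. \<Sum>j\<in>M. mm I X (f j) p q)"
  unfolding mm_def sum_distrib_left by (intro ext) (rule sum.swap)

lemma mm_sum_left: "mm I (\<lambda>p q. \<Sum>j\<in>M. f j p q) X = (\<lambda>p q. \<Sum>j\<in>M. mm I (f j) X p q)"
  unfolding mm_def sum_distrib_right by (intro ext) (rule sum.swap)

lemma T_commutes:
  assumes "\<And>j. j \<in> J \<Longrightarrow> mm I X (A j) = mm I (A j) X"
    and "\<And>j. j \<in> J \<Longrightarrow> mm I X (adjf (A j)) = mm I (adjf (A j)) X"
    and "mm I X Y = mm I Y X"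
  shows "mm I X (T Y) = mm I (T Y) X"
proof -
  have "mm I X (mm I (adjf (A j)) (mm I Y (A j))) = mm I (mm I (adjf (A j)) (mm I Y (A j))) X" if "j \<in> J" for j
    using assms(1,2)[OF that] assms(3) by (metis mm_assoc)
  then show ?thesis unfolding T_def mm_sum_right mm_sum_left by (intro ext sum.cong refl) simp
qed

text \<open>Commuting with \<open>X\<close> is a closed linear condition that \<open>T\<close>
  preserves, so it survives iteration, averaging and the limit.\<close>

lemma cesaro_limit_commutes:
  assumes lim: "\<And>p q. (\<lambda>N. cesaro Y (r N) p q) \<longlonglongrightarrow> Z p q"
    and "\<And>j. j \<in> J \<Longrightarrow> mm I X (A j) = mm I (A j) X"
    and "\<And>j. j \<in> J \<Longrightarrow> mm I X (adjf (A j)) = mm I (adjf (A j)) X"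
    and "mm I X Y = mm I Y X"
  shows "mm I X Z = mm I Z X"
proof (intro ext)
  fix p k
  have pw: "mm I X ((T ^^ m) Y) = mm I ((T ^^ m) Y) X" for m
    by (induction m) (use T_commutes assms in auto)
  have eq: "mm I X (cesaro Y N) p k = mm I (cesaro Y N) X p k" for N
  proof -
    have "mm I X (cesaro Y N) p k = mm I X (\<lambda>p q. \<Sum>m<Suc N. (T ^^ m) Y p q) p k / of_nat (Suc N)"
      by (simp add: mm_def cesaro_def sum_divide_distrib)
    also have "\<dots> = mm I (\<lambda>p q. \<Sum>m<Suc N. (T ^^ m) Y p q) X p k / of_nat (Suc N)"
      unfolding mm_sum_right mm_sum_left pw ..
    also have "\<dots> = mm I (cesaro Y N) X p k"
      by (simp add: mm_def cesaro_def sum_divide_distrib)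
    finally show ?thesis .
  qed
  have "(\<lambda>N. mm I X (cesaro Y (r N)) p k) \<longlonglongrightarrow> mm I X Z p k"
    "(\<lambda>N. mm I (cesaro Y (r N)) X p k) \<longlonglongrightarrow> mm I Z X p k"
    unfolding mm_def by (intro tendsto_intros lim)+
  then show "mm I X Z p k = mm I Z X p k" unfolding eq using LIMSEQ_unique by blast
qed

end

section \<open>Normal matrices that shift energies\<close>

text \<open>The diagonal entries of the two products are the squared norms of a column and of the
  row with the same index, so a nonzero column means a nonzero row. From a nonzero entry one can
  therefore step to further nonzero entries forever; finiteness of \<open>I\<close> closes the path,
  and a cycle of length m forces m w in \<open>V\<close>.\<close>

lemma normal_nonzero_mode_zero:
  fixes e :: "nat \<Rightarrow> real"
  assumes I: "finite I" and normal: "\<And>p. p \<in> I \<Longrightarrow> mm I (adjf Z) Z p p = mm I Z (adjf Z) p p"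
    and mode: "\<And>p q. p \<in> I \<Longrightarrow> q \<in> I \<Longrightarrow> Z p q \<noteq> 0 \<Longrightarrow> e p - e q - w \<in> V"
    and add: "\<And>x y. x \<in> V \<Longrightarrow> y \<in> V \<Longrightarrow> x + y \<in> V"
    and neg: "\<And>x. x \<in> V \<Longrightarrow> - x \<in> V"
    and div: "\<And>x (m::nat). of_nat m * x \<in> V \<Longrightarrow> m > 0 \<Longrightarrow> x \<in> V"
    and w: "w \<notin> V" and pq: "p \<in> I" "q \<in> I"
  shows "Z p q = 0"
proof (rule ccontr)
  assume nz: "Z p q \<noteq> 0"
  have next_ex: "\<exists>l\<in>I. Z k l \<noteq> 0" if "k \<in> I" "i \<in> I" "Z i k \<noteq> 0" for i k
  proof (rule ccontr)
    assume "\<not> ?thesis"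
    then have "mm I Z (adjf Z) k k = 0" by (auto simp: mm_def intro!: sum.neutral)
    then have "mm I (adjf Z) Z k k = 0" using normal that(1) by simp
    moreover have "mm I (adjf Z) Z k k = of_real (\<Sum>i\<in>I. (cmod (Z i k))\<^sup>2)"
      unfolding mm_def adjf_def of_real_sum by (intro sum.cong refl) (metis complex_norm_square mult.commute)
    ultimately have "(\<Sum>i\<in>I. (cmod (Z i k))\<^sup>2) = 0" by (metis of_real_eq_0_iff)
    then show False using I that by (subst (asm) sum_nonneg_eq_0_iff) auto
  qed
  \<comment> \<open>Following \<open>nx\<close> from \<open>p\<close> gives the infinite path; along
    it \<open>next_ex\<close> guarantees that the chosen successor exists.\<close>
  define nx where "nx k = (SOME l. l \<in> I \<and> Z k l \<noteq> 0)" for k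
  define g where "g m = (nx ^^ m) p" for m
  have g: "g m \<in> I \<and> g (Suc m) \<in> I \<and> Z (g m) (g (Suc m)) \<noteq> 0" for m
  proof (induction m)
    case 0
    have "nx p \<in> I \<and> Z p (nx p) \<noteq> 0" unfolding nx_def by (rule someI[of _ q]) (use pq nz in simp)
    then show ?case using pq by (simp add: g_def)
  next
    case (Suc m)
    have "nx (g (Suc m)) \<in> I \<and> Z (g (Suc m)) (nx (g (Suc m))) \<noteq> 0"
      unfolding nx_def by (rule someI_ex) (use next_ex[of "g (Suc m)" "g m"] Suc in blast)
    then show ?case using Suc by (simp add: g_def)
  qed
  have zero: "0 \<in> V" using mode[OF pq nz] add neg by (metis add.right_inverse)
  have path: "e (g m) - e (g (m + d)) - of_nat d * w \<in> V" for m d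
  proof (induction d)
    case 0
    show ?case using zero by simp
  next
    case (Suc d)
    have "e (g (m + d)) - e (g (Suc (m + d))) - w \<in> V" using g[of "m + d"] mode by blast
    from add[OF Suc this] show ?case by (simp add: algebra_simps)
  qed
  have "\<not> inj g"
    using I g finite_subset[of "range g" I] finite_imageD[of g UNIV] by (metis image_subsetI infinite_UNIV_nat)
  then obtain a b where "a < b" "g a = g b" unfolding inj_def by (metis linorder_neqE_nat)
  then have "- (of_nat (b - a) * w) \<in> V" using path[of a "b - a"] by simp
  then have "of_nat (b - a) * w \<in> V" using neg by fastforce
  then show False using div[of "b - a" w] w \<open>a < b\<close> by simp
qed

section \<open>Rational subspaces and covariance modulo them\<close>

definition rational_subspace :: "real set \<Rightarrow> bool" where
  "rational_subspace V \<longleftrightarrow> 0 \<in> V \<and> (\<forall>x\<in>V. \<forall>y\<in>V. x + y \<in> V) \<and> (\<forall>x\<in>V. \<forall>q. of_rat q * x \<in> V)"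

text \<open>The last clause, division by a positive integer, is what the cycle argument needs and
  what the additive group generated by the modes need not provide.\<close>

lemma rational_subspaceD:
  assumes "rational_subspace V"
  shows "0 \<in> V" "x \<in> V \<Longrightarrow> y \<in> V \<Longrightarrow> x + y \<in> V" "x \<in> V \<Longrightarrow> - x \<in> V"
    "x \<in> V \<Longrightarrow> y \<in> V \<Longrightarrow> x - y \<in> V" "of_nat m * x \<in> V \<Longrightarrow> m > 0 \<Longrightarrow> x \<in> V"
proof -
  show "0 \<in> V" and add: "x \<in> V \<Longrightarrow> y \<in> V \<Longrightarrow> x + y \<in> V" for x y
    using assms by (auto simp: rational_subspace_def)
  have sc: "of_rat q * x \<in> V" if "x \<in> V" for q x using assms that by (auto simp: rational_subspace_def)
  show neg: "- x \<in> V" if "x \<in> V" for x using sc[OF that, of "-1"] by simp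
  show "x - y \<in> V" if "x \<in> V" "y \<in> V" using add[OF that(1) neg[OF that(2)]] by simp
  show "x \<in> V" if "of_nat m * x \<in> V" "m > 0"
    using sc[OF that(1), of "1 / of_nat m"] that(2) by (simp add: of_rat_divide)
qed

text \<open>\<open>T\<close> is the trace dual of the channel with Kraus operators
  \<open>A j\<close>, and the sums are tr (c X): hence tr (c T X) pairs \<open>X\<close> with the
  image of \<open>c\<close>, which is \<open>c\<close> again.\<close>

lemma (in faithful_kraus) expectation_T:
  assumes fixed: "\<And>p q. p \<in> I \<Longrightarrow> q \<in> I \<Longrightarrow>
      (\<Sum>j\<in>J. \<Sum>k\<in>I. \<Sum>l\<in>I. A j p k * c k l * cnj (A j q l)) = c p q"
  shows "(\<Sum>p\<in>I. \<Sum>q\<in>I. c q p * T X p q) = (\<Sum>p\<in>I. \<Sum>q\<in>I. c q p * X p q)"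
proof -
  let ?f = "\<lambda>p q j a b. X a b * (A j b q * c q p * cnj (A j a p))"
  have "(\<Sum>p\<in>I. \<Sum>q\<in>I. c q p * T X p q) = (\<Sum>p\<in>I. \<Sum>q\<in>I. \<Sum>j\<in>J. \<Sum>a\<in>I. \<Sum>b\<in>I. ?f p q j a b)"
    by (simp add: T_def mm_def adjf_def sum_distrib_left mult_ac)
  also have "\<dots> = (\<Sum>p\<in>I. \<Sum>q\<in>I. \<Sum>a\<in>I. \<Sum>b\<in>I. \<Sum>j\<in>J. ?f p q j a b)"
    by (intro sum.cong refl, rule sum_swap21[symmetric])
  also have "\<dots> = (\<Sum>a\<in>I. \<Sum>b\<in>I. \<Sum>p\<in>I. \<Sum>q\<in>I. \<Sum>j\<in>J. ?f p q j a b)" by (rule sum_swap22)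
  also have "\<dots> = (\<Sum>a\<in>I. \<Sum>b\<in>I. \<Sum>q\<in>I. \<Sum>p\<in>I. \<Sum>j\<in>J. ?f p q j a b)"
    by (rule sum.cong[OF refl], rule sum.cong[OF refl], rule sum.swap)
  also have "\<dots> = (\<Sum>a\<in>I. \<Sum>b\<in>I. \<Sum>j\<in>J. \<Sum>q\<in>I. \<Sum>p\<in>I. ?f p q j a b)"
    by (intro sum.cong refl, rule sum_swap21)
  also have "\<dots> = (\<Sum>a\<in>I. \<Sum>b\<in>I. X a b * (\<Sum>j\<in>J. \<Sum>q\<in>I. \<Sum>p\<in>I. A j b q * c q p * cnj (A j a p)))"
    by (simp only: sum_distrib_left)
  also have "\<dots> = (\<Sum>p\<in>I. \<Sum>q\<in>I. c q p * X p q)"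
    using fixed by (intro sum.cong refl) (simp add: mult.commute)
  finally show ?thesis .
qed

text \<open>Expanded in the entries of \<open>X\<close>, the coefficients of \<open>T X\<close> are
  the sums \<open>\<Sum>j\<in>J. cnj (A j a k) * A j b l\<close>, and these carry the covariance; a
  single \<open>A j\<close> need not have a definite mode.\<close>

lemma (in faithful_kraus) T_mode:
  assumes V: "rational_subspace V"
    and tmode: "\<And>k l p q. \<lbrakk>k \<in> I; l \<in> I; p \<in> I; q \<in> I; (\<Sum>j\<in>J. cnj (A j p k) * A j q l) \<noteq> 0\<rbrakk>
      \<Longrightarrow> e p - e q - (e k - e l) \<in> V"
    and X: "\<And>k l. k \<in> I \<Longrightarrow> l \<in> I \<Longrightarrow> X k l \<noteq> 0 \<Longrightarrow> e k - e l - w \<in> V"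
    and kl: "k \<in> I" "l \<in> I" "T X k l \<noteq> 0"
  shows "e k - e l - w \<in> V"
proof -
  have "T X k l = (\<Sum>j\<in>J. \<Sum>a\<in>I. \<Sum>b\<in>I. X a b * (cnj (A j a k) * A j b l))"
    by (simp add: T_def mm_def adjf_def sum_distrib_left mult_ac)
  also have "\<dots> = (\<Sum>a\<in>I. \<Sum>b\<in>I. \<Sum>j\<in>J. X a b * (cnj (A j a k) * A j b l))"
    by (rule sum_swap21[symmetric])
  also have "\<dots> = (\<Sum>a\<in>I. \<Sum>b\<in>I. X a b * (\<Sum>j\<in>J. cnj (A j a k) * A j b l))"
    by (simp only: sum_distrib_left)
  finally obtain a b where ab: "a \<in> I" "b \<in> I" "X a b * (\<Sum>j\<in>J. cnj (A j a k) * A j b l) \<noteq> 0"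
    using kl(3) by (metis (no_types, lifting) sum.neutral)
  then have "e a - e b - w \<in> V" "e a - e b - (e k - e l) \<in> V"
    using X[of a b] tmode[of k l a b] kl by auto
  from rational_subspaceD(4)[OF V this] show ?thesis by (simp add: algebra_simps)
qed

text \<open>The hypothesis \<open>ycomm\<close> encodes, by commutants, that \<open>Y\<close> is
  built from the \<open>A j\<close> and their adjoints. The fixed matrix \<open>c\<close> is not
  tied to the weights \<open>lam\<close> and may have any modes, so the vanishing has to come from
  \<open>Z\<close>.\<close>

theorem (in faithful_kraus) nonzero_mode_expectation_zero:
  assumes V: "rational_subspace V" and w: "w \<notin> V"
    and fixed: "\<And>p q. p \<in> I \<Longrightarrow> q \<in> I \<Longrightarrow>
      (\<Sum>j\<in>J. \<Sum>k\<in>I. \<Sum>l\<in>I. A j p k * c k l * cnj (A j q l)) = c p q"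
    and tmode: "\<And>k l p q. \<lbrakk>k \<in> I; l \<in> I; p \<in> I; q \<in> I; (\<Sum>j\<in>J. cnj (A j p k) * A j q l) \<noteq> 0\<rbrakk>
      \<Longrightarrow> e p - e q - (e k - e l) \<in> V"
    and Y: "on_I Y" and ymode: "\<And>k l. k \<in> I \<Longrightarrow> l \<in> I \<Longrightarrow> Y k l \<noteq> 0 \<Longrightarrow> e k - e l - w \<in> V"
    and ycomm: "\<And>X. \<lbrakk>\<And>j. j \<in> J \<Longrightarrow> mm I X (A j) = mm I (A j) X;
      \<And>j. j \<in> J \<Longrightarrow> mm I X (adjf (A j)) = mm I (adjf (A j)) X\<rbrakk> \<Longrightarrow> mm I X Y = mm I Y X"
  shows "(\<Sum>p\<in>I. \<Sum>q\<in>I. c q p * Y p q) = 0"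
proof -
  obtain Z r where Z: "strict_mono r" "on_I Z" "T Z = Z"
      and lim: "\<And>p q. (\<lambda>N. cesaro Y (r N) p q) \<longlonglongrightarrow> Z p q"
    using cesaro_limit[OF Y] by blast
  have powmode: "e k - e l - w \<in> V" if "k \<in> I" "l \<in> I" "(T ^^ m) Y k l \<noteq> 0" for k l m
    using that
  proof (induction m arbitrary: k l)
    case 0
    then show ?case using ymode by simp
  next
    case (Suc m)
    show ?case by (rule T_mode[where k=k and l=l, OF V tmode Suc.IH]) (use Suc.prems in auto)
  qed
  have zmode: "e k - e l - w \<in> V" if "k \<in> I" "l \<in> I" "Z k l \<noteq> 0" for k l
  proof (rule ccontr)
    assume "\<not> ?thesis"
    then have "(T ^^ m) Y k l = 0" for m using powmode[OF that(1,2)] by blast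
    then have "cesaro Y N k l = 0" for N by (simp add: cesaro_def)
    then have "Z k l = 0" using lim[of k l] by (simp add: LIMSEQ_const_iff)
    then show False using that(3) by simp
  qed
  \<comment> \<open>Both \<open>Z\<close> and its adjoint are fixed points. Commutation of
    \<open>Z\<close> with \<open>A j\<close>, read through the adjoint, becomes commutation of
    \<open>adjf Z\<close> with \<open>adjf (A j)\<close>.\<close>
  have fpa: "T (adjf Z) = adjf Z" using T_adjf Z(3) by metis
  have c1: "mm I (adjf Z) (A j) = mm I (A j) (adjf Z)" if "j \<in> J" for j
    by (rule fixed_point_commutes[OF on_I_adjf[OF Z(2)] fpa that])
  have c2: "mm I (adjf Z) (adjf (A j)) = mm I (adjf (A j)) (adjf Z)" if "j \<in> J" for j
    using fixed_point_commutes[OF Z(2,3) that] by (metis adjf_mm)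
  have normal: "mm I (adjf Z) Z = mm I Z (adjf Z)"
    using cesaro_limit_commutes[OF lim c1 c2 ycomm[OF c1 c2]] .
  have "Z p q = 0" if "p \<in> I" "q \<in> I" for p q
    by (rule normal_nonzero_mode_zero[where e=e and V=V and w=w, OF finI _ zmode rational_subspaceD(2)[OF V]
          rational_subspaceD(3)[OF V] rational_subspaceD(5)[OF V] w that]) (simp_all add: normal)
  moreover have "(\<Sum>p\<in>I. \<Sum>q\<in>I. c q p * Z p q) = (\<Sum>p\<in>I. \<Sum>q\<in>I. c q p * Y p q)"
  proof (rule cesaro_limit_linear[OF lim])
    show "(\<Sum>p\<in>I. \<Sum>q\<in>I. c q p * (T ^^ m) Y p q) = (\<Sum>p\<in>I. \<Sum>q\<in>I. c q p * Y p q)" for m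
    proof (induction m)
      case (Suc m)
      then show ?case using expectation_T[OF fixed, of "(T ^^ m) Y"] by simp
    qed simp
  qed
  ultimately show ?thesis by simp
qed

section \<open>Catalysts\<close>

text \<open>States are carried as Gram vectors \<open>g t\<close>, which makes positivity manifest;
  this identity returns from the vectors to matrix entries.\<close>

lemma gram_form:
  "(\<Sum>t\<in>S. (\<Sum>k\<in>K. a k * g t k) * cnj (\<Sum>l\<in>L. b l * g' t l)) =
   (\<Sum>k\<in>K. \<Sum>l\<in>L. a k * (\<Sum>t\<in>S. g t k * cnj (g' t l)) * cnj (b l))"
proof -
  have "(\<Sum>t\<in>S. (\<Sum>k\<in>K. a k * g t k) * cnj (\<Sum>l\<in>L. b l * g' t l)) =
      (\<Sum>t\<in>S. \<Sum>k\<in>K. \<Sum>l\<in>L. a k * (g t k * cnj (g' t l)) * cnj (b l))"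
    unfolding cnj_sum sum_product by (intro sum.cong refl) (simp add: mult_ac)
  also have "\<dots> = (\<Sum>k\<in>K. \<Sum>l\<in>L. \<Sum>t\<in>S. a k * (g t k * cnj (g' t l)) * cnj (b l))"
    by (rule sum_swap21[symmetric])
  also have "\<dots> = (\<Sum>k\<in>K. \<Sum>l\<in>L. a k * (\<Sum>t\<in>S. g t k * cnj (g' t l)) * cnj (b l))"
    by (simp only: sum_distrib_left sum_distrib_right)
  finally show ?thesis .
qed

lemma sum_mult_cnj_self: "(\<Sum>t\<in>S. f t * cnj (f t)) = of_real (\<Sum>t\<in>S. (cmod (f t))\<^sup>2)"
  by (simp only: of_real_sum complex_norm_square)

section \<open>Catalysts with diagonal block part\<close>

text \<open>The hypothesis \<open>diag\<close> says that the block part of the catalyst matrix,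
  whose Gram vectors are the \<open>g t\<close>, is already diagonal. It is then invariant, and on
  its support the theorem on expectations applies, with the full catalyst matrix as the fixed
  matrix.\<close>

theorem diagonal_catalyst:
  fixes A :: "'r \<Rightarrow> nat \<Rightarrow> nat \<Rightarrow> nat \<Rightarrow> complex"
  assumes R: "finite R" and V: "rational_subspace V"
    and TP: "\<And>k l. k < n \<Longrightarrow> l < n \<Longrightarrow>
      (\<Sum>r\<in>R. \<Sum>s<m. \<Sum>p<n. A r s p k * cnj (A r s p l)) = (if k = l then 1 else 0)"
    and mode: "\<And>s s' p q k l. \<lbrakk>s < m; s' < m; p < n; q < n; k < n; l < n;
      (\<Sum>r\<in>R. A r s p k * cnj (A r s' q l)) \<noteq> 0\<rbrakk> \<Longrightarrow> \<epsilon> s + e p - (\<epsilon> s' + e q) - (e k - e l) \<in> V"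
    and fixed: "\<And>p q. p < n \<Longrightarrow> q < n \<Longrightarrow>
      (\<Sum>r\<in>R. \<Sum>s<m. \<Sum>t<n. (\<Sum>k<n. A r s p k * g t k) * cnj (\<Sum>k<n. A r s q k * g t k))
        = (\<Sum>t<n. g t p * cnj (g t q))"
    and diag: "\<And>k l. \<lbrakk>k < n; l < n; k \<noteq> l; e k - e l \<in> V\<rbrakk> \<Longrightarrow> (\<Sum>t<n. g t k * cnj (g t l)) = 0"
    and s: "s < m" "s' < m" "\<epsilon> s - \<epsilon> s' \<notin> V"
  shows "(\<Sum>r\<in>R. \<Sum>t<n. \<Sum>p<n. (\<Sum>k<n. A r s p k * g t k) * cnj (\<Sum>k<n. A r s' p k * g t k)) = 0"
proof -
  define c where "c k l = (\<Sum>t<n. g t k * cnj (g t l))" for k l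
  define lam where "lam k = (\<Sum>t<n. (cmod (g t k))\<^sup>2)" for k
  \<comment> \<open>Entry of the reduced channel on C: the weight of \<open>c k l\<close> in the
    output entry at \<open>p\<close>, \<open>q\<close>.\<close>
  define M where "M p k q l = (\<Sum>r\<in>R. \<Sum>s<m. A r s p k * cnj (A r s q l))" for p k q l
  have ckk: "c k k = of_real (lam k)" for k unfolding c_def lam_def by (rule sum_mult_cnj_self)
  have lam_nn: "lam k \<ge> 0" for k unfolding lam_def by (intro sum_nonneg) auto
  have fixed_c: "(\<Sum>k<n. \<Sum>l<n. c k l * M p k q l) = c p q" if "p < n" "q < n" for p q
  proof -
    have "c p q = (\<Sum>r\<in>R. \<Sum>s<m. \<Sum>k<n. \<Sum>l<n. A r s p k * c k l * cnj (A r s q l))"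
      using fixed[OF that] unfolding gram_form c_def by simp
    also have "\<dots> = (\<Sum>k<n. \<Sum>l<n. \<Sum>r\<in>R. \<Sum>s<m. A r s p k * c k l * cnj (A r s q l))" by (rule sum_swap22)
    also have "\<dots> = (\<Sum>k<n. \<Sum>l<n. c k l * M p k q l)"
      by (simp add: M_def sum_distrib_left mult_ac)
    finally show ?thesis by simp
  qed
  have Mmode: "e p - e q - (e k - e l) \<in> V" if nz: "p < n" "q < n" "k < n" "l < n" "M p k q l \<noteq> 0" for p q k l
  proof -
    have "M p k q l = (\<Sum>s<m. \<Sum>r\<in>R. A r s p k * cnj (A r s q l))" unfolding M_def by (rule sum.swap)
    then obtain s where "s < m" "(\<Sum>r\<in>R. A r s p k * cnj (A r s q l)) \<noteq> 0"
      using nz(5) by (metis (no_types, lifting) lessThan_iff sum.neutral)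
    then show ?thesis using mode[of s s p q k l] nz by simp
  qed
  \<comment> \<open>Cutting down to the block part commutes with the channel. If \<open>p\<close>
    and \<open>q\<close> lie in one coset, only entries of \<open>c\<close> within a coset
    contribute, and these are diagonal; otherwise covariance makes every \<open>M p k q k\<close>
    vanish.\<close>
  have lamfix: "(\<Sum>k<n. of_real (lam k) * M p k q k) = (if p = q then of_real (lam p) else 0)"
    if pq: "p < n" "q < n" for p q
  proof (cases "e p - e q \<in> V")
    case True
    have "c k l * M p k q l = (if k = l then of_real (lam k) * M p k q k else 0)" if "k < n" "l < n" for k l
    proof (cases "k = l \<or> M p k q l = 0")
      case True
      then show ?thesis by (auto simp: ckk)
    next
      case False
      then have "e p - e q - (e k - e l) \<in> V" using Mmode pq that by blast
      then have "e k - e l \<in> V" using rational_subspaceD(4)[OF V True] by fastforce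
      then have "c k l = 0" using diag that False unfolding c_def by blast
      then show ?thesis using False by simp
    qed
    then have "(\<Sum>k<n. \<Sum>l<n. c k l * M p k q l) = (\<Sum>k<n. \<Sum>l<n. if k = l then of_real (lam k) * M p k q k else 0)"
      by (intro sum.cong refl) auto
    also have "\<dots> = (\<Sum>k<n. of_real (lam k) * M p k q k)" by simp
    finally have "(\<Sum>k<n. of_real (lam k) * M p k q k) = c p q" using fixed_c[OF pq] by simp
    moreover have "c p q = (if p = q then of_real (lam p) else 0)"
      using diag[OF pq _ True] ckk unfolding c_def by auto
    ultimately show ?thesis by simp
  next
    case False
    then have "M p k q k = 0" if "k < n" for k using Mmode[of p q k k] pq that by auto
    moreover have "p \<noteq> q" using False rational_subspaceD(1)[OF V] by auto
    ultimately show ?thesis by simp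
  qed
  define I where "I = {k. k < n \<and> lam k > 0}"
  have finI: "finite I" by (simp add: I_def)
  \<comment> \<open>A vanishing diagonal entry kills the whole row and column of \<open>c\<close>,
    entries between different cosets included, because the Gram vectors vanish there.\<close>
  have g0: "g t k = 0" if "k < n" "k \<notin> I" "t < n" for t k
  proof -
    have "lam k = 0" using that(1,2) lam_nn[of k] by (auto simp: I_def)
    then have "\<forall>t\<in>{..<n}. (cmod (g t k))\<^sup>2 = 0" unfolding lam_def by (subst (asm) sum_nonneg_eq_0_iff) auto
    then show ?thesis using that(3) by simp
  qed
  have c0: "c k l = 0" if "k < n" "l < n" "k \<notin> I \<or> l \<notin> I" for k l
    using g0 that unfolding c_def by (intro sum.neutral) auto
  \<comment> \<open>Nothing leaves the support: on the diagonal at \<open>p\<close> with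
    \<open>lam p = 0\<close>, invariance reads as a vanishing sum of squares with weights
    \<open>lam k\<close>.\<close>
  have leak: "A r s p k = 0" if "p < n" "p \<notin> I" "k \<in> I" "r \<in> R" "s < m" for r s p k
  proof -
    have "lam p = 0" using that(1,2) lam_nn[of p] by (auto simp: I_def)
    let ?N = "\<lambda>k. \<Sum>r\<in>R. \<Sum>s<m. (cmod (A r s p k))\<^sup>2"
    have "M p k p k = of_real (?N k)" for k
      unfolding M_def sum_mult_cnj_self of_real_sum ..
    then have "complex_of_real (\<Sum>k<n. lam k * ?N k) = 0"
      using lamfix[OF that(1,1)] \<open>lam p = 0\<close> by simp
    then have z: "(\<Sum>k<n. lam k * ?N k) = 0" by (simp only: of_real_eq_0_iff)
    have nn: "?N k \<ge> 0" for k by (intro sum_nonneg) auto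
    have "\<forall>k\<in>{..<n}. lam k * ?N k = 0"
      using z by (subst (asm) sum_nonneg_eq_0_iff) (use lam_nn nn in auto)
    then have "lam k * ?N k = 0" using that(3) unfolding I_def by blast
    then have "?N k = 0" using that(3) by (simp add: I_def)
    then have "(\<Sum>s<m. (cmod (A r s p k))\<^sup>2) = 0"
      using R that(4) by (subst (asm) sum_nonneg_eq_0_iff) (auto intro: sum_nonneg)
    then show ?thesis using that(5) by (subst (asm) sum_nonneg_eq_0_iff) auto
  qed
  have restrict: "(\<Sum>p<n. f p) = (\<Sum>p\<in>I. f p)" if "\<And>p. p < n \<Longrightarrow> p \<notin> I \<Longrightarrow> f p = 0" for f :: "nat \<Rightarrow> complex"
    using that by (intro sum.mono_neutral_right) (auto simp: I_def)
  define J where "J = R \<times> {..<m}"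
  define B where "B j p k = (if p \<in> I \<and> k \<in> I then A (fst j) (snd j) p k else 0)" for j p k
  have sumJ: "(\<Sum>j\<in>J. f (fst j) (snd j)) = (\<Sum>r\<in>R. \<Sum>s<m. f r s)" for f :: "'r \<Rightarrow> nat \<Rightarrow> complex"
    by (simp add: J_def sum.cartesian_product split_def)
  have sumM: "(\<Sum>j\<in>J. B j p k * cnj (B j q l)) = M p k q l" if "p \<in> I" "q \<in> I" "k \<in> I" "l \<in> I" for p q k l
    using that sumJ[of "\<lambda>r s. A r s p k * cnj (A r s q l)"] by (simp add: B_def M_def)
  interpret faithful_kraus I J B lam
  proof
    show "finite I" "finite J" using R finI by (auto simp: J_def)
    show "B j p k = 0" if "p \<notin> I \<or> k \<notin> I" for j p k using that by (auto simp: B_def)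
    show "lam k > 0" if "k \<in> I" for k using that by (simp add: I_def)
    \<comment> \<open>Trace preservation survives the restriction, since by \<open>leak\<close>
      columns in \<open>I\<close> have no entries outside \<open>I\<close>.\<close>
    show "(\<Sum>j\<in>J. \<Sum>p\<in>I. B j p k * cnj (B j p l)) = (if k = l then 1 else 0)" if "k \<in> I" "l \<in> I" for k l
    proof -
      have "(\<Sum>j\<in>J. \<Sum>p\<in>I. B j p k * cnj (B j p l)) = (\<Sum>r\<in>R. \<Sum>s<m. \<Sum>p\<in>I. A r s p k * cnj (A r s p l))"
        using that sumJ[of "\<lambda>r s. \<Sum>p\<in>I. A r s p k * cnj (A r s p l)"] by (simp add: B_def)
      also have "\<dots> = (\<Sum>r\<in>R. \<Sum>s<m. \<Sum>p<n. A r s p k * cnj (A r s p l))"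
        by (intro sum.cong refl restrict[symmetric]) (use leak that in auto)
      finally show ?thesis using TP that by (simp add: I_def)
    qed
    show "(\<Sum>j\<in>J. \<Sum>k\<in>I. B j p k * of_real (lam k) * cnj (B j q k)) = (if p = q then of_real (lam p) else 0)"
      if "p \<in> I" "q \<in> I" for p q
    proof -
      have "(\<Sum>j\<in>J. \<Sum>k\<in>I. B j p k * of_real (lam k) * cnj (B j q k)) =
          (\<Sum>k\<in>I. of_real (lam k) * (\<Sum>j\<in>J. B j p k * cnj (B j q k)))"
        by (subst sum.swap) (simp add: sum_distrib_left mult_ac)
      also have "\<dots> = (\<Sum>k\<in>I. of_real (lam k) * M p k q k)"
        using sumM that by (intro sum.cong refl) simp
      also have "\<dots> = (\<Sum>k<n. of_real (lam k) * M p k q k)"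
        using lam_nn by (intro restrict[symmetric]) (auto simp: I_def order_less_le)
      finally show ?thesis using lamfix that by (simp add: I_def)
    qed
  qed
  define Y where "Y l k = (\<Sum>r\<in>R. mm I (adjf (B (r, s'))) (B (r, s)) l k)" for l k
  have Yon: "on_I Y" unfolding Y_def on_I_def mm_def adjf_def by (auto simp: B_def intro!: sum.neutral)
  have Yeq: "Y l k = (\<Sum>r\<in>R. \<Sum>p\<in>I. A r s p k * cnj (A r s' p l))" if "l \<in> I" "k \<in> I" for l k
    using that by (simp add: Y_def mm_def adjf_def B_def mult.commute)
  have "(\<Sum>p\<in>I. \<Sum>q\<in>I. c q p * Y p q) = 0"
  proof (rule nonzero_mode_expectation_zero[where e=e and V=V and w="\<epsilon> s' - \<epsilon> s", OF V])
    show "\<epsilon> s' - \<epsilon> s \<notin> V" using s(3) rational_subspaceD(3)[OF V, of "\<epsilon> s' - \<epsilon> s"] by auto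
    show "(\<Sum>j\<in>J. \<Sum>k\<in>I. \<Sum>l\<in>I. B j p k * c k l * cnj (B j q l)) = c p q" if "p \<in> I" "q \<in> I" for p q
    proof -
      have "(\<Sum>j\<in>J. \<Sum>k\<in>I. \<Sum>l\<in>I. B j p k * c k l * cnj (B j q l)) =
          (\<Sum>k\<in>I. \<Sum>l\<in>I. c k l * (\<Sum>j\<in>J. B j p k * cnj (B j q l)))"
        by (subst sum_swap21[symmetric]) (simp add: sum_distrib_left mult_ac)
      also have "\<dots> = (\<Sum>k\<in>I. \<Sum>l\<in>I. c k l * M p k q l)"
        using sumM that by (intro sum.cong refl) simp
      also have "\<dots> = (\<Sum>k\<in>I. \<Sum>l<n. c k l * M p k q l)"
        by (intro sum.cong refl restrict[symmetric]) (auto simp: c0 I_def)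
      also have "\<dots> = (\<Sum>k<n. \<Sum>l<n. c k l * M p k q l)"
        by (intro restrict[symmetric] sum.neutral) (auto simp: c0)
      finally show ?thesis using fixed_c that by (simp add: I_def)
    qed
    show "e p - e q - (e k - e l) \<in> V"
      if "k \<in> I" "l \<in> I" "p \<in> I" "q \<in> I" "(\<Sum>j\<in>J. cnj (B j p k) * B j q l) \<noteq> 0" for k l p q
    proof -
      have "(\<Sum>j\<in>J. cnj (B j p k) * B j q l) = cnj (\<Sum>j\<in>J. B j p k * cnj (B j q l))" by simp
      then have "M p k q l \<noteq> 0" using sumM that by auto
      then show ?thesis using Mmode that by (simp add: I_def)
    qed
    show "on_I Y" by (rule Yon)
    show "e l - e k - (\<epsilon> s' - \<epsilon> s) \<in> V" if lk: "l \<in> I" "k \<in> I" "Y l k \<noteq> 0" for l k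
    proof -
      have "Y l k = (\<Sum>p\<in>I. \<Sum>r\<in>R. A r s p k * cnj (A r s' p l))"
        unfolding Yeq[OF lk(1,2)] by (rule sum.swap)
      then obtain p where p: "p \<in> I" "(\<Sum>r\<in>R. A r s p k * cnj (A r s' p l)) \<noteq> 0"
        using lk(3) by (metis (no_types, lifting) sum.neutral)
      then have "\<epsilon> s + e p - (\<epsilon> s' + e p) - (e k - e l) \<in> V"
        using lk s by (intro mode) (auto simp: I_def)
      then show ?thesis by (simp add: algebra_simps)
    qed
    show "mm I X Y = mm I Y X" if xc: "\<And>j. j \<in> J \<Longrightarrow> mm I X (B j) = mm I (B j) X"
      "\<And>j. j \<in> J \<Longrightarrow> mm I X (adjf (B j)) = mm I (adjf (B j)) X" for X
    proof -
      have "mm I X (mm I (adjf (B (r, s'))) (B (r, s))) = mm I (mm I (adjf (B (r, s'))) (B (r, s))) X"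
        if r: "r \<in> R" for r
      proof -
        have "(r, s) \<in> J" "(r, s') \<in> J" using r s by (auto simp: J_def)
        then have "mm I X (B (r, s)) = mm I (B (r, s)) X" "mm I X (adjf (B (r, s'))) = mm I (adjf (B (r, s'))) X"
          using xc by blast+
        then show ?thesis by (metis mm_assoc)
      qed
      then show ?thesis unfolding Y_def[abs_def] mm_sum_right mm_sum_left by (intro ext sum.cong refl) simp
    qed
  qed
  \<comment> \<open>The claim is about tr (c Y): the sum over outputs \<open>p\<close> shrinks to
    \<open>I\<close> by \<open>leak\<close>, the sums over \<open>k\<close> and \<open>l\<close>
    because \<open>c\<close> vanishes off \<open>I\<close>.\<close>
  moreover have "(\<Sum>r\<in>R. \<Sum>t<n. \<Sum>p<n. (\<Sum>k<n. A r s p k * g t k) * cnj (\<Sum>k<n. A r s' p k * g t k)) =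
      (\<Sum>p\<in>I. \<Sum>q\<in>I. c q p * Y p q)"
  proof -
    have "(\<Sum>r\<in>R. \<Sum>t<n. \<Sum>p<n. (\<Sum>k<n. A r s p k * g t k) * cnj (\<Sum>k<n. A r s' p k * g t k)) =
        (\<Sum>r\<in>R. \<Sum>p<n. \<Sum>t<n. (\<Sum>k<n. A r s p k * g t k) * cnj (\<Sum>k<n. A r s' p k * g t k))"
      by (rule sum.cong[OF refl], rule sum.swap)
    also have "\<dots> = (\<Sum>r\<in>R. \<Sum>p<n. \<Sum>k<n. \<Sum>l<n. A r s p k * c k l * cnj (A r s' p l))"
      unfolding gram_form c_def ..
    also have "\<dots> = (\<Sum>r\<in>R. \<Sum>p<n. \<Sum>k\<in>I. \<Sum>l\<in>I. A r s p k * c k l * cnj (A r s' p l))"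
    proof (rule sum.cong[OF refl], rule sum.cong[OF refl])
      fix r p
      have "(\<Sum>k<n. \<Sum>l<n. A r s p k * c k l * cnj (A r s' p l)) = (\<Sum>k\<in>I. \<Sum>l<n. A r s p k * c k l * cnj (A r s' p l))"
        by (intro restrict sum.neutral) (auto simp: c0)
      also have "\<dots> = (\<Sum>k\<in>I. \<Sum>l\<in>I. A r s p k * c k l * cnj (A r s' p l))"
        by (intro sum.cong[OF refl] restrict) (auto simp: c0 I_def)
      finally show "(\<Sum>k<n. \<Sum>l<n. A r s p k * c k l * cnj (A r s' p l)) =
        (\<Sum>k\<in>I. \<Sum>l\<in>I. A r s p k * c k l * cnj (A r s' p l))" .
    qed
    also have "\<dots> = (\<Sum>r\<in>R. \<Sum>p\<in>I. \<Sum>k\<in>I. \<Sum>l\<in>I. A r s p k * c k l * cnj (A r s' p l))"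
      by (intro sum.cong[OF refl] restrict sum.neutral) (auto simp: leak s)
    also have "\<dots> = (\<Sum>k\<in>I. \<Sum>l\<in>I. \<Sum>r\<in>R. \<Sum>p\<in>I. A r s p k * c k l * cnj (A r s' p l))"
      by (rule sum_swap22)
    also have "\<dots> = (\<Sum>k\<in>I. \<Sum>l\<in>I. c k l * Y l k)"
      by (intro sum.cong refl) (simp add: Yeq sum_distrib_left mult_ac)
    also have "\<dots> = (\<Sum>l\<in>I. \<Sum>k\<in>I. c k l * Y l k)" by (rule sum.swap)
    finally show ?thesis .
  qed
  ultimately show ?thesis by simp
qed

section \<open>Change of basis on the catalyst\<close>

lemma orthonormal_resolution:
  assumes "orthonormal n n v"
  shows "(\<Sum>k<n. (\<Sum>x<n. a x * v k x) * (\<Sum>y<n. cnj (v k y) * b y)) = (\<Sum>x<n. a x * b x)"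
proof -
  have "(\<Sum>k<n. (\<Sum>x<n. a x * v k x) * (\<Sum>y<n. cnj (v k y) * b y)) =
      (\<Sum>k<n. (\<Sum>x<n. a x * v k x) * cnj (\<Sum>y<n. cnj (b y) * v k y))"
    by (simp add: mult.commute)
  also have "\<dots> = (\<Sum>x<n. \<Sum>y<n. a x * (if x = y then 1 else 0) * b y)"
    unfolding gram_form using orthonormal_complete[OF assms] by (intro sum.cong refl) simp
  also have "\<dots> = (\<Sum>x<n. a x * b x)"
    by (simp add: if_distrib[of "\<lambda>x. _ * x"] if_distrib[of "\<lambda>x. x * _"] cong: if_cong)
  finally show ?thesis .
qed

lemma orthonormal_parseval:
  assumes "orthonormal n n v"
  shows "(\<Sum>p<n. (\<Sum>z<n. cnj (v p z) * a z) * cnj (\<Sum>z<n. cnj (v p z) * b z)) = (\<Sum>z<n. a z * cnj (b z))"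
  using orthonormal_resolution[OF assms, of "\<lambda>z. cnj (b z)" a] by (simp add: mult.commute)

text \<open>Conjugating input and output on C by an eigenbasis of the block part reduces to the
  diagonal case. Block diagonalisation puts each basis vector into one energy coset, so covariance
  modulo \<open>V\<close> survives although the new basis vectors need not be energy
  eigenvectors.\<close>

theorem covariant_catalyst:
  fixes A :: "'r \<Rightarrow> nat \<Rightarrow> nat \<Rightarrow> nat \<Rightarrow> complex"
  assumes R: "finite R" and V: "rational_subspace V"
    and TP: "\<And>k l. k < n \<Longrightarrow> l < n \<Longrightarrow>
      (\<Sum>r\<in>R. \<Sum>s<m. \<Sum>p<n. A r s p k * cnj (A r s p l)) = (if k = l then 1 else 0)"
    and mode: "\<And>s s' p q k l. \<lbrakk>s < m; s' < m; p < n; q < n; k < n; l < n;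
      (\<Sum>r\<in>R. A r s p k * cnj (A r s' q l)) \<noteq> 0\<rbrakk> \<Longrightarrow> \<epsilon> s + h p - (\<epsilon> s' + h q) - (h k - h l) \<in> V"
    and fixed: "\<And>p q. p < n \<Longrightarrow> q < n \<Longrightarrow>
      (\<Sum>r\<in>R. \<Sum>s<m. \<Sum>t<n. (\<Sum>k<n. A r s p k * g t k) * cnj (\<Sum>k<n. A r s q k * g t k))
        = (\<Sum>t<n. g t p * cnj (g t q))"
    and s: "s < m" "s' < m" "\<epsilon> s - \<epsilon> s' \<notin> V"
  shows "(\<Sum>r\<in>R. \<Sum>t<n. \<Sum>p<n. (\<Sum>k<n. A r s p k * g t k) * cnj (\<Sum>k<n. A r s' p k * g t k)) = 0"
proof -
  note Vadd = rational_subspaceD(2)[OF V] and Vneg = rational_subspaceD(3)[OF V]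
    and Vdiff = rational_subspaceD(4)[OF V]
  have Vsym: "h y - h x \<in> V" if "h x - h y \<in> V" for x y using Vneg[OF that] by simp
  define c where "c x y = (\<Sum>t<n. g t x * cnj (g t y))" for x y
  define c0 where "c0 x y = (if h x - h y \<in> V then c x y else 0)" for x y
  \<comment> \<open>The coset of \<open>h x\<close> as a set of reals, so that equal labels mean a
    difference in \<open>V\<close>.\<close>
  define \<kappa> where "\<kappa> x = {u. u - h x \<in> V}" for x
  have \<kappa>eq: "\<kappa> x = \<kappa> y \<longleftrightarrow> h x - h y \<in> V" for x y
  proof
    assume "\<kappa> x = \<kappa> y"
    moreover have "h x \<in> \<kappa> x" using rational_subspaceD(1)[OF V] by (simp add: \<kappa>_def)
    ultimately show "h x - h y \<in> V" by (simp add: \<kappa>_def)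
  next
    assume d: "h x - h y \<in> V"
    have "u - h x \<in> V \<longleftrightarrow> u - h y \<in> V" for u
      using Vadd[OF _ d, of "u - h x"] Vdiff[OF _ d, of "u - h y"] by auto
    then show "\<kappa> x = \<kappa> y" by (simp add: \<kappa>_def)
  qed
  have herm: "c0 j i = cnj (c0 i j)" for i j
    using Vsym by (auto simp: c0_def c_def mult.commute)
  have block: "\<kappa> i = \<kappa> j" if "i < n" "j < n" "c0 i j \<noteq> 0" for i j
    using that unfolding \<kappa>eq c0_def by (auto split: if_splits)
  have "\<exists>v \<mu>. orthonormal n n v \<and>
      (\<forall>k<n. \<forall>i<n. (\<Sum>j<n. c0 i j * v k j) = of_real (\<mu> k) * v k i) \<and>
      (\<forall>k<n. \<forall>i<n. \<forall>j<n. v k i \<noteq> 0 \<longrightarrow> v k j \<noteq> 0 \<longrightarrow> \<kappa> i = \<kappa> j)"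
    by (rule spectral_theorem_blocks) (rule herm, rule block)
  then obtain v \<mu> where on: "orthonormal n n v"
    and eig': "\<forall>k<n. \<forall>i<n. (\<Sum>j<n. c0 i j * v k j) = of_real (\<mu> k) * v k i"
    and cls': "\<forall>k<n. \<forall>i<n. \<forall>j<n. v k i \<noteq> 0 \<longrightarrow> v k j \<noteq> 0 \<longrightarrow> \<kappa> i = \<kappa> j" by blast
  note eig = eig'[rule_format] and cls = cls'[rule_format]
  have onD: "(\<Sum>i<n. cnj (v k i) * v l i) = (if k = l then 1 else 0)" if "k < n" "l < n" for k l
    using on that by (simp add: orthonormal_def)
  \<comment> \<open>Any coordinate at which \<open>v k\<close> is nonzero may represent its energy;
    by \<open>cls\<close> another choice changes \<open>e k\<close> only by an element of
    \<open>V\<close>.\<close>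
  define e where "e k = h (SOME x. x < n \<and> v k x \<noteq> 0)" for k
  have he: "h x - e k \<in> V" if "k < n" "x < n" "v k x \<noteq> 0" for k x
  proof -
    have "(SOME x. x < n \<and> v k x \<noteq> 0) < n \<and> v k (SOME x. x < n \<and> v k x \<noteq> 0) \<noteq> 0"
      by (rule someI[of _ x]) (use that in simp)
    then show ?thesis using cls[of k x] that unfolding e_def \<kappa>eq by blast
  qed
  define A' where "A' r s p k = (\<Sum>z<n. cnj (v p z) * (\<Sum>x<n. A r s z x * v k x))" for r s p k
  define g' where "g' t k = (\<Sum>x<n. cnj (v k x) * g t x)" for t k
  have A'g': "(\<Sum>k<n. A' r s p k * g' t k) = (\<Sum>z<n. cnj (v p z) * (\<Sum>x<n. A r s z x * g t x))" for r s p t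
  proof -
    have "A' r s p k = (\<Sum>x<n. (\<Sum>z<n. cnj (v p z) * A r s z x) * v k x)" for k
      unfolding A'_def sum_distrib_left sum_distrib_right by (subst sum.swap) (simp add: mult.assoc)
    then have "(\<Sum>k<n. A' r s p k * g' t k) = (\<Sum>x<n. (\<Sum>z<n. cnj (v p z) * A r s z x) * g t x)"
      unfolding g'_def by (simp only: orthonormal_resolution[OF on])
    also have "\<dots> = (\<Sum>z<n. cnj (v p z) * (\<Sum>x<n. A r s z x * g t x))"
      unfolding sum_distrib_left sum_distrib_right by (subst sum.swap) (simp add: mult.assoc)
    finally show ?thesis .
  qed
  have "(\<Sum>r\<in>R. \<Sum>t<n. \<Sum>p<n. (\<Sum>k<n. A' r s p k * g' t k) * cnj (\<Sum>k<n. A' r s' p k * g' t k)) = 0"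
  proof (rule diagonal_catalyst[where e=e and \<epsilon>=\<epsilon>, OF R V _ _ _ _ s])
    fix k l assume kl: "k < n" "l < n"
    let ?S = "R \<times> {..<m} \<times> {..<n}"
    let ?A = "\<lambda>(r,s,z). A r s z"
    have "(\<Sum>r\<in>R. \<Sum>s<m. \<Sum>p<n. A' r s p k * cnj (A' r s p l)) =
        (\<Sum>r\<in>R. \<Sum>s<m. \<Sum>z<n. (\<Sum>x<n. v k x * A r s z x) * cnj (\<Sum>x<n. v l x * A r s z x))"
      unfolding A'_def orthonormal_parseval[OF on] by (simp add: mult.commute)
    also have "\<dots> = (\<Sum>i\<in>?S. (\<Sum>x<n. v k x * ?A i x) * cnj (\<Sum>x<n. v l x * ?A i x))"
      by (simp add: sum.cartesian_product split_def)
    also have "\<dots> = (\<Sum>x<n. \<Sum>y<n. v k x * (\<Sum>i\<in>?S. ?A i x * cnj (?A i y)) * cnj (v l y))"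
      by (rule gram_form)
    also have "\<dots> = (\<Sum>x<n. \<Sum>y<n. v k x * (\<Sum>r\<in>R. \<Sum>s<m. \<Sum>z<n. A r s z x * cnj (A r s z y)) * cnj (v l y))"
      by (simp add: sum.cartesian_product split_def)
    also have "\<dots> = (\<Sum>x<n. \<Sum>y<n. v k x * (if x = y then 1 else 0) * cnj (v l y))"
      using TP by (intro sum.cong refl) simp
    also have "\<dots> = (\<Sum>x<n. cnj (v l x) * v k x)"
      by (simp add: if_distrib[of "\<lambda>x. _ * x"] if_distrib[of "\<lambda>x. x * _"] mult.commute cong: if_cong)
    also have "\<dots> = (if k = l then 1 else 0)" using onD kl by auto
    finally show "(\<Sum>r\<in>R. \<Sum>s<m. \<Sum>p<n. A' r s p k * cnj (A' r s p l)) = (if k = l then 1 else 0)" .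
  next
    fix s s' p q k l
    assume b: "s < m" "s' < m" "p < n" "q < n" "k < n" "l < n"
      and nz: "(\<Sum>r\<in>R. A' r s p k * cnj (A' r s' q l)) \<noteq> 0"
    let ?K = "{..<n} \<times> {..<n}"
    have A'2: "A' r s p k = (\<Sum>i\<in>?K. (cnj (v p (fst i)) * v k (snd i)) * A r s (fst i) (snd i))" for r s p k
      by (simp add: A'_def sum_distrib_left sum.cartesian_product split_def mult_ac)
    obtain i j where ij: "i \<in> ?K" "j \<in> ?K"
      "(cnj (v p (fst i)) * v k (snd i)) * (\<Sum>r\<in>R. A r s (fst i) (snd i) * cnj (A r s' (fst j) (snd j)))
         * cnj (cnj (v q (fst j)) * v l (snd j)) \<noteq> 0"
      using nz unfolding A'2 gram_form by (metis (no_types, lifting) sum.neutral)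
    then have "\<epsilon> s + h (fst i) - (\<epsilon> s' + h (fst j)) - (h (snd i) - h (snd j)) \<in> V"
      using b by (intro mode) auto
    \<comment> \<open>Replacing the four energies \<open>h\<close> by the representatives
      \<open>e\<close> changes the balance by an element of \<open>V\<close>.\<close>
    moreover have a: "h (fst i) - e p \<in> V" "h (snd i) - e k \<in> V" "h (fst j) - e q \<in> V" "h (snd j) - e l \<in> V"
      using ij b by (auto intro!: he)
    have "(h (fst i) - e p) - (h (fst j) - e q) - ((h (snd i) - e k) - (h (snd j) - e l)) \<in> V"
      by (rule Vdiff[OF Vdiff[OF a(1,3)] Vdiff[OF a(2,4)]])
    ultimately have "\<epsilon> s + h (fst i) - (\<epsilon> s' + h (fst j)) - (h (snd i) - h (snd j))
        - ((h (fst i) - e p) - (h (fst j) - e q) - ((h (snd i) - e k) - (h (snd j) - e l))) \<in> V"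
      by (rule Vdiff)
    then show "\<epsilon> s + e p - (\<epsilon> s' + e q) - (e k - e l) \<in> V" by (simp add: algebra_simps)
  next
    fix p q assume pq: "p < n" "q < n"
    let ?S = "R \<times> {..<m} \<times> {..<n}"
    let ?B = "\<lambda>(r,s,t) z. \<Sum>x<n. A r s z x * g t x"
    have "(\<Sum>r\<in>R. \<Sum>s<m. \<Sum>t<n. (\<Sum>k<n. A' r s p k * g' t k) * cnj (\<Sum>k<n. A' r s q k * g' t k)) =
        (\<Sum>i\<in>?S. (\<Sum>z<n. cnj (v p z) * ?B i z) * cnj (\<Sum>z<n. cnj (v q z) * ?B i z))"
      unfolding A'g' by (simp add: sum.cartesian_product split_def)
    also have "\<dots> = (\<Sum>z<n. \<Sum>z'<n. cnj (v p z) * (\<Sum>i\<in>?S. ?B i z * cnj (?B i z')) * cnj (cnj (v q z')))"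
      by (rule gram_form)
    also have "\<dots> = (\<Sum>z<n. \<Sum>z'<n. cnj (v p z) * (\<Sum>r\<in>R. \<Sum>s<m. \<Sum>t<n.
        (\<Sum>x<n. A r s z x * g t x) * cnj (\<Sum>x<n. A r s z' x * g t x)) * cnj (cnj (v q z')))"
      by (simp add: sum.cartesian_product split_def)
    also have "\<dots> = (\<Sum>z<n. \<Sum>z'<n. cnj (v p z) * (\<Sum>t<n. g t z * cnj (g t z')) * cnj (cnj (v q z')))"
      using fixed by (intro sum.cong[OF refl]) simp
    also have "\<dots> = (\<Sum>t<n. g' t p * cnj (g' t q))" unfolding g'_def by (rule gram_form[symmetric])
    finally show "(\<Sum>r\<in>R. \<Sum>s<m. \<Sum>t<n. (\<Sum>k<n. A' r s p k * g' t k) * cnj (\<Sum>k<n. A' r s q k * g' t k))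
        = (\<Sum>t<n. g' t p * cnj (g' t q))" .
  next
    fix k l assume kl: "k < n" "l < n" "k \<noteq> l" "e k - e l \<in> V"
    have "(\<Sum>t<n. g' t k * cnj (g' t l)) = (\<Sum>x<n. \<Sum>y<n. cnj (v k x) * c x y * cnj (cnj (v l y)))"
      unfolding g'_def c_def by (rule gram_form)
    \<comment> \<open>Coordinates that contribute lie in one coset, since \<open>e k\<close> and
      \<open>e l\<close> differ by an element of \<open>V\<close>; there \<open>c\<close> agrees
      with its block part, of which \<open>v l\<close> is an eigenvector.\<close>
    also have "\<dots> = (\<Sum>x<n. \<Sum>y<n. cnj (v k x) * (c0 x y * v l y))"
    proof (rule sum.cong[OF refl], rule sum.cong[OF refl])
      fix x y assume xy: "x \<in> {..<n}" "y \<in> {..<n}"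
      show "cnj (v k x) * c x y * cnj (cnj (v l y)) = cnj (v k x) * (c0 x y * v l y)"
      proof (cases "v k x = 0 \<or> v l y = 0")
        case False
        then have a: "h x - e k \<in> V" "h y - e l \<in> V" using he kl xy by auto
        have "(h x - e k) - (h y - e l) + (e k - e l) \<in> V" by (rule Vadd[OF Vdiff[OF a] kl(4)])
        then have "h x - h y \<in> V" by simp
        then show ?thesis by (simp add: c0_def)
      qed auto
    qed
    also have "\<dots> = (\<Sum>x<n. cnj (v k x) * (of_real (\<mu> l) * v l x))"
      using eig[OF kl(2)] by (intro sum.cong refl) (simp flip: sum_distrib_left)
    also have "\<dots> = of_real (\<mu> l) * (\<Sum>x<n. cnj (v k x) * v l x)"
      by (simp add: sum_distrib_left mult_ac)
    finally show "(\<Sum>t<n. g' t k * cnj (g' t l)) = 0" using onD kl by simp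
  qed
  \<comment> \<open>The trace over C does not depend on the basis.\<close>
  then show ?thesis unfolding A'g' orthonormal_parseval[OF on] .
qed

section \<open>Functions of a Hamiltonian and modes\<close>

text \<open>The function \<open>f\<close> takes the index of the eigenvector rather than an
  eigenvalue, so degenerate spectra need no care. With suitable \<open>f\<close> this is the
  Hamiltonian, an exponential of it or a spectral projector.\<close>

definition specfun :: "nat \<Rightarrow> (nat \<Rightarrow> nat \<Rightarrow> complex) \<Rightarrow> (nat \<Rightarrow> complex) \<Rightarrow> complex mat" where
  "specfun n v f = mat n n (\<lambda>(i,j). \<Sum>k<n. f k * v k i * cnj (v k j))"

definition vcoef :: "nat \<Rightarrow> (nat \<Rightarrow> nat \<Rightarrow> complex) \<Rightarrow> complex vec \<Rightarrow> nat \<Rightarrow> complex" where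
  "vcoef n v x k = (\<Sum>i<n. cnj (v k i) * x $ i)"

definition mcoef :: "nat \<Rightarrow> (nat \<Rightarrow> nat \<Rightarrow> complex) \<Rightarrow> complex mat \<Rightarrow> nat \<Rightarrow> nat \<Rightarrow> complex" where
  "mcoef n v X k l = (\<Sum>i<n. \<Sum>j<n. cnj (v k i) * X $$ (i,j) * v l j)"

lemma orthonormalD:
  "orthonormal n m v \<Longrightarrow> k < m \<Longrightarrow> l < m \<Longrightarrow> (\<Sum>i<n. cnj (v k i) * v l i) = (if k = l then 1 else 0)"
  by (simp add: orthonormal_def)

lemma specfun_carrier [simp]: "specfun n v f \<in> carrier_mat n n" by (simp add: specfun_def)

lemma specfun_dim [simp]: "dim_row (specfun n v f) = n" "dim_col (specfun n v f) = n"
  by (simp_all add: specfun_def)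

lemma specfun_index: "i < n \<Longrightarrow> j < n \<Longrightarrow> specfun n v f $$ (i,j) = (\<Sum>k<n. f k * v k i * cnj (v k j))"
  by (simp add: specfun_def)

lemma mult_mat_index:
  "A \<in> carrier_mat n m \<Longrightarrow> B \<in> carrier_mat m p \<Longrightarrow> i < n \<Longrightarrow> j < p \<Longrightarrow>
    (A * B) $$ (i,j) = (\<Sum>k<m. A $$ (i,k) * (B $$ (k,j) :: complex))"
  by (auto simp: times_mat_def scalar_prod_def lessThan_atLeast0)

lemma mult_mat_vec_index_sum:
  "A \<in> carrier_mat n m \<Longrightarrow> x \<in> carrier_vec m \<Longrightarrow> i < n \<Longrightarrow>
    (A *\<^sub>v x) $ i = (\<Sum>k<m. A $$ (i,k) * (x $ k :: complex))"
  by (auto simp: mult_mat_vec_def scalar_prod_def lessThan_atLeast0)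

lemma specfun_apply:
  assumes "orthonormal n n v" "k < n"
  shows "(\<Sum>a<n. (\<Sum>l<n. f l * v l i * cnj (v l a)) * v k a) = f k * v k i"
proof -
  have "(\<Sum>a<n. (\<Sum>l<n. f l * v l i * cnj (v l a)) * v k a) = (\<Sum>a<n. \<Sum>l<n. f l * v l i * (cnj (v l a) * v k a))"
    by (simp add: sum_distrib_right mult.assoc)
  also have "\<dots> = (\<Sum>l<n. f l * v l i * (\<Sum>a<n. cnj (v l a) * v k a))"
    by (subst sum.swap) (simp add: sum_distrib_left)
  also have "\<dots> = (\<Sum>l<n. f l * v l i * (if l = k then 1 else 0))"
    using orthonormalD[OF assms(1) _ assms(2)] by (intro sum.cong refl) simp
  also have "\<dots> = f k * v k i" using assms(2) by (simp add: if_distrib[of "\<lambda>x. _ * x"] cong: if_cong)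
  finally show ?thesis .
qed

lemma specfun_mult:
  assumes "orthonormal n n v"
  shows "specfun n v f * specfun n v g = specfun n v (\<lambda>k. f k * g k)"
proof (rule eq_matI)
  fix i j assume "i < dim_row (specfun n v (\<lambda>k. f k * g k))" "j < dim_col (specfun n v (\<lambda>k. f k * g k))"
  then have ij: "i < n" "j < n" by auto
  have "(specfun n v f * specfun n v g) $$ (i,j) =
      (\<Sum>a<n. (\<Sum>l<n. f l * v l i * cnj (v l a)) * (\<Sum>k<n. g k * v k a * cnj (v k j)))"
    unfolding mult_mat_index[OF specfun_carrier specfun_carrier ij] using ij by (simp add: specfun_index)
  also have "\<dots> = (\<Sum>a<n. \<Sum>k<n. (\<Sum>l<n. f l * v l i * cnj (v l a)) * v k a * (g k * cnj (v k j)))"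
    by (intro sum.cong[OF refl]) (simp add: sum_distrib_left mult_ac)
  also have "\<dots> = (\<Sum>k<n. (\<Sum>a<n. (\<Sum>l<n. f l * v l i * cnj (v l a)) * v k a) * (g k * cnj (v k j)))"
    by (subst sum.swap) (simp only: sum_distrib_right)
  also have "\<dots> = specfun n v (\<lambda>k. f k * g k) $$ (i,j)"
    using specfun_apply[OF assms] ij by (simp add: specfun_index mult_ac)
  finally show "(specfun n v f * specfun n v g) $$ (i,j) = specfun n v (\<lambda>k. f k * g k) $$ (i,j)" .
qed auto

lemma specfun_one: "orthonormal n n v \<Longrightarrow> specfun n v (\<lambda>_. 1) = 1\<^sub>m n"
  by (rule eq_matI) (auto simp: specfun_index orthonormal_complete)

lemma specfun_smult: "z \<cdot>\<^sub>m specfun n v f = specfun n v (\<lambda>k. z * f k)"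
  by (rule eq_matI) (auto simp: specfun_index sum_distrib_left mult_ac)

lemma specfun_pow:
  assumes "orthonormal n n v"
  shows "specfun n v f ^\<^sub>m p = specfun n v (\<lambda>k. f k ^ p)"
proof (induction p)
  case 0
  show ?case using specfun_one[OF assms] by simp
next
  case (Suc p)
  then show ?case using specfun_mult[OF assms, of "\<lambda>k. f k ^ p" f] by (simp add: mult.commute)
qed

lemma adj_specfun: "adj (specfun n v f) = specfun n v (\<lambda>k. cnj (f k))"
  by (rule eq_matI) (auto simp: adj_def specfun_index mult_ac)

text \<open>Powers act on \<open>f\<close> pointwise, so each entry of the series is a finite
  combination of scalar exponential series.\<close>

lemma mat_exp_specfun:
  assumes "orthonormal n n v"
  shows "mat_exp (specfun n v f) = specfun n v (\<lambda>k. exp (f k))"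
proof (rule eq_matI)
  fix i j assume "i < dim_row (specfun n v (\<lambda>k. exp (f k)))" "j < dim_col (specfun n v (\<lambda>k. exp (f k)))"
  then have ij: "i < n" "j < n" by auto
  have s: "(\<lambda>p. f k ^ p / of_nat (fact p) * (v k i * cnj (v k j))) sums (exp (f k) * (v k i * cnj (v k j)))" for k
  proof -
    have "(\<lambda>p. f k ^ p / of_nat (fact p)) sums exp (f k)"
      using exp_converges[of "f k"] by (simp add: scaleR_conv_of_real divide_inverse mult.commute)
    then show ?thesis by (rule sums_mult2)
  qed
  have "(\<lambda>p. \<Sum>k<n. f k ^ p / of_nat (fact p) * (v k i * cnj (v k j))) sums (\<Sum>k<n. exp (f k) * (v k i * cnj (v k j)))"
    by (rule sums_sum[OF s])
  moreover have "(\<lambda>p. (specfun n v f ^\<^sub>m p) $$ (i,j) / of_nat (fact p)) =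
      (\<lambda>p. \<Sum>k<n. f k ^ p / of_nat (fact p) * (v k i * cnj (v k j)))"
    using ij by (simp add: specfun_pow[OF assms] specfun_index sum_divide_distrib mult_ac)
  ultimately have "(\<Sum>p. (specfun n v f ^\<^sub>m p) $$ (i,j) / of_nat (fact p)) = (\<Sum>k<n. exp (f k) * (v k i * cnj (v k j)))"
    by (simp add: sums_iff)
  then show "mat_exp (specfun n v f) $$ (i,j) = specfun n v (\<lambda>k. exp (f k)) $$ (i,j)"
    using ij by (simp add: mat_exp_def specfun_index mult.assoc)
qed (auto simp: mat_exp_def)

lemma mcoef_specfun_mult_left:
  assumes on: "orthonormal n n v" and X: "X \<in> carrier_mat n n" and k: "k < n"
  shows "mcoef n v (specfun n v f * X) k l = f k * mcoef n v X k l"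
proof -
  define S where "S i a = (\<Sum>m<n. f m * v m i * cnj (v m a))" for i a
  have cv: "(\<Sum>i<n. cnj (v k i) * S i a) = f k * cnj (v k a)" for a
  proof -
    have "cnj (\<Sum>i<n. cnj (v k i) * S i a) = (\<Sum>i<n. (\<Sum>m<n. cnj (f m) * v m a * cnj (v m i)) * v k i)"
      by (simp add: S_def mult_ac)
    then have "cnj (\<Sum>i<n. cnj (v k i) * S i a) = cnj (f k) * v k a"
      using specfun_apply[OF on k] by simp
    then show ?thesis by (metis complex_cnj_cnj complex_cnj_mult)
  qed
  have "cnj (v k i) * (specfun n v f * X) $$ (i,j) * v l j = (\<Sum>a<n. cnj (v k i) * S i a * (X $$ (a,j) * v l j))"
    if "i < n" "j < n" for i j
    unfolding mult_mat_index[OF specfun_carrier X that] sum_distrib_left sum_distrib_right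
    using that by (intro sum.cong refl) (simp add: specfun_index S_def mult.assoc)
  then have "mcoef n v (specfun n v f * X) k l =
      (\<Sum>i<n. \<Sum>j<n. \<Sum>a<n. cnj (v k i) * S i a * (X $$ (a,j) * v l j))"
    unfolding mcoef_def by (intro sum.cong refl) auto
  also have "\<dots> = (\<Sum>a<n. \<Sum>i<n. \<Sum>j<n. cnj (v k i) * S i a * (X $$ (a,j) * v l j))"
    by (rule sum_swap21)
  also have "\<dots> = (\<Sum>a<n. \<Sum>j<n. \<Sum>i<n. cnj (v k i) * S i a * (X $$ (a,j) * v l j))"
    by (rule sum.cong[OF refl], rule sum.swap)
  also have "\<dots> = (\<Sum>a<n. \<Sum>j<n. f k * (cnj (v k a) * X $$ (a,j) * v l j))"
    unfolding sum_distrib_right[symmetric] cv by (simp only: mult.assoc)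
  finally show ?thesis by (simp only: mcoef_def sum_distrib_left)
qed

lemma mcoef_specfun_mult_right:
  assumes on: "orthonormal n n v" and X: "X \<in> carrier_mat n n" and l: "l < n"
  shows "mcoef n v (X * specfun n v f) k l = f l * mcoef n v X k l"
proof -
  define S where "S i a = (\<Sum>m<n. f m * v m i * cnj (v m a))" for i a
  have vc: "(\<Sum>j<n. S a j * v l j) = f l * v l a" for a
    unfolding S_def by (rule specfun_apply[OF on l])
  have "cnj (v k i) * (X * specfun n v f) $$ (i,j) * v l j = (\<Sum>a<n. cnj (v k i) * X $$ (i,a) * (S a j * v l j))"
    if "i < n" "j < n" for i j
    unfolding mult_mat_index[OF X specfun_carrier that] sum_distrib_left sum_distrib_right
    using that by (intro sum.cong refl) (simp add: specfun_index S_def mult.assoc)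
  then have "mcoef n v (X * specfun n v f) k l =
      (\<Sum>i<n. \<Sum>j<n. \<Sum>a<n. cnj (v k i) * X $$ (i,a) * (S a j * v l j))"
    unfolding mcoef_def by (intro sum.cong refl) auto
  also have "\<dots> = (\<Sum>i<n. \<Sum>a<n. \<Sum>j<n. cnj (v k i) * X $$ (i,a) * (S a j * v l j))"
    by (rule sum.cong[OF refl], rule sum.swap)
  also have "\<dots> = (\<Sum>i<n. \<Sum>a<n. cnj (v k i) * X $$ (i,a) * (f l * v l a))"
    by (simp only: sum_distrib_left[symmetric] vc)
  also have "\<dots> = (\<Sum>i<n. \<Sum>a<n. f l * (cnj (v k i) * X $$ (i,a) * v l a))"
    by (intro sum.cong refl) simp
  finally show ?thesis by (simp only: mcoef_def sum_distrib_left)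
qed

lemma mcoef_expansion:
  assumes "orthonormal n n v" "i < n" "j < n"
  shows "(\<Sum>k<n. \<Sum>l<n. v k i * mcoef n v X k l * cnj (v l j)) = X $$ (i,j)"
proof -
  have "(\<Sum>k<n. \<Sum>l<n. v k i * mcoef n v X k l * cnj (v l j)) =
      (\<Sum>k<n. \<Sum>l<n. \<Sum>a<n. \<Sum>b<n. (v k i * cnj (v k a)) * X $$ (a,b) * (v l b * cnj (v l j)))"
    by (simp add: mcoef_def sum_distrib_left sum_distrib_right mult_ac)
  also have "\<dots> = (\<Sum>a<n. \<Sum>b<n. \<Sum>k<n. \<Sum>l<n. (v k i * cnj (v k a)) * X $$ (a,b) * (v l b * cnj (v l j)))"
    by (rule sum_swap22)
  also have "\<dots> = (\<Sum>a<n. \<Sum>b<n. (\<Sum>k<n. v k i * cnj (v k a)) * X $$ (a,b) * (\<Sum>l<n. v l b * cnj (v l j)))"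
    by (simp only: sum_product[symmetric] sum_distrib_right[symmetric])
  also have "\<dots> = (\<Sum>a<n. \<Sum>b<n. (if i = a then 1 else 0) * X $$ (a,b) * (if b = j then 1 else 0))"
    using orthonormal_complete[OF assms(1)] assms(2,3) by (intro sum.cong refl) simp
  also have "\<dots> = X $$ (i,j)" using assms(2,3)
    by (simp add: if_distrib[of "\<lambda>x. _ * x"] if_distrib[of "\<lambda>x. x * _"] cong: if_cong)
  finally show ?thesis .
qed

lemma mcoef_eq_zero:
  assumes "orthonormal n n v" "X \<in> carrier_mat n n" "\<And>k l. k < n \<Longrightarrow> l < n \<Longrightarrow> mcoef n v X k l = 0"
  shows "X = 0\<^sub>m n n"
  using assms(2) mcoef_expansion[OF assms(1), of _ _ X] assms(3) by (intro eq_matI) (force, auto)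

lemma vcoef_expansion:
  assumes "orthonormal n n v" "i < n"
  shows "(\<Sum>k<n. v k i * vcoef n v x k) = x $ i"
proof -
  have "(\<Sum>k<n. v k i * vcoef n v x k) = (\<Sum>k<n. \<Sum>a<n. (v k i * cnj (v k a)) * x $ a)"
    by (simp add: vcoef_def sum_distrib_left mult_ac)
  also have "\<dots> = (\<Sum>a<n. (\<Sum>k<n. v k i * cnj (v k a)) * x $ a)"
    by (subst sum.swap) (simp add: sum_distrib_right)
  also have "\<dots> = (\<Sum>a<n. (if i = a then 1 else 0) * x $ a)"
    using orthonormal_complete[OF assms] by (intro sum.cong refl) simp
  also have "\<dots> = x $ i" using assms(2) by (simp add: if_distrib[of "\<lambda>x. x * _"] cong: if_cong)
  finally show ?thesis .
qed

lemma vcoef_specfun: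
  assumes "orthonormal n n v" "x \<in> carrier_vec n" "k < n"
  shows "vcoef n v (specfun n v f *\<^sub>v x) k = f k * vcoef n v x k"
proof -
  have sx: "(specfun n v f *\<^sub>v x) $ i = (\<Sum>l<n. f l * v l i * vcoef n v x l)" if "i < n" for i
  proof -
    have "(specfun n v f *\<^sub>v x) $ i = (\<Sum>a<n. \<Sum>l<n. f l * v l i * (cnj (v l a) * x $ a))"
      unfolding mult_mat_vec_index_sum[OF specfun_carrier assms(2) that]
      using that by (simp add: specfun_index sum_distrib_right mult.assoc)
    also have "\<dots> = (\<Sum>l<n. f l * v l i * vcoef n v x l)"
      by (subst sum.swap) (simp add: vcoef_def sum_distrib_left)
    finally show ?thesis .
  qed
  have "vcoef n v (specfun n v f *\<^sub>v x) k = (\<Sum>i<n. \<Sum>l<n. (cnj (v k i) * v l i) * (f l * vcoef n v x l))"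
    unfolding vcoef_def[of n v "specfun n v f *\<^sub>v x"] by (intro sum.cong refl) (simp add: sx sum_distrib_left mult_ac del: index_mult_mat_vec)
  also have "\<dots> = (\<Sum>l<n. (\<Sum>i<n. cnj (v k i) * v l i) * (f l * vcoef n v x l))"
    by (subst sum.swap) (simp add: sum_distrib_right)
  also have "\<dots> = (\<Sum>l<n. (if k = l then 1 else 0) * (f l * vcoef n v x l))"
    using orthonormalD[OF assms(1,3)] by (intro sum.cong refl) simp
  also have "\<dots> = f k * vcoef n v x k" using assms(3) by (simp add: if_distrib[of "\<lambda>x. x * _"] cong: if_cong)
  finally show ?thesis .
qed

lemma vcoef_eqI:
  assumes "orthonormal n n v" "x \<in> carrier_vec n" "y \<in> carrier_vec n"
    "\<And>k. k < n \<Longrightarrow> vcoef n v x k = vcoef n v y k"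
  shows "x = y"
proof (rule eq_vecI)
  fix i assume "i < dim_vec y"
  then have i: "i < n" using assms(3) by simp
  have "x $ i = (\<Sum>k<n. v k i * vcoef n v x k)" using vcoef_expansion[OF assms(1) i] by simp
  also have "\<dots> = (\<Sum>k<n. v k i * vcoef n v y k)" using assms(4) by simp
  also have "\<dots> = y $ i" by (rule vcoef_expansion[OF assms(1) i])
  finally show "x $ i = y $ i" .
qed (use assms in auto)

lemma vcoef_smult: "x \<in> carrier_vec n \<Longrightarrow> vcoef n v (z \<cdot>\<^sub>v x) k = z * vcoef n v x k"
  by (simp add: vcoef_def sum_distrib_left mult_ac)

lemma hermitian_spectral:
  assumes "hermitian n H"
  shows "\<exists>v e. orthonormal n n v \<and> H = specfun n v (\<lambda>k. of_real (e k))"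
proof -
  have H: "H \<in> carrier_mat n n" "adj H = H" using assms by (auto simp: hermitian_def)
  have herm: "H $$ (j,i) = cnj (H $$ (i,j))" if "i < n" "j < n" for i j
  proof -
    have "H $$ (j,i) = adj H $$ (j,i)" using H by simp
    then show ?thesis using that H(1) by (simp add: adj_def)
  qed
  have "\<exists>v e. orthonormal n n v \<and> (\<forall>k<n. \<forall>i<n. (\<Sum>j<n. H $$ (i,j) * v k j) = of_real (e k) * v k i)"
    by (rule spectral_theorem) (rule herm)
  then obtain v e where on: "orthonormal n n v"
    and eig: "\<forall>k<n. \<forall>i<n. (\<Sum>j<n. H $$ (i,j) * v k j) = of_real (e k) * v k i" by blast
  have "H = specfun n v (\<lambda>k. of_real (e k))"
    using H(1) spectral_expansion[OF on, of "\<lambda>i j. H $$ (i,j)" "\<lambda>k. of_real (e k)"] eig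
    by (intro eq_matI) (auto simp: specfun_index)
  then show ?thesis using on by blast
qed

lemma adj_mult:
  assumes "A \<in> carrier_mat n m" "B \<in> carrier_mat m p"
  shows "adj (A * B) = adj B * adj A"
proof -
  have c: "adj A \<in> carrier_mat m n" "adj B \<in> carrier_mat p m" using assms by (auto simp: adj_def)
  show ?thesis
  proof (rule eq_matI)
    fix i j assume "i < dim_row (adj B * adj A)" "j < dim_col (adj B * adj A)"
    then have ij: "i < p" "j < n" using c by auto
    have "adj (A * B) $$ (i,j) = cnj (\<Sum>k<m. A $$ (j,k) * B $$ (k,i))"
      using ij assms mult_mat_index[OF assms ij(2,1)] by (simp add: adj_def)
    also have "\<dots> = (\<Sum>k<m. adj B $$ (i,k) * adj A $$ (k,j))"
      using ij assms by (simp add: adj_def mult.commute)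
    finally show "adj (A * B) $$ (i,j) = (adj B * adj A) $$ (i,j)" using mult_mat_index[OF c(2,1) ij] by simp
  qed (use assms in \<open>auto simp: adj_def\<close>)
qed

lemma mat_eq_of_mult_vec:
  fixes A B :: "complex mat"
  assumes "A \<in> carrier_mat n n" "B \<in> carrier_mat n n" "\<And>x. x \<in> carrier_vec n \<Longrightarrow> A *\<^sub>v x = B *\<^sub>v x"
  shows "A = B"
proof (rule eq_matI)
  fix i j assume "i < dim_row B" "j < dim_col B"
  then have ij: "i < n" "j < n" using assms by auto
  have u: "(M *\<^sub>v unit_vec n j) $ i = M $$ (i,j)" if "M \<in> carrier_mat n n" for M :: "complex mat"
    using ij that by (simp add: mult_mat_vec_index_sum[OF that] if_distrib[of "\<lambda>x. _ * x"] cong: if_cong)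
  show "A $$ (i,j) = B $$ (i,j)" using u[OF assms(1)] u[OF assms(2)] assms(3)[of "unit_vec n j"] by simp
qed (use assms in auto)

section \<open>Spectral projectors and modes\<close>

text \<open>The definition is by description, so uniqueness is the point: two orthogonal projectors
  with the same fixed vectors absorb each other, and taking adjoints turns this into
  equality.\<close>

lemma eigproj_specfun:
  assumes on: "orthonormal n n v" and H: "H = specfun n v (\<lambda>k. of_real (e k))"
  shows "eigproj H E = specfun n v (\<lambda>k. if e k = E then 1 else 0)"
proof -
  let ?P = "specfun n v (\<lambda>k. if e k = E then 1 else 0)"
  let ?good = "\<lambda>P. P \<in> carrier_mat n n \<and> P * P = P \<and> adj P = P \<and>
      (\<forall>x \<in> carrier_vec n. P *\<^sub>v x = x \<longleftrightarrow> H *\<^sub>v x = of_real E \<cdot>\<^sub>v x)"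
  have Hc: "H \<in> carrier_mat n n" using H by simp
  have gP: "?good ?P"
  proof (intro conjI ballI)
    show "?P * ?P = ?P" by (simp add: specfun_mult[OF on] if_distrib cong: if_cong)
    show "adj ?P = ?P" by (simp add: adj_specfun if_distrib cong: if_cong)
    fix x :: "complex vec" assume x: "x \<in> carrier_vec n"
    have "?P *\<^sub>v x = x \<longleftrightarrow> (\<forall>k<n. vcoef n v (?P *\<^sub>v x) k = vcoef n v x k)"
      using vcoef_eqI[OF on, of "?P *\<^sub>v x" x] x by (metis mult_mat_vec_carrier specfun_carrier)
    also have "\<dots> \<longleftrightarrow> (\<forall>k<n. vcoef n v (H *\<^sub>v x) k = vcoef n v (of_real E \<cdot>\<^sub>v x) k)"
      using x by (auto simp: H vcoef_specfun[OF on] vcoef_smult)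
    also have "\<dots> \<longleftrightarrow> H *\<^sub>v x = of_real E \<cdot>\<^sub>v x"
      using vcoef_eqI[OF on, of "H *\<^sub>v x" "of_real E \<cdot>\<^sub>v x"] x Hc by (metis mult_mat_vec_carrier smult_carrier_vec)
    finally show "?P *\<^sub>v x = x \<longleftrightarrow> H *\<^sub>v x = of_real E \<cdot>\<^sub>v x" .
  qed simp
  have absorb: "P * Q = Q" if P: "?good P" and Q: "?good Q" for P Q
  proof (rule mat_eq_of_mult_vec)
    fix x :: "complex vec" assume x: "x \<in> carrier_vec n"
    have Qx: "Q *\<^sub>v x \<in> carrier_vec n" using Q x by (meson mult_mat_vec_carrier)
    have "Q *\<^sub>v (Q *\<^sub>v x) = Q *\<^sub>v x" using Q x by (metis assoc_mult_mat_vec)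
    then have "P *\<^sub>v (Q *\<^sub>v x) = Q *\<^sub>v x" using P Q Qx by blast
    then show "P * Q *\<^sub>v x = Q *\<^sub>v x" using P Q x by (metis assoc_mult_mat_vec)
  qed (use P Q in \<open>auto intro: mult_carrier_mat\<close>)
  have "P = ?P" if P: "?good P" for P
  proof -
    have "P = adj (?P * P)" using absorb[OF gP P] P by simp
    also have "\<dots> = adj P * adj ?P" using P by (intro adj_mult) auto
    also have "\<dots> = P * ?P" using P gP by simp
    also have "\<dots> = ?P" using absorb[OF P gP] .
    finally show ?thesis .
  qed
  then show ?thesis unfolding eigproj_def using gP Hc by (intro the_equality) auto
qed

text \<open>A block between two spectral projectors is zero exactly if all its coefficients in the
  eigenbasis are. Modes can thus be read off entry by entry, whatever basis of a degenerate
  eigenspace was chosen.\<close>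

lemma modes_specfun:
  assumes on: "orthonormal n n v" and H: "H = specfun n v (\<lambda>k. of_real (e k))" and X: "X \<in> carrier_mat n n"
  shows "modes H X = {e k - e l | k l. k < n \<and> l < n \<and> mcoef n v X k l \<noteq> 0}"
proof -
  let ?I = "\<lambda>E k. if e k = E then 1 else 0 :: complex"
  have coef: "mcoef n v (eigproj H E * X * eigproj H F) k l = ?I F l * (?I E k * mcoef n v X k l)"
    if "k < n" "l < n" for E F k l
    using that X by (simp add: eigproj_specfun[OF on H] mcoef_specfun_mult_right[OF on] mcoef_specfun_mult_left[OF on]
        mult_carrier_mat[OF specfun_carrier X])
  have dim: "dim_row H = n" using H by simp
  have carr: "eigproj H E * X * eigproj H F \<in> carrier_mat n n" for E F
    using X by (auto simp: eigproj_specfun[OF on H] intro!: mult_carrier_mat)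
  show ?thesis
  proof (intro subset_antisym subsetI)
    fix d assume "d \<in> modes H X"
    then obtain E F where d: "d = E - F" "eigproj H E * X * eigproj H F \<noteq> 0\<^sub>m n n"
      unfolding modes_def dim by blast
    then obtain k l where kl: "k < n" "l < n" "mcoef n v (eigproj H E * X * eigproj H F) k l \<noteq> 0"
      using mcoef_eq_zero[OF on carr] by blast
    then have "e k = E" "e l = F" "mcoef n v X k l \<noteq> 0" using coef[OF kl(1,2)] by (auto split: if_splits)
    then show "d \<in> {e k - e l | k l. k < n \<and> l < n \<and> mcoef n v X k l \<noteq> 0}" using d kl by blast
  next
    fix d assume "d \<in> {e k - e l | k l. k < n \<and> l < n \<and> mcoef n v X k l \<noteq> 0}"
    then obtain k l where kl: "k < n" "l < n" "mcoef n v X k l \<noteq> 0" "d = e k - e l" by blast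
    have sp: "e k \<in> spec H" if k: "k < n" for k
    proof -
      let ?x = "vec n (v k)"
      have "(\<Sum>i<n. cnj (v k i) * v k i) \<noteq> 0" using orthonormalD[OF on k k] by simp
      then obtain i where "i < n" "v k i \<noteq> 0" by (metis (no_types, lifting) lessThan_iff mult_zero_right sum.neutral)
      then have "?x \<noteq> 0\<^sub>v n" by (metis index_vec index_zero_vec(1))
      moreover have "H *\<^sub>v ?x = of_real (e k) \<cdot>\<^sub>v ?x"
      proof (rule eq_vecI)
        fix i assume "i < dim_vec (of_real (e k) \<cdot>\<^sub>v ?x)"
        then have i: "i < n" by simp
        then show "(H *\<^sub>v ?x) $ i = (of_real (e k) \<cdot>\<^sub>v ?x) $ i"
          unfolding H using specfun_apply[OF on k, of "\<lambda>k. of_real (e k)" i]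
          by (simp add: mult_mat_vec_index_sum[OF specfun_carrier] specfun_index del: index_mult_mat_vec)
      qed (simp add: H)
      ultimately show ?thesis unfolding spec_def dim by auto
    qed
    have "mcoef n v (eigproj H (e k) * X * eigproj H (e l)) k l \<noteq> 0" using coef[OF kl(1,2)] kl(3) by simp
    then have "eigproj H (e k) * X * eigproj H (e l) \<noteq> 0\<^sub>m n n" by (auto simp: mcoef_def)
    then show "d \<in> modes H X" unfolding modes_def dim using sp kl by blast
  qed
qed

lemma mcoef_evolve:
  assumes on: "orthonormal n n v" and H: "H = specfun n v (\<lambda>k. of_real (e k))" and X: "X \<in> carrier_mat n n"
    and kl: "k < n" "l < n"
  shows "mcoef n v (evolve H t X) k l = exp (- \<i> * of_real (t * (e k - e l))) * mcoef n v X k l"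
proof -
  have "evolve H t X = specfun n v (\<lambda>k. exp (- \<i> * of_real t * of_real (e k))) * X
      * specfun n v (\<lambda>k. exp (\<i> * of_real t * of_real (e k)))"
    unfolding evolve_def H specfun_smult mat_exp_specfun[OF on] ..
  then have "mcoef n v (evolve H t X) k l = exp (\<i> * of_real t * of_real (e l)) *
      (exp (- \<i> * of_real t * of_real (e k)) * mcoef n v X k l)"
    using X kl by (simp add: mcoef_specfun_mult_right[OF on] mcoef_specfun_mult_left[OF on]
        mult_carrier_mat[OF specfun_carrier X])
  also have "\<dots> = exp (\<i> * of_real t * of_real (e l) + - \<i> * of_real t * of_real (e k)) * mcoef n v X k l"
    by (simp only: exp_add mult.assoc)
  also have "\<i> * of_real t * of_real (e l) + - \<i> * of_real t * of_real (e k) = - \<i> * of_real (t * (e k - e l))"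
    by (simp add: algebra_simps)
  finally show ?thesis .
qed

lemma evolve_carrier:
  assumes "orthonormal n n v" "H = specfun n v (\<lambda>k. of_real (e k))" "X \<in> carrier_mat n n"
  shows "evolve H t X \<in> carrier_mat n n"
  unfolding evolve_def assms(2) specfun_smult mat_exp_specfun[OF assms(1)]
  using assms(3) by (auto intro!: mult_carrier_mat)

lemma rational_subspace_rat_modes: "rational_subspace (rat_modes H X)"
  unfolding rational_subspace_def
proof (intro conjI ballI allI)
  show "0 \<in> rat_modes H X" unfolding rat_modes_def by (rule CollectI, rule exI[of _ "{}"]) auto
next
  fix x q assume "x \<in> rat_modes H X"
  then obtain F p where "finite F" "F \<subseteq> modes H X" "x = (\<Sum>d\<in>F. of_rat (p d) * d)"
    unfolding rat_modes_def by blast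
  then show "of_rat q * x \<in> rat_modes H X" unfolding rat_modes_def
    by (intro CollectI exI[of _ F] exI[of _ "\<lambda>d. q * p d"]) (simp add: sum_distrib_left of_rat_mult mult.assoc)
next
  fix x y assume "x \<in> rat_modes H X" "y \<in> rat_modes H X"
  then obtain F p G r where F: "finite F" "F \<subseteq> modes H X" "x = (\<Sum>d\<in>F. of_rat (p d) * d)"
    and G: "finite G" "G \<subseteq> modes H X" "y = (\<Sum>d\<in>G. of_rat (r d) * d)"
    unfolding rat_modes_def by blast
  \<comment> \<open>Coefficients are extended by zero to the union of the two finite sets, where
    they can be added.\<close>
  let ?q = "\<lambda>d. (if d \<in> F then p d else 0) + (if d \<in> G then r d else 0)"
  have "x = (\<Sum>d\<in>F \<union> G. of_rat (if d \<in> F then p d else 0) * d)"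
    unfolding F(3) using F(1) G(1) by (intro sum.mono_neutral_cong_left) auto
  moreover have "y = (\<Sum>d\<in>F \<union> G. of_rat (if d \<in> G then r d else 0) * d)"
    unfolding G(3) using F(1) G(1) by (intro sum.mono_neutral_cong_left) auto
  ultimately have "x + y = (\<Sum>d\<in>F \<union> G. of_rat (?q d) * d)"
    by (simp only: of_rat_add distrib_right sum.distrib)
  then show "x + y \<in> rat_modes H X" unfolding rat_modes_def
    using F(1,2) G(1,2) by (intro CollectI exI[of _ "F \<union> G"] exI[of _ ?q]) auto
qed

lemma rat_modes_subset:
  assumes "modes H X \<subseteq> V" "rational_subspace V"
  shows "rat_modes H X \<subseteq> V"
proof
  fix x assume "x \<in> rat_modes H X"
  then obtain F q where F: "finite F" "F \<subseteq> modes H X" "x = (\<Sum>d\<in>F. of_rat (q d) * d)"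
    unfolding rat_modes_def by blast
  from F(1,2) have "(\<Sum>d\<in>F. of_rat (q d) * d) \<in> V"
    by (induction F rule: finite_induct) (use assms in \<open>auto simp: rational_subspace_def\<close>)
  then show "x \<in> V" using F(3) by simp
qed

lemma modes_subset_rat_modes: "modes H X \<subseteq> rat_modes H X"
proof
  fix d assume "d \<in> modes H X"
  then show "d \<in> rat_modes H X" unfolding rat_modes_def
    by (intro CollectI exI[of _ "{d}"] exI[of _ "\<lambda>_. 1"]) auto
qed

section \<open>Kraus operators of covariant channels\<close>

text \<open>The Gram vectors are the eigenvectors scaled by the square roots of their eigenvalues,
  which are nonnegative by testing positivity on the eigenvectors.\<close>

lemma psd_gram:
  assumes "psd n A"
  shows "\<exists>g. \<forall>i<n. \<forall>j<n. A $$ (i,j) = (\<Sum>t<n. g t i * cnj (g t j))"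
proof -
  have "hermitian n A" using assms by (simp add: psd_def)
  then obtain v e where on: "orthonormal n n v" and A: "A = specfun n v (\<lambda>k. of_real (e k))"
    using hermitian_spectral by blast
  have nn: "e k \<ge> 0" if k: "k < n" for k
  proof -
    let ?x = "vec n (v k)"
    have "cinner ?x (A *\<^sub>v ?x) = vcoef n v (A *\<^sub>v ?x) k" by (simp add: cinner_def vcoef_def)
    also have "\<dots> = of_real (e k) * vcoef n v ?x k" unfolding A by (rule vcoef_specfun[OF on _ k]) simp
    also have "vcoef n v ?x k = 1" using orthonormalD[OF on k k] by (simp add: vcoef_def)
    finally have "Re (cinner ?x (A *\<^sub>v ?x)) = e k" by simp
    then show ?thesis using assms unfolding psd_def by (metis vec_carrier)
  qed
  define s where "s t = complex_of_real (sqrt (e t))" for t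
  let ?g = "\<lambda>t i. s t * v t i"
  have h: "of_real (e t) * v t i * cnj (v t j) = ?g t i * cnj (?g t j)" if "t < n" for t i j
  proof -
    have ss: "complex_of_real (e t) = s t * s t"
      unfolding s_def of_real_mult[symmetric] using nn[OF that] by simp
    have cs: "cnj (s t) = s t" by (simp add: s_def)
    show ?thesis unfolding ss complex_cnj_mult cs by (simp add: mult_ac)
  qed
  have "A $$ (i,j) = (\<Sum>t<n. ?g t i * cnj (?g t j))" if "i < n" "j < n" for i j
    unfolding A specfun_index[OF that] by (intro sum.cong refl h) simp
  then show ?thesis by (intro exI[of _ ?g] allI impI)
qed

lemma psd_outer: "psd n (mat n n (\<lambda>(i,j). x i * cnj (x j)))"
proof -
  let ?X = "mat n n (\<lambda>(i,j). x i * cnj (x j))"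
  have "adj ?X = ?X" by (rule eq_matI) (auto simp: adj_def mult.commute)
  then have h: "hermitian n ?X" by (simp add: hermitian_def)
  have "cinner w (?X *\<^sub>v w) = of_real ((cmod (\<Sum>i<n. cnj (w $ i) * x i))\<^sup>2)" if w: "w \<in> carrier_vec n" for w
  proof -
    have Xw: "(?X *\<^sub>v w) $ i = (\<Sum>j<n. x i * cnj (x j) * w $ j)" if "i < n" for i
      using that by (subst mult_mat_vec_index_sum[of _ n n]) (use w in auto)
    have "cinner w (?X *\<^sub>v w) = (\<Sum>i<n. \<Sum>j<n. (cnj (w $ i) * x i) * (cnj (x j) * w $ j))"
      using w unfolding cinner_def
      by (intro sum.cong) (auto simp: Xw sum_distrib_left mult_ac simp del: index_mult_mat_vec)
    also have "\<dots> = (\<Sum>i<n. cnj (w $ i) * x i) * cnj (\<Sum>i<n. cnj (w $ i) * x i)"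
      unfolding sum_product[symmetric] by (simp add: mult.commute)
    finally show ?thesis by (simp only: complex_norm_square)
  qed
  then show ?thesis using h unfolding psd_def by simp
qed

text \<open>Additivity in \<open>lin_map\<close> concerns two summands, so the expansion into matrix
  units is an induction over the set of positions at which \<open>X\<close> is kept.\<close>

lemma lin_map_expansion:
  assumes L: "lin_map n m \<Lambda>" and X: "X \<in> carrier_mat n n" and ij: "i < m" "j < m"
  shows "\<Lambda> X $$ (i,j) = (\<Sum>a<n. \<Sum>b<n. X $$ (a,b) * \<Lambda> (mat n n (\<lambda>(p,q). if p = a \<and> q = b then 1 else 0)) $$ (i,j))"
proof -
  let ?E = "\<lambda>a b. mat n n (\<lambda>(p,q). if p = a \<and> q = b then 1 else 0) :: complex mat"
  define M where "M S = mat n n (\<lambda>(p,q). if (p,q) \<in> S then X $$ (p,q) else 0)" for S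
  have M: "M S \<in> carrier_mat n n" for S by (simp add: M_def)
  have car: "\<Lambda> Y \<in> carrier_mat m m" if "Y \<in> carrier_mat n n" for Y using L that by (simp add: lin_map_def)
  have add: "\<Lambda> (Y + Z) = \<Lambda> Y + \<Lambda> Z" if "Y \<in> carrier_mat n n" "Z \<in> carrier_mat n n" for Y Z
    using L that by (simp add: lin_map_def)
  have sc: "\<Lambda> (z \<cdot>\<^sub>m Y) = z \<cdot>\<^sub>m \<Lambda> Y" if "Y \<in> carrier_mat n n" for Y z
    using L that by (simp add: lin_map_def)
  have "\<Lambda> (M S) $$ (i,j) = (\<Sum>(a,b)\<in>S. X $$ (a,b) * \<Lambda> (?E a b) $$ (i,j))"
    if "finite S" "S \<subseteq> {..<n} \<times> {..<n}" for S
    using that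
  proof (induction S rule: finite_induct)
    case empty
    \<comment> \<open>The zero matrix is written as a multiple by 0, so that homogeneity sends it to
      zero.\<close>
    have "M {} = 0 \<cdot>\<^sub>m ?E 0 0" by (rule eq_matI) (auto simp: M_def)
    then have "\<Lambda> (M {}) = 0 \<cdot>\<^sub>m \<Lambda> (?E 0 0)" using sc[of "?E 0 0" 0] by simp
    then have "\<Lambda> (M {}) $$ (i,j) = 0" using ij car[of "?E 0 0"] by (simp only:) simp
    then show ?case by (simp only: sum.empty)
  next
    case (insert s S)
    obtain a b where s: "s = (a,b)" by (cases s)
    have "M (insert s S) = X $$ (a,b) \<cdot>\<^sub>m ?E a b + M S"
      using insert.hyps(2) s by (intro eq_matI) (auto simp: M_def)
    then have "\<Lambda> (M (insert s S)) = X $$ (a,b) \<cdot>\<^sub>m \<Lambda> (?E a b) + \<Lambda> (M S)"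
      by (simp add: add sc M)
    then show ?case using insert s ij car[of "?E a b"] car[OF M[of S]] by simp
  qed
  from this[of "{..<n} \<times> {..<n}"] have "\<Lambda> (M ({..<n} \<times> {..<n})) $$ (i,j) = (\<Sum>a<n. \<Sum>b<n. X $$ (a,b) * \<Lambda> (?E a b) $$ (i,j))"
    by (simp add: sum.cartesian_product)
  moreover have "M ({..<n} \<times> {..<n}) = X" using X by (intro eq_matI) (auto simp: M_def)
  ultimately show ?thesis by simp
qed

lemma pair_index_less: "i < m \<Longrightarrow> x < n \<Longrightarrow> i * n + x < m * (n::nat)"
proof -
  assume "i < m" "x < n"
  then have "i * n + x < Suc i * n" by simp
  also have "\<dots> \<le> m * n" using \<open>i < m\<close> by (intro mult_le_mono1) simp
  finally show ?thesis .
qed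

section \<open>Kraus operators from the Choi matrix\<close>

definition kraus_rep :: "nat \<Rightarrow> nat \<Rightarrow> nat \<Rightarrow> (nat \<Rightarrow> nat \<Rightarrow> nat \<Rightarrow> complex) \<Rightarrow> (complex mat \<Rightarrow> complex mat) \<Rightarrow> bool" where
  "kraus_rep n m R K \<Lambda> \<longleftrightarrow> (\<forall>X\<in>carrier_mat n n. \<forall>i<m. \<forall>j<m.
     \<Lambda> X $$ (i,j) = (\<Sum>r<R. \<Sum>a<n. \<Sum>b<n. K r i a * X $$ (a,b) * cnj (K r j b)))"

text \<open>Choi: the Kraus operators are the Gram vectors of the image of the maximally entangled projector.\<close>
theorem kraus_rep_exists:
  assumes "is_channel n m \<Lambda>"
  shows "\<exists>K. kraus_rep n m (n * m) K \<Lambda>"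
proof -
  have L: "lin_map n m \<Lambda>" using assms by (simp add: is_channel_def)
  let ?E = "\<lambda>a b. mat n n (\<lambda>(p,q). if p = a \<and> q = b then 1 else 0) :: complex mat"
  \<comment> \<open>At index \<open>a * n + p\<close> this is 1 exactly if \<open>a = p\<close>: the
    unnormalised maximally entangled vector.\<close>
  let ?x = "\<lambda>i. if i div n = i mod n then 1 else 0 :: complex"
  let ?X = "mat (n * n) (n * n) (\<lambda>(i,j). ?x i * cnj (?x j))"
  have "psd (n * m) (ext_map n n m \<Lambda> ?X)" using assms psd_outer[of "n * n" ?x] unfolding is_channel_def by blast
  then obtain g where g: "\<forall>i<n * m. \<forall>j<n * m. ext_map n n m \<Lambda> ?X $$ (i,j) = (\<Sum>t<n * m. g t i * cnj (g t j))"
    using psd_gram by blast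
  have E: "\<Lambda> (?E a b) $$ (i,j) = (\<Sum>t<n * m. g t (a * m + i) * cnj (g t (b * m + j)))"
    if "a < n" "b < n" "i < m" "j < m" for a b i j
  proof -
    have "mat n n (\<lambda>(p,q). ?X $$ (a * n + p, b * n + q)) = ?E a b"
      using that by (intro eq_matI) (auto simp: pair_index_less)
    then have "ext_map n n m \<Lambda> ?X $$ (a * m + i, b * m + j) = \<Lambda> (?E a b) $$ (i,j)"
      using that unfolding ext_map_def by (simp add: pair_index_less)
    then show ?thesis using g that by (simp add: pair_index_less)
  qed
  \<comment> \<open>A Gram vector of the Choi matrix, folded with the input index \<open>a\<close>
    as block number, is a Kraus operator; their number \<open>n * m\<close> is the size of that
    matrix.\<close>
  let ?K = "\<lambda>r i a. g r (a * m + i)"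
  have "\<Lambda> X $$ (i,j) = (\<Sum>r<n * m. \<Sum>a<n. \<Sum>b<n. ?K r i a * X $$ (a,b) * cnj (?K r j b))"
    if X: "X \<in> carrier_mat n n" and ij: "i < m" "j < m" for X i j
  proof -
    have "\<Lambda> X $$ (i,j) = (\<Sum>a<n. \<Sum>b<n. X $$ (a,b) * (\<Sum>r<n * m. ?K r i a * cnj (?K r j b)))"
      unfolding lin_map_expansion[OF L X ij] using E ij by (intro sum.cong refl) simp
    also have "\<dots> = (\<Sum>a<n. \<Sum>b<n. \<Sum>r<n * m. ?K r i a * X $$ (a,b) * cnj (?K r j b))"
      by (simp add: sum_distrib_left mult_ac)
    also have "\<dots> = (\<Sum>r<n * m. \<Sum>a<n. \<Sum>b<n. ?K r i a * X $$ (a,b) * cnj (?K r j b))"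
      by (rule sum_swap21)
    finally show ?thesis .
  qed
  then show ?thesis unfolding kraus_rep_def by (intro exI[of _ ?K] ballI allI impI)
qed

lemma sum_bilinear:
  fixes p :: "'a \<Rightarrow> complex"
  shows "(\<Sum>y\<in>Y. \<Sum>z\<in>Z. p y * (\<Sum>a\<in>A. \<Sum>b\<in>B. u a y * h a b * w b z) * q z) =
    (\<Sum>a\<in>A. \<Sum>b\<in>B. (\<Sum>y\<in>Y. p y * u a y) * h a b * (\<Sum>z\<in>Z. w b z * q z))"
proof -
  have "(\<Sum>y\<in>Y. \<Sum>z\<in>Z. p y * (\<Sum>a\<in>A. \<Sum>b\<in>B. u a y * h a b * w b z) * q z) =
      (\<Sum>y\<in>Y. \<Sum>z\<in>Z. \<Sum>a\<in>A. \<Sum>b\<in>B. (p y * u a y * h a b) * (w b z * q z))"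
    unfolding sum_distrib_left sum_distrib_right by (simp only: mult.assoc)
  also have "\<dots> = (\<Sum>a\<in>A. \<Sum>b\<in>B. \<Sum>y\<in>Y. \<Sum>z\<in>Z. (p y * u a y * h a b) * (w b z * q z))" by (rule sum_swap22)
  also have "\<dots> = (\<Sum>a\<in>A. \<Sum>b\<in>B. (\<Sum>y\<in>Y. p y * u a y) * h a b * (\<Sum>z\<in>Z. w b z * q z))"
    by (simp only: sum_product[symmetric] sum_distrib_right[symmetric])
  finally show ?thesis .
qed

section \<open>Covariant channels in energy bases\<close>

text \<open>The matrix entry of the Kraus operator \<open>K r\<close> between the input basis vector
  \<open>u a\<close> and the output basis vector \<open>w i\<close>.\<close>

definition khat :: "nat \<Rightarrow> nat \<Rightarrow> (nat \<Rightarrow> nat \<Rightarrow> complex) \<Rightarrow> (nat \<Rightarrow> nat \<Rightarrow> complex) \<Rightarrow>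
    (nat \<Rightarrow> nat \<Rightarrow> nat \<Rightarrow> complex) \<Rightarrow> nat \<Rightarrow> nat \<Rightarrow> nat \<Rightarrow> complex" where
  "khat n m u w K r i a = (\<Sum>y<n. (\<Sum>x<m. cnj (w i x) * K r x y) * u a y)"

lemma kraus_mcoef:
  assumes K: "kraus_rep n m R K \<Lambda>" and on: "orthonormal n n u" and X: "X \<in> carrier_mat n n"
  shows "mcoef m w (\<Lambda> X) i j =
    (\<Sum>r<R. \<Sum>a<n. \<Sum>b<n. khat n m u w K r i a * mcoef n u X a b * cnj (khat n m u w K r j b))"
proof -
  have "mcoef m w (\<Lambda> X) i j = (\<Sum>x<m. \<Sum>x'<m. \<Sum>r<R.
      cnj (w i x) * (\<Sum>a<n. \<Sum>b<n. K r x a * X $$ (a,b) * cnj (K r x' b)) * w j x')"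
    unfolding mcoef_def using K X
    by (intro sum.cong refl) (simp add: kraus_rep_def sum_distrib_left sum_distrib_right)
  also have "\<dots> = (\<Sum>r<R. \<Sum>x<m. \<Sum>x'<m.
      cnj (w i x) * (\<Sum>a<n. \<Sum>b<n. K r x a * X $$ (a,b) * cnj (K r x' b)) * w j x')"
    by (rule sum_swap21)
  also have "\<dots> = (\<Sum>r<R. \<Sum>a<n. \<Sum>b<n. (\<Sum>x<m. cnj (w i x) * K r x a) * X $$ (a,b) * (\<Sum>x<m. cnj (K r x b) * w j x))"
    by (rule sum.cong[OF refl], rule sum_bilinear)
  also have "\<dots> = (\<Sum>r<R. \<Sum>a<n. \<Sum>b<n. (\<Sum>x<m. cnj (w i x) * K r x a) *
      (\<Sum>k<n. \<Sum>l<n. u k a * mcoef n u X k l * cnj (u l b)) * (\<Sum>x<m. cnj (K r x b) * w j x))"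
    using mcoef_expansion[OF on] by (intro sum.cong refl) simp
  also have "\<dots> = (\<Sum>r<R. \<Sum>k<n. \<Sum>l<n. (\<Sum>a<n. (\<Sum>x<m. cnj (w i x) * K r x a) * u k a) * mcoef n u X k l *
      (\<Sum>b<n. cnj (u l b) * (\<Sum>x<m. cnj (K r x b) * w j x)))"
    by (rule sum.cong[OF refl], rule sum_bilinear)
  also have "\<dots> = (\<Sum>r<R. \<Sum>k<n. \<Sum>l<n. khat n m u w K r i k * mcoef n u X k l * cnj (khat n m u w K r j l))"
    by (simp add: khat_def mult.commute)
  finally show ?thesis .
qed

lemma mcoef_outer:
  "mcoef n u (mat n n (\<lambda>(y,z). \<phi> y * cnj (\<chi> z))) a b = (\<Sum>y<n. cnj (u a y) * \<phi> y) * cnj (\<Sum>z<n. cnj (u b z) * \<chi> z)"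
  unfolding mcoef_def cnj_sum sum_product by (intro sum.cong refl) (simp add: mult_ac)

lemma sum_mcoef_diag:
  assumes "orthonormal n n u" "X \<in> carrier_mat n n"
  shows "(\<Sum>i<n. mcoef n u X i i) = mtrace X"
proof -
  have "(\<Sum>i<n. mcoef n u X i i) = (\<Sum>y<n. \<Sum>z<n. \<Sum>i<n. (u i z * cnj (u i y)) * X $$ (y,z))"
    unfolding mcoef_def by (subst sum_swap21[symmetric]) (simp add: mult_ac)
  also have "\<dots> = (\<Sum>y<n. \<Sum>z<n. (if z = y then 1 else 0) * X $$ (y,z))"
    unfolding sum_distrib_right[symmetric] using orthonormal_complete[OF assms(1)] by (intro sum.cong refl) simp
  also have "\<dots> = mtrace X" using assms(2)
    by (simp add: mtrace_def if_distrib[of "\<lambda>x. x * _"] cong: if_cong)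
  finally show ?thesis .
qed

text \<open>Trace preservation, which is postulated for all matrices, is evaluated on the matrix
  unit formed from \<open>u a\<close> and \<open>u b\<close>.\<close>

lemma khat_trace_preserving:
  assumes ch: "is_channel n m \<Lambda>" and K: "kraus_rep n m R K \<Lambda>" and on: "orthonormal n n u" "orthonormal m m w"
    and ab: "a < n" "b < n"
  shows "(\<Sum>r<R. \<Sum>i<m. khat n m u w K r i a * cnj (khat n m u w K r i b)) = (if a = b then 1 else 0)"
proof -
  let ?k = "khat n m u w K"
  let ?X = "mat n n (\<lambda>(y,z). u a y * cnj (u b z))"
  have X: "?X \<in> carrier_mat n n" by simp
  have LX: "\<Lambda> ?X \<in> carrier_mat m m" using ch X unfolding is_channel_def lin_map_def by blast
  have cf: "mcoef n u ?X k l = (if k = a then 1 else 0) * (if l = b then 1 else 0)" if "k < n" "l < n" for k l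
    unfolding mcoef_outer using orthonormalD[OF on(1)] that ab by simp
  have "(\<Sum>i<m. mcoef m w (\<Lambda> ?X) i i) = (\<Sum>i<m. \<Sum>r<R. \<Sum>k<n. \<Sum>l<n.
      ?k r i k * ((if k = a then 1 else 0) * (if l = b then 1 else 0)) * cnj (?k r i l))"
    unfolding kraus_mcoef[OF K on(1) X] using cf by (intro sum.cong refl) simp
  also have "\<dots> = (\<Sum>i<m. \<Sum>r<R. ?k r i a * cnj (?k r i b))"
    using ab by (simp add: if_distrib[of "\<lambda>x. _ * x"] if_distrib[of "\<lambda>x. x * _"] cong: if_cong)
  also have "\<dots> = (\<Sum>r<R. \<Sum>i<m. ?k r i a * cnj (?k r i b))" by (rule sum.swap)
  finally have "(\<Sum>r<R. \<Sum>i<m. ?k r i a * cnj (?k r i b)) = mtrace (\<Lambda> ?X)"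
    using sum_mcoef_diag[OF on(2) LX] by simp
  also have "\<dots> = mtrace ?X" using ch X unfolding is_channel_def by blast
  also have "\<dots> = (\<Sum>y<n. cnj (u b y) * u a y)" by (simp add: mtrace_def mult.commute)
  also have "\<dots> = (if a = b then 1 else 0)" using orthonormalD[OF on(1) ab(2,1)] by auto
  finally show ?thesis .
qed

text \<open>Covariance is postulated on states only, so the form is known to vanish just on unit
  vectors. Polarisation recovers its entries: superpositions of two basis vectors with relative
  phases 1 and i give two independent equations for \<open>Q x y\<close> and
  \<open>Q y x\<close>.\<close>

lemma sesquilinear_zero:
  fixes Q :: "nat \<Rightarrow> nat \<Rightarrow> complex"
  assumes Q: "\<And>\<psi>. (\<Sum>a<n. \<psi> a * cnj (\<psi> a)) = 1 \<Longrightarrow> (\<Sum>a<n. \<Sum>b<n. Q a b * (\<psi> a * cnj (\<psi> b))) = 0"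
    and xy: "x < n" "y < n"
  shows "Q x y = 0"
proof -
  have diag: "Q x x = 0" if "x < n" for x
  proof -
    let ?p = "\<lambda>a. if a = x then 1 else 0 :: complex"
    have "(\<Sum>a<n. \<Sum>b<n. Q a b * (?p a * cnj (?p b))) = Q x x" using that
      by (simp add: if_distrib[of "\<lambda>x. _ * x"] if_distrib[of "\<lambda>x. x * _"] if_distrib[of cnj] cong: if_cong)
    then show ?thesis using Q[of ?p] that
      by (simp add: if_distrib[of "\<lambda>x. _ * x"] if_distrib[of "\<lambda>x. x * _"] if_distrib[of cnj] cong: if_cong)
  qed
  show ?thesis
  proof (cases "x = y")
    case False
    \<comment> \<open>Normalises the superposition of the basis vectors \<open>x\<close> and
      \<open>y\<close> with relative phase \<open>z\<close>.\<close>
    define s where "s = complex_of_real (1 / sqrt 2)"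
    have ss: "s * s = 1 / 2" unfolding s_def of_real_mult[symmetric] by simp
    have cs: "cnj s = s" by (simp add: s_def)
    have z: "cnj z * Q x y + z * Q y x = 0" if z: "z * cnj z = 1" for z
    proof -
      let ?p = "\<lambda>a. (if a = x then s else 0) + (if a = y then s * z else 0)"
      have two: "(\<Sum>a<n. ?p a * f a) = s * f x + s * z * f y" for f
        using xy by (simp add: distrib_right sum.distrib if_distrib[of "\<lambda>x. x * _"] cong: if_cong)
      have twoc: "(\<Sum>a<n. cnj (?p a) * f a) = s * f x + s * cnj z * f y" for f
      proof -
        have "cnj (?p a) = (if a = x then s else 0) + (if a = y then s * cnj z else 0)" for a by (simp add: cs)
        then show ?thesis
          using xy by (simp add: distrib_right sum.distrib if_distrib[of "\<lambda>x. x * _"] cong: if_cong)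
      qed
      have px: "?p x = s" "?p y = s * z" using False by auto
      have "(\<Sum>a<n. ?p a * cnj (?p a)) = s * cnj (?p x) + s * z * cnj (?p y)" by (rule two)
      also have "\<dots> = s * s + s * s * (z * cnj z)" unfolding px by (simp add: cs mult_ac)
      also have "\<dots> = 1" by (simp add: ss z)
      finally have "(\<Sum>a<n. \<Sum>b<n. Q a b * (?p a * cnj (?p b))) = 0" by (rule Q)
      moreover have "(\<Sum>a<n. \<Sum>b<n. Q a b * (?p a * cnj (?p b))) = (\<Sum>a<n. ?p a * (\<Sum>b<n. cnj (?p b) * Q a b))"
        by (simp only: sum_distrib_left mult_ac)
      ultimately have "0 = s * (s * Q x x + s * cnj z * Q x y) + s * z * (s * Q y x + s * cnj z * Q y y)"
        by (simp only: twoc two)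
      also have "\<dots> = s * s * (cnj z * Q x y + z * Q y x)"
        using diag[OF xy(1)] diag[OF xy(2)] by (simp add: algebra_simps)
      finally show ?thesis by (simp add: ss)
    qed
    have "Q x y + Q y x = 0" using z[of 1] by simp
    moreover have "- \<i> * Q x y + \<i> * Q y x = 0" using z[of \<i>] by simp
    then have "\<i> * (Q y x - Q x y) = 0" by (simp add: algebra_simps)
    then have "Q y x = Q x y" by simp
    ultimately show ?thesis by simp
  qed (use diag xy in auto)
qed

lemma exp_phase_eq:
  assumes "\<And>t. exp (- \<i> * of_real (t * x)) = exp (- \<i> * of_real (t * y))"
  shows "x = (y :: real)"
proof (rule ccontr)
  assume ne: "x \<noteq> y"
  \<comment> \<open>At this time the two phases differ by the factor -1.\<close>
  define t where "t = pi / (x - y)"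
  have tx: "t * x = t * y + pi" using ne by (simp add: t_def field_simps)
  have "exp (- \<i> * of_real (t * x)) = exp (- \<i> * of_real (t * y)) * exp (- \<i> * of_real pi)"
    unfolding tx exp_add[symmetric] by (simp add: algebra_simps)
  also have "exp (- \<i> * of_real pi) = (-1 :: complex)" by (simp add: exp_minus mult.commute)
  finally show False using assms[of t] by simp
qed

text \<open>Testing covariance on pure states compares the phases acquired on the input and on the
  output. Polarisation isolates one pair \<open>a\<close>, \<open>b\<close>; a nonzero sum of Kraus
  entries then forces equal phases at all times, hence equal energy differences.\<close>

theorem covariant_khat_modes:
  assumes cov: "covariant n HX m HY \<Lambda>" and L: "lin_map n m \<Lambda>" and K: "kraus_rep n m R K \<Lambda>"
    and on: "orthonormal n n u" "orthonormal m m w"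
    and HX: "HX = specfun n u (\<lambda>k. of_real (E k))" and HY: "HY = specfun m w (\<lambda>k. of_real (F k))"
    and ij: "i < m" "j < m" and ab: "a < n" "b < n"
    and nz: "(\<Sum>r<R. khat n m u w K r i a * cnj (khat n m u w K r j b)) \<noteq> 0"
  shows "F i - F j = E a - E b"
proof -
  let ?k = "khat n m u w K"
  define lc where "lc a b = (\<Sum>r<R. ?k r i a * cnj (?k r j b))" for a b
  have form: "mcoef m w (\<Lambda> X) i j = (\<Sum>a<n. \<Sum>b<n. lc a b * mcoef n u X a b)" if "X \<in> carrier_mat n n" for X
    unfolding kraus_mcoef[OF K on(1) that] lc_def
    by (subst sum_swap21[symmetric]) (simp add: sum_distrib_left mult_ac)
  have "exp (- \<i> * of_real (t * (E a - E b))) = exp (- \<i> * of_real (t * (F i - F j)))" for t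
  proof -
    define Q where "Q a b = lc a b * (exp (- \<i> * of_real (t * (E a - E b))) - exp (- \<i> * of_real (t * (F i - F j))))" for a b
    have "Q a b = 0"
    proof (rule sesquilinear_zero[OF _ ab])
      fix \<psi> :: "nat \<Rightarrow> complex" assume unit: "(\<Sum>a<n. \<psi> a * cnj (\<psi> a)) = 1"
      \<comment> \<open>The vector with coordinates \<psi> in the energy basis; its projector is a
        pure test state.\<close>
      define \<phi> where "\<phi> y = (\<Sum>a<n. \<psi> a * u a y)" for y
      let ?\<sigma> = "mat n n (\<lambda>(y,z). \<phi> y * cnj (\<phi> z))"
      have \<sigma>: "?\<sigma> \<in> carrier_mat n n" by simp
      have c1: "(\<Sum>y<n. cnj (u a y) * \<phi> y) = \<psi> a" if "a < n" for a
      proof -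
        have "(\<Sum>y<n. cnj (u a y) * \<phi> y) = (\<Sum>y<n. \<Sum>b<n. \<psi> b * (cnj (u a y) * u b y))"
          by (simp add: \<phi>_def sum_distrib_left mult_ac)
        also have "\<dots> = (\<Sum>b<n. \<psi> b * (\<Sum>y<n. cnj (u a y) * u b y))"
          by (subst sum.swap) (simp only: sum_distrib_left)
        also have "\<dots> = (\<Sum>b<n. \<psi> b * (if a = b then 1 else 0))"
          using orthonormalD[OF on(1) that] by (intro sum.cong refl) simp
        also have "\<dots> = \<psi> a" using that by (simp add: if_distrib[of "\<lambda>x. _ * x"] cong: if_cong)
        finally show ?thesis .
      qed
      have cf: "mcoef n u ?\<sigma> a b = \<psi> a * cnj (\<psi> b)" if "a < n" "b < n" for a b
        unfolding mcoef_outer using c1 that by simp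
      have "mtrace ?\<sigma> = 1" using sum_mcoef_diag[OF on(1) \<sigma>] cf unit by simp
      then have st: "is_state n ?\<sigma>" using psd_outer by (simp add: is_state_def)
      have L\<sigma>: "\<Lambda> ?\<sigma> \<in> carrier_mat m m" using L \<sigma> unfolding lin_map_def by blast
      have "mcoef m w (\<Lambda> (evolve HX t ?\<sigma>)) i j = mcoef m w (evolve HY t (\<Lambda> ?\<sigma>)) i j"
        using cov st unfolding covariant_def by simp
      also have "\<dots> = exp (- \<i> * of_real (t * (F i - F j))) * (\<Sum>a<n. \<Sum>b<n. lc a b * mcoef n u ?\<sigma> a b)"
        using mcoef_evolve[OF on(2) HY L\<sigma> ij] form[OF \<sigma>] by simp
      also have "mcoef m w (\<Lambda> (evolve HX t ?\<sigma>)) i j =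
          (\<Sum>a<n. \<Sum>b<n. lc a b * (exp (- \<i> * of_real (t * (E a - E b))) * mcoef n u ?\<sigma> a b))"
        unfolding form[OF evolve_carrier[OF on(1) HX \<sigma>]]
        using mcoef_evolve[OF on(1) HX \<sigma>] by (intro sum.cong refl) simp
      finally have eq: "(\<Sum>a<n. \<Sum>b<n. lc a b * (exp (- \<i> * of_real (t * (E a - E b))) * mcoef n u ?\<sigma> a b))
          = (\<Sum>a<n. \<Sum>b<n. exp (- \<i> * of_real (t * (F i - F j))) * (lc a b * mcoef n u ?\<sigma> a b))"
        by (simp only: sum_distrib_left)
      have "(\<Sum>a<n. \<Sum>b<n. Q a b * (\<psi> a * cnj (\<psi> b))) =
          (\<Sum>a<n. \<Sum>b<n. lc a b * (exp (- \<i> * of_real (t * (E a - E b))) * mcoef n u ?\<sigma> a b)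
            - exp (- \<i> * of_real (t * (F i - F j))) * (lc a b * mcoef n u ?\<sigma> a b))"
        by (intro sum.cong refl) (simp only: lessThan_iff cf Q_def left_diff_distrib right_diff_distrib mult_ac)
      then show "(\<Sum>a<n. \<Sum>b<n. Q a b * (\<psi> a * cnj (\<psi> b))) = 0"
        unfolding sum_subtractf eq by simp
    qed
    then show ?thesis using nz by (simp add: Q_def lc_def)
  qed
  from exp_phase_eq[OF this] show ?thesis by simp
qed

section \<open>Composite systems\<close>

lemma sum_mult_split: "(\<Sum>a<m * n. f a) = (\<Sum>i<m. \<Sum>x<n. f (i * n + x))"
  for f :: "nat \<Rightarrow> complex"
proof -
  have "(\<Sum>a<m * n. f a) = (\<Sum>i<m. sum f {i * n..<i * n + n})" by (rule sum.nat_group[symmetric])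
  also have "\<dots> = (\<Sum>i<m. \<Sum>x<n. f (i * n + x))"
  proof (rule sum.cong[OF refl])
    fix i
    have "sum f {i * n..<i * n + n} = sum f {0 + i * n..<n + i * n}" by (simp add: add.commute)
    also have "\<dots> = (\<Sum>x<n. f (i * n + x))"
      unfolding sum.shift_bounds_nat_ivl by (simp add: lessThan_atLeast0 add.commute)
    finally show "sum f {i * n..<i * n + n} = (\<Sum>x<n. f (i * n + x))" .
  qed
  finally show ?thesis .
qed

lemma pair_index_bounds: "a < m * n \<Longrightarrow> a div n < m \<and> a mod n < (n::nat)"
  by (metis less_mult_imp_div_less mod_less_divisor mult_0_right not_gr_zero not_less_zero)

definition tensor_basis :: "nat \<Rightarrow> (nat \<Rightarrow> nat \<Rightarrow> complex) \<Rightarrow> (nat \<Rightarrow> nat \<Rightarrow> complex) \<Rightarrow> nat \<Rightarrow> nat \<Rightarrow> complex" where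
  "tensor_basis n u w k a = u (k div n) (a div n) * w (k mod n) (a mod n)"

lemma orthonormal_tensor_basis:
  assumes "orthonormal m m u" "orthonormal n n w"
  shows "orthonormal (m * n) (m * n) (tensor_basis n u w)"
  unfolding orthonormal_def
proof (intro allI impI)
  fix k l assume "k < m * n" "l < m * n"
  then have b: "k div n < m" "k mod n < n" "l div n < m" "l mod n < n" using pair_index_bounds by blast+
  have "(\<Sum>a<m * n. cnj (tensor_basis n u w k a) * tensor_basis n u w l a) =
      (\<Sum>i<m. \<Sum>x<n. (cnj (u (k div n) i) * u (l div n) i) * (cnj (w (k mod n) x) * w (l mod n) x))"
    unfolding sum_mult_split by (intro sum.cong refl) (simp add: tensor_basis_def)
  also have "\<dots> = (if k div n = l div n then 1 else 0) * (if k mod n = l mod n then 1 else 0)"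
    unfolding sum_product[symmetric] orthonormalD[OF assms(1) b(1,3)] orthonormalD[OF assms(2) b(2,4)] ..
  also have "\<dots> = (if k = l then 1 else 0)"
  proof -
    have "k = l \<longleftrightarrow> k div n = l div n \<and> k mod n = l mod n" by (metis div_mult_mod_eq)
    then show ?thesis by simp
  qed
  finally show "(\<Sum>a<m * n. cnj (tensor_basis n u w k a) * tensor_basis n u w l a) = (if k = l then 1 else 0)" .
qed

text \<open>In each summand of the Hamiltonian, completeness of the other factor's basis supplies
  the identity matrix.\<close>

lemma comp_ham_specfun:
  assumes on: "orthonormal m m u" "orthonormal n n w"
    and HA: "HA = specfun m u (\<lambda>k. of_real (e k))" and HB: "HB = specfun n w (\<lambda>k. of_real (h k))"
  shows "comp_ham HA HB = specfun (m * n) (tensor_basis n u w) (\<lambda>k. of_real (e (k div n) + h (k mod n)))"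
proof (rule eq_matI)
  fix a b
  assume "a < dim_row (specfun (m * n) (tensor_basis n u w) (\<lambda>k. of_real (e (k div n) + h (k mod n))))"
    "b < dim_col (specfun (m * n) (tensor_basis n u w) (\<lambda>k. of_real (e (k div n) + h (k mod n))))"
  then have ab: "a < m * n" "b < m * n" by auto
  then have bd: "a div n < m" "a mod n < n" "b div n < m" "b mod n < n" using pair_index_bounds by blast+
  let ?a = "a div n" and ?b = "b div n" and ?x = "a mod n" and ?y = "b mod n"
  have "specfun (m * n) (tensor_basis n u w) (\<lambda>k. of_real (e (k div n) + h (k mod n))) $$ (a,b) =
      (\<Sum>i<m. \<Sum>x<n. (of_real (e i) * u i ?a * cnj (u i ?b)) * (w x ?x * cnj (w x ?y))
         + (u i ?a * cnj (u i ?b)) * (of_real (h x) * w x ?x * cnj (w x ?y)))"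
    unfolding specfun_index[OF ab] sum_mult_split
    by (intro sum.cong refl) (simp add: tensor_basis_def algebra_simps)
  also have "\<dots> = (\<Sum>i<m. of_real (e i) * u i ?a * cnj (u i ?b)) * (\<Sum>x<n. w x ?x * cnj (w x ?y))
      + (\<Sum>i<m. u i ?a * cnj (u i ?b)) * (\<Sum>x<n. of_real (h x) * w x ?x * cnj (w x ?y))"
    unfolding sum.distrib sum_product[symmetric] ..
  also have "\<dots> = HA $$ (?a,?b) * (if ?x = ?y then 1 else 0) + (if ?a = ?b then 1 else 0) * HB $$ (?x,?y)"
    unfolding orthonormal_complete[OF on(1) bd(1,3)] orthonormal_complete[OF on(2) bd(2,4)] HA HB
      specfun_index[OF bd(1,3)] specfun_index[OF bd(2,4)] ..
  also have "\<dots> = comp_ham HA HB $$ (a,b)"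
    using ab bd by (simp add: comp_ham_def kron_def HA HB)
  finally show "comp_ham HA HB $$ (a,b) =
    specfun (m * n) (tensor_basis n u w) (\<lambda>k. of_real (e (k div n) + h (k mod n))) $$ (a,b)" by simp
qed (auto simp: comp_ham_def kron_def HA HB)

lemma mcoef_tensor:
  "mcoef (m * n) (tensor_basis n u w) M k l = (\<Sum>i<m. \<Sum>x<n. \<Sum>j<m. \<Sum>y<n.
     cnj (u (k div n) i) * cnj (w (k mod n) x) * M $$ (i * n + x, j * n + y) * u (l div n) j * w (l mod n) y)"
  unfolding mcoef_def sum_mult_split by (intro sum.cong refl) (simp add: tensor_basis_def)

lemma mcoef_kron:
  assumes "A \<in> carrier_mat m m" "B \<in> carrier_mat n n"
  shows "mcoef (m * n) (tensor_basis n u w) (kron A B) k l =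
    mcoef m u A (k div n) (l div n) * mcoef n w B (k mod n) (l mod n)"
proof -
  let ?f = "\<lambda>i j. cnj (u (k div n) i) * A $$ (i,j) * u (l div n) j"
  let ?g = "\<lambda>x y. cnj (w (k mod n) x) * B $$ (x,y) * w (l mod n) y"
  have kr: "kron A B $$ (i * n + x, j * n + y) = A $$ (i,j) * B $$ (x,y)"
    if "i < m" "j < m" "x < n" "y < n" for i j x y
    using assms that pair_index_less by (simp add: kron_def)
  have "mcoef (m * n) (tensor_basis n u w) (kron A B) k l = (\<Sum>i<m. \<Sum>x<n. \<Sum>j<m. \<Sum>y<n. ?f i j * ?g x y)"
    unfolding mcoef_tensor by (intro sum.cong refl) (simp add: kr)
  also have "\<dots> = (\<Sum>i<m. \<Sum>j<m. \<Sum>x<n. \<Sum>y<n. ?f i j * ?g x y)"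
    by (rule sum.cong[OF refl], rule sum.swap)
  also have "\<dots> = (\<Sum>i<m. \<Sum>j<m. ?f i j) * (\<Sum>x<n. \<Sum>y<n. ?g x y)"
    by (simp only: sum_distrib_left[symmetric] sum_distrib_right[symmetric])
  finally show ?thesis by (simp only: mcoef_def)
qed

text \<open>A partial trace may be taken in any orthonormal basis of the traced factor, by
  completeness of that basis.\<close>

lemma mcoef_ptrace2:
  assumes "orthonormal n n w"
  shows "mcoef m u (ptrace2 m n M) s s' = (\<Sum>z<n. mcoef (m * n) (tensor_basis n u w) M (s * n + z) (s' * n + z))"
proof -
  let ?f = "\<lambda>i x j y. cnj (u s i) * M $$ (i * n + x, j * n + y) * u s' j"
  have "(\<Sum>z<n. mcoef (m * n) (tensor_basis n u w) M (s * n + z) (s' * n + z)) =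
      (\<Sum>z<n. \<Sum>i<m. \<Sum>x<n. \<Sum>j<m. \<Sum>y<n. ?f i x j y * (w z y * cnj (w z x)))"
    unfolding mcoef_tensor by (intro sum.cong refl) (simp add: mult_ac)
  also have "\<dots> = (\<Sum>i<m. \<Sum>x<n. \<Sum>z<n. \<Sum>j<m. \<Sum>y<n. ?f i x j y * (w z y * cnj (w z x)))"
    by (rule sum_swap21[symmetric])
  also have "\<dots> = (\<Sum>i<m. \<Sum>x<n. \<Sum>j<m. \<Sum>y<n. \<Sum>z<n. ?f i x j y * (w z y * cnj (w z x)))"
    by (rule sum.cong[OF refl], rule sum.cong[OF refl], rule sum_swap21[symmetric])
  also have "\<dots> = (\<Sum>i<m. \<Sum>x<n. \<Sum>j<m. \<Sum>y<n. ?f i x j y * (if y = x then 1 else 0))"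
    unfolding sum_distrib_left[symmetric] using orthonormal_complete[OF assms] by (intro sum.cong refl) simp
  also have "\<dots> = (\<Sum>i<m. \<Sum>x<n. \<Sum>j<m. ?f i x j x)"
    by (intro sum.cong refl) (simp add: if_distrib[of "\<lambda>x. _ * x"] cong: if_cong)
  also have "\<dots> = (\<Sum>i<m. \<Sum>j<m. \<Sum>x<n. ?f i x j x)" by (rule sum.cong[OF refl], rule sum.swap)
  also have "\<dots> = mcoef m u (ptrace2 m n M) s s'"
    unfolding mcoef_def by (intro sum.cong refl) (simp add: ptrace2_def sum_distrib_left sum_distrib_right)
  finally show ?thesis by simp
qed

lemma mcoef_ptrace1:
  assumes "orthonormal m m u" "z < n" "z' < n"
  shows "mcoef n w (ptrace1 m n M) z z' = (\<Sum>s<m. mcoef (m * n) (tensor_basis n u w) M (s * n + z) (s * n + z'))"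
proof -
  let ?f = "\<lambda>i x j y. cnj (w z x) * M $$ (i * n + x, j * n + y) * w z' y"
  have "(\<Sum>s<m. mcoef (m * n) (tensor_basis n u w) M (s * n + z) (s * n + z')) =
      (\<Sum>s<m. \<Sum>i<m. \<Sum>x<n. \<Sum>j<m. \<Sum>y<n. ?f i x j y * (u s j * cnj (u s i)))"
    unfolding mcoef_tensor using assms(2,3) by (intro sum.cong refl) (simp add: mult_ac)
  also have "\<dots> = (\<Sum>i<m. \<Sum>x<n. \<Sum>s<m. \<Sum>j<m. \<Sum>y<n. ?f i x j y * (u s j * cnj (u s i)))"
    by (rule sum_swap21[symmetric])
  also have "\<dots> = (\<Sum>i<m. \<Sum>x<n. \<Sum>j<m. \<Sum>y<n. \<Sum>s<m. ?f i x j y * (u s j * cnj (u s i)))"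
    by (rule sum.cong[OF refl], rule sum.cong[OF refl], rule sum_swap21[symmetric])
  also have "\<dots> = (\<Sum>i<m. \<Sum>x<n. \<Sum>j<m. \<Sum>y<n. ?f i x j y * (if j = i then 1 else 0))"
    unfolding sum_distrib_left[symmetric] using orthonormal_complete[OF assms(1)] by (intro sum.cong refl) simp
  also have "\<dots> = (\<Sum>i<m. \<Sum>x<n. \<Sum>y<n. \<Sum>j<m. ?f i x j y * (if j = i then 1 else 0))"
    by (rule sum.cong[OF refl], rule sum.cong[OF refl], rule sum.swap)
  also have "\<dots> = (\<Sum>i<m. \<Sum>x<n. \<Sum>y<n. ?f i x i y)"
    by (intro sum.cong refl) (simp add: if_distrib[of "\<lambda>x. _ * x"] cong: if_cong)
  also have "\<dots> = (\<Sum>x<n. \<Sum>y<n. \<Sum>i<m. ?f i x i y)" by (rule sum_swap21[symmetric])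
  also have "\<dots> = mcoef n w (ptrace1 m n M) z z'"
    unfolding mcoef_def by (intro sum.cong refl) (simp add: ptrace1_def sum_distrib_left sum_distrib_right)
  finally show ?thesis by simp
qed

lemma psd_mcoef_gram:
  assumes "psd n X"
  shows "\<exists>g. \<forall>k l. mcoef n v X k l = (\<Sum>t<n. g t k * cnj (g t l))"
proof -
  obtain g where g: "\<forall>i<n. \<forall>j<n. X $$ (i,j) = (\<Sum>t<n. g t i * cnj (g t j))" using psd_gram[OF assms] by blast
  have "mcoef n v X k l = (\<Sum>t<n. (\<Sum>i<n. cnj (v k i) * g t i) * cnj (\<Sum>j<n. cnj (v l j) * g t j))" for k l
    unfolding gram_form mcoef_def using g by (intro sum.cong refl) simp
  then show ?thesis by (intro exI[of _ "\<lambda>t k. \<Sum>i<n. cnj (v k i) * g t i"] allI)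
qed

section \<open>From channel and catalyst to modes of the output\<close>

theorem theorem3:
  fixes dS dS' dC :: nat
    and HS HS' HC \<rho> c :: "complex mat"
    and \<Lambda> :: "complex mat \<Rightarrow> complex mat"
  assumes "hermitian dS HS" and "hermitian dS' HS'" and "hermitian dC HC"
    and "is_state dS \<rho>" and "is_state dC c"
    and "is_channel (dS * dC) (dS' * dC) \<Lambda>"
    and "covariant (dS * dC) (comp_ham HS HC) (dS' * dC) (comp_ham HS' HC) \<Lambda>"
    and "ptrace1 dS' dC (\<Lambda> (kron \<rho> c)) = c"
  shows "rat_modes HS' (ptrace2 dS' dC (\<Lambda> (kron \<rho> c))) \<subseteq> rat_modes HS \<rho>"
proof -
  define V where "V = rat_modes HS \<rho>"
  have V: "rational_subspace V" unfolding V_def by (rule rational_subspace_rat_modes)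
  obtain u E where onS: "orthonormal dS dS u" and HS: "HS = specfun dS u (\<lambda>k. of_real (E k))"
    using hermitian_spectral[OF assms(1)] by blast
  obtain u' \<epsilon> where onS': "orthonormal dS' dS' u'" and HS': "HS' = specfun dS' u' (\<lambda>k. of_real (\<epsilon> k))"
    using hermitian_spectral[OF assms(2)] by blast
  obtain w h where onC: "orthonormal dC dC w" and HC: "HC = specfun dC w (\<lambda>k. of_real (h k))"
    using hermitian_spectral[OF assms(3)] by blast
  let ?N = "dS * dC" and ?M = "dS' * dC"
  let ?U = "tensor_basis dC u w" and ?W = "tensor_basis dC u' w"
  note onU = orthonormal_tensor_basis[OF onS onC] and onW = orthonormal_tensor_basis[OF onS' onC]
  have \<rho>: "\<rho> \<in> carrier_mat dS dS" "psd dS \<rho>" "mtrace \<rho> = 1" and c: "c \<in> carrier_mat dC dC" "psd dC c"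
    using assms(4,5) by (auto simp: is_state_def psd_def hermitian_def)
  have L: "lin_map ?N ?M \<Lambda>" using assms(6) by (simp add: is_channel_def)
  obtain K where K: "kraus_rep ?N ?M (?N * ?M) K \<Lambda>" using kraus_rep_exists[OF assms(6)] by blast
  define R where "R = ?N * ?M"
  define k where "k r s z i x = khat ?N ?M ?U ?W K r (s * dC + z) (i * dC + x)" for r s z i x
  obtain q where q: "\<forall>i j. mcoef dS u \<rho> i j = (\<Sum>t<dS. q t i * cnj (q t j))"
    using psd_mcoef_gram[OF \<rho>(2)] by blast
  obtain g where g: "\<forall>x y. mcoef dC w c x y = (\<Sum>t<dC. g t x * cnj (g t y))"
    using psd_mcoef_gram[OF c(2)] by blast
  \<comment> \<open>The exact energy balance of \<Lambda>; it weakens to a balance modulo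
    \<open>V\<close> only once \<rho> is contracted in.\<close>
  have kmode: "\<epsilon> s + h z - (\<epsilon> s' + h z') = E i + h x - (E j + h y)"
    if b: "s < dS'" "s' < dS'" "z < dC" "z' < dC" "i < dS" "j < dS" "x < dC" "y < dC"
      and nz: "(\<Sum>r<R. k r s z i x * cnj (k r s' z' j y)) \<noteq> 0" for s s' z z' i j x y
    using covariant_khat_modes[OF assms(7) L K onU onW comp_ham_specfun[OF onS onC HS HC]
        comp_ham_specfun[OF onS' onC HS' HC] pair_index_less[OF b(1,3)] pair_index_less[OF b(2,4)]
        pair_index_less[OF b(5,7)] pair_index_less[OF b(6,8)]] nz b
    by (simp add: k_def R_def)
  have kTP: "(\<Sum>r<R. \<Sum>s<dS'. \<Sum>z<dC. k r s z i x * cnj (k r s z j y)) = (if i = j \<and> x = y then 1 else 0)"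
    if b: "i < dS" "j < dS" "x < dC" "y < dC" for i j x y
  proof -
    have "(i * dC + x = j * dC + y) = (i = j \<and> x = y)" using b
      by (metis div_mult_self3 mod_mult_self3 div_less mod_less add.left_neutral add.commute not_less_zero)
    then show ?thesis
      using khat_trace_preserving[OF assms(6) K onU onW pair_index_less[OF b(1,3)] pair_index_less[OF b(2,4)]]
      unfolding sum_mult_split k_def R_def by simp
  qed
  have \<rho>mode: "E i - E j \<in> V" if "i < dS" "j < dS" "mcoef dS u \<rho> i j \<noteq> 0" for i j
    using modes_specfun[OF onS HS \<rho>(1)] modes_subset_rat_modes[of HS \<rho>] that unfolding V_def by blast
  \<comment> \<open>The Kraus operator \<open>r\<close> with the Gram vector \<open>q t\<close> of
    \<rho> put on S and the energy vector \<open>s\<close> read off on S' is an operator on C. The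
    environment label is the pair of \<open>r\<close> and \<open>t\<close>.\<close>
  define A where "A = (\<lambda>(r,t) s z x. \<Sum>i<dS. q t i * k r s z i x)"
  define RR where "RR = {..<R} \<times> {..<dS}"
  \<comment> \<open>Summing over \<open>t\<close> restores the entries of \<rho>, whose nonzero ones
    link energies that differ by an element of \<open>V\<close>.\<close>
  have AA: "(\<Sum>p\<in>RR. A p s z x * cnj (A p s' z' y)) =
      (\<Sum>i<dS. \<Sum>j<dS. mcoef dS u \<rho> i j * (\<Sum>r<R. k r s z i x * cnj (k r s' z' j y)))" for s s' z z' x y
  proof -
    have "(\<Sum>p\<in>RR. A p s z x * cnj (A p s' z' y)) =
        (\<Sum>r<R. \<Sum>t<dS. (\<Sum>i<dS. k r s z i x * q t i) * cnj (\<Sum>i<dS. k r s' z' i y * q t i))"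
      unfolding RR_def A_def by (simp add: sum.cartesian_product split_def mult.commute)
    also have "\<dots> = (\<Sum>r<R. \<Sum>i<dS. \<Sum>j<dS. k r s z i x * mcoef dS u \<rho> i j * cnj (k r s' z' j y))"
      unfolding gram_form using q by simp
    also have "\<dots> = (\<Sum>i<dS. \<Sum>j<dS. \<Sum>r<R. k r s z i x * mcoef dS u \<rho> i j * cnj (k r s' z' j y))"
      by (rule sum_swap21[symmetric])
    finally show ?thesis by (simp add: sum_distrib_left mult_ac)
  qed
  let ?X = "kron \<rho> c"
  have X: "?X \<in> carrier_mat ?N ?N" using \<rho>(1) c(1) by (auto simp: kron_def)
  \<comment> \<open>The full output in the product energy basis; both partial traces are read off
    from it.\<close>
  have out: "mcoef ?M ?W (\<Lambda> ?X) (s * dC + z) (s' * dC + z') =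
      (\<Sum>p\<in>RR. \<Sum>t<dC. (\<Sum>x<dC. A p s z x * g t x) * cnj (\<Sum>x<dC. A p s' z' x * g t x))" for s s' z z'
  proof -
    have "mcoef ?M ?W (\<Lambda> ?X) (s * dC + z) (s' * dC + z') = (\<Sum>r<R. \<Sum>i<dS. \<Sum>x<dC. \<Sum>j<dS. \<Sum>y<dC.
        k r s z i x * (mcoef dS u \<rho> i j * mcoef dC w c x y) * cnj (k r s' z' j y))"
      unfolding kraus_mcoef[OF K onU X] sum_mult_split mcoef_kron[OF \<rho>(1) c(1)] R_def[symmetric]
      by (intro sum.cong refl) (simp add: k_def)
    also have "\<dots> = (\<Sum>r<R. \<Sum>i<dS. \<Sum>j<dS. \<Sum>x<dC. \<Sum>y<dC.
        k r s z i x * (mcoef dS u \<rho> i j * mcoef dC w c x y) * cnj (k r s' z' j y))"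
      by (rule sum.cong[OF refl], rule sum.cong[OF refl], rule sum.swap)
    also have "\<dots> = (\<Sum>r<R. \<Sum>x<dC. \<Sum>y<dC. \<Sum>i<dS. \<Sum>j<dS.
        k r s z i x * (mcoef dS u \<rho> i j * mcoef dC w c x y) * cnj (k r s' z' j y))"
      by (rule sum.cong[OF refl], rule sum_swap22)
    also have "\<dots> = (\<Sum>x<dC. \<Sum>y<dC. \<Sum>r<R. \<Sum>i<dS. \<Sum>j<dS.
        k r s z i x * (mcoef dS u \<rho> i j * mcoef dC w c x y) * cnj (k r s' z' j y))"
      by (rule sum_swap21[symmetric])
    also have "\<dots> = (\<Sum>x<dC. \<Sum>y<dC. \<Sum>i<dS. \<Sum>j<dS. \<Sum>r<R.
        k r s z i x * (mcoef dS u \<rho> i j * mcoef dC w c x y) * cnj (k r s' z' j y))"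
      by (rule sum.cong[OF refl], rule sum.cong[OF refl], rule sum_swap21[symmetric])
    also have "\<dots> = (\<Sum>x<dC. \<Sum>y<dC. mcoef dC w c x y * (\<Sum>p\<in>RR. A p s z x * cnj (A p s' z' y)))"
      unfolding AA sum_distrib_left by (intro sum.cong refl) (simp add: mult_ac)
    also have "\<dots> = (\<Sum>x<dC. \<Sum>y<dC. \<Sum>p\<in>RR. A p s z x * mcoef dC w c x y * cnj (A p s' z' y))"
      by (simp add: sum_distrib_left mult_ac)
    also have "\<dots> = (\<Sum>p\<in>RR. \<Sum>x<dC. \<Sum>y<dC. A p s z x * mcoef dC w c x y * cnj (A p s' z' y))"
      by (rule sum_swap21)
    also have "\<dots> = (\<Sum>p\<in>RR. \<Sum>t<dC. (\<Sum>x<dC. A p s z x * g t x) * cnj (\<Sum>x<dC. A p s' z' x * g t x))"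
      unfolding gram_form using g by simp
    finally show ?thesis .
  qed
  have zero: "mcoef dS' u' (ptrace2 dS' dC (\<Lambda> ?X)) s s' = 0"
    if s: "s < dS'" "s' < dS'" "\<epsilon> s - \<epsilon> s' \<notin> V" for s s'
  proof -
    have "(\<Sum>p\<in>RR. \<Sum>t<dC. \<Sum>z<dC. (\<Sum>x<dC. A p s z x * g t x) * cnj (\<Sum>x<dC. A p s' z x * g t x)) = 0"
    proof (rule covariant_catalyst[where \<epsilon>=\<epsilon> and h=h and V=V and m=dS', OF _ V _ _ _ s])
      show "finite RR" by (simp add: RR_def)
    next
      \<comment> \<open>Trace preservation of the operators on C combines that of \<Lambda> with the
        unit trace of \<rho>.\<close>
      fix x y assume xy: "x < dC" "y < dC"
      have "(\<Sum>p\<in>RR. \<Sum>s<dS'. \<Sum>z<dC. A p s z x * cnj (A p s z y)) =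
          (\<Sum>s<dS'. \<Sum>z<dC. \<Sum>p\<in>RR. A p s z x * cnj (A p s z y))"
        by (rule sum_swap21[symmetric])
      also have "\<dots> = (\<Sum>i<dS. \<Sum>j<dS. \<Sum>s<dS'. \<Sum>z<dC. mcoef dS u \<rho> i j * (\<Sum>r<R. k r s z i x * cnj (k r s z j y)))"
        unfolding AA by (rule sum_swap22)
      also have "\<dots> = (\<Sum>i<dS. \<Sum>j<dS. mcoef dS u \<rho> i j * (\<Sum>r<R. \<Sum>s<dS'. \<Sum>z<dC. k r s z i x * cnj (k r s z j y)))"
      proof -
        have "(\<Sum>s<dS'. \<Sum>z<dC. \<Sum>r<R. k r s z i x * cnj (k r s z j y)) =
            (\<Sum>r<R. \<Sum>s<dS'. \<Sum>z<dC. k r s z i x * cnj (k r s z j y))" for i j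
          by (rule sum_swap21)
        then show ?thesis by (simp only: sum_distrib_left[symmetric])
      qed
      also have "\<dots> = (\<Sum>i<dS. \<Sum>j<dS. mcoef dS u \<rho> i j * (if i = j \<and> x = y then 1 else 0))"
        using kTP xy by (intro sum.cong refl) simp
      also have "\<dots> = (if x = y then \<Sum>i<dS. mcoef dS u \<rho> i i else 0)"
        by (auto simp: if_distrib[of "\<lambda>x. _ * x"] cong: if_cong)
      also have "\<dots> = (if x = y then 1 else 0)" using sum_mcoef_diag[OF onS \<rho>(1)] \<rho>(3) by simp
      finally show "(\<Sum>p\<in>RR. \<Sum>s<dS'. \<Sum>z<dC. A p s z x * cnj (A p s z y)) = (if x = y then 1 else 0)" .
    next
      fix s s' z z' x y
      assume b: "s < dS'" "s' < dS'" "z < dC" "z' < dC" "x < dC" "y < dC"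
        and nz: "(\<Sum>p\<in>RR. A p s z x * cnj (A p s' z' y)) \<noteq> 0"
      obtain i j where ij: "i < dS" "j < dS" "mcoef dS u \<rho> i j * (\<Sum>r<R. k r s z i x * cnj (k r s' z' j y)) \<noteq> 0"
        using nz unfolding AA by (metis (no_types, lifting) lessThan_iff sum.neutral)
      then have "E i - E j \<in> V" "\<epsilon> s + h z - (\<epsilon> s' + h z') = E i + h x - (E j + h y)"
        using \<rho>mode kmode b by auto
      moreover from this(2) have "\<epsilon> s + h z - (\<epsilon> s' + h z') - (h x - h y) = E i - E j" by linarith
      ultimately show "\<epsilon> s + h z - (\<epsilon> s' + h z') - (h x - h y) \<in> V" by simp
    next
      \<comment> \<open>Here the catalyst condition enters: tracing out S' returns
        \<open>c\<close>.\<close>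
      fix z z' assume z: "z < dC" "z' < dC"
      have "(\<Sum>t<dC. g t z * cnj (g t z')) = mcoef dC w (ptrace1 dS' dC (\<Lambda> ?X)) z z'"
        using g assms(8) by simp
      also have "\<dots> = (\<Sum>s<dS'. \<Sum>p\<in>RR. \<Sum>t<dC. (\<Sum>x<dC. A p s z x * g t x) * cnj (\<Sum>x<dC. A p s z' x * g t x))"
        unfolding mcoef_ptrace1[OF onS' z] out ..
      also have "\<dots> = (\<Sum>p\<in>RR. \<Sum>s<dS'. \<Sum>t<dC. (\<Sum>x<dC. A p s z x * g t x) * cnj (\<Sum>x<dC. A p s z' x * g t x))"
        by (rule sum.swap)
      finally show "(\<Sum>p\<in>RR. \<Sum>s<dS'. \<Sum>t<dC. (\<Sum>x<dC. A p s z x * g t x) * cnj (\<Sum>x<dC. A p s z' x * g t x))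
          = (\<Sum>t<dC. g t z * cnj (g t z'))" by simp
    qed
    moreover have "mcoef dS' u' (ptrace2 dS' dC (\<Lambda> ?X)) s s' =
        (\<Sum>p\<in>RR. \<Sum>t<dC. \<Sum>z<dC. (\<Sum>x<dC. A p s z x * g t x) * cnj (\<Sum>x<dC. A p s' z x * g t x))"
      unfolding mcoef_ptrace2[OF onC] out by (rule sum_swap21[symmetric])
    ultimately show ?thesis by simp
  qed
  have out_carrier: "ptrace2 dS' dC (\<Lambda> ?X) \<in> carrier_mat dS' dS'" by (simp add: ptrace2_def)
  have "modes HS' (ptrace2 dS' dC (\<Lambda> ?X)) \<subseteq> V"
    unfolding modes_specfun[OF onS' HS' out_carrier] using zero by auto
  then show ?thesis using rat_modes_subset[OF _ V] unfolding V_def by blast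
qed

end
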